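(* Let $K$ be a field, $n \geq 1$, and $A = K[x_1,\ldots,x_n]$ the polynomial ring with each $\deg x_i = 1$. Let $H : \mathbb{N} \to \mathbb{N}$ be a numerical function satisfying $H(0) = 1$, $H(1) \leq n$ and $H(q+1) \leq H(q)^{\langle q \rangle}$ for $q = 1, 2, \ldots$, and suppose that $H$ is noncritical (i.e., not critical). Let $\mathcal{A}_H$ be the set of those integers $0 \leq r \leq n$ for which there exists a homogeneous ideal $I$ of $A$ with $H_{A/I} = H$ and $\operatorname{depth} A/I = r$. Then \[ \mathcal{A}_H = \{0, 1, 2, \ldots, b\}, \] where $b$ is the biggest integer for which $b \in \mathcal{A}_H$.
   Context: $\mathbb{N}$ is the set of nonnegative integers. For a homogeneous ideal $I \neq A$, the Hilbert function of $A/I$ is $H_{A/I}(q) = \dim_K (A/I)_q$. For integers $a \geq 1$ and $q \geq 1$, write the $q$-th Macaulay representation $a = \binom{k_q}{q} + \binom{k_{q-1}}{q-1} + \cdots + \binom{k_j}{j}$ with $k_q > k_{q-1} > \cdots > k_j \geq j \geq 1$ (it is unique), and set $a^{\langle q \rangle} = \binom{k_q+1}{q+1} + \binom{k_{q-1}+1}{q} + \cdots + \binom{k_j+1}{j+1}$; also $0^{\langle q \rangle} = 0$. By Macaulay's theorem, the conditions $H(0)=1$, $H(1)\le n$, $H(q+1) \leq H(q)^{\langle q\rangle}$ for $q \geq 1$ hold if and only if $H = H_{A/I}$ for some homogeneous ideal $I \neq A$ of $A$, and in this case there is a unique lexsegment ideal $I$ of $A$ with $H_{A/I} = H$. The lexicographic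 order $<_{\mathrm{lex}}$ is induced by $x_1 > x_2 > \cdots > x_n$. A monomial ideal $L$ of $A$ is lexsegment if, whenever a monomial $u$ belongs to $L$ and $v$ is a monomial with $\deg v = \deg u$ and $v >_{\mathrm{lex}} u$, one has $v \in L$. For $m \geq 1$ let $A_{[m]} = K[x_1,\ldots,x_{n+m}]$. A lexsegment ideal $L$ of $A$ is universal lexsegment if, for every $m \geq 1$, $L A_{[m]}$ is a lexsegment ideal of $A_{[m]}$. The function $H$ is called critical if the unique lexsegment ideal $I$ of $A$ with $H_{A/I} = H$ is universal lexsegment. *)

theory Defs
  imports
    "HOL-Library.Poly_Mapping"
    "HOL-Library.Extended_Nat"
    "HOL-Algebra.Embedded_Algebras"
    "HOL-Algebra.QuotRing"
begin

section \<open>Polynomial rings\<close>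

text \<open>
  A monomial is its exponent vector. The variables \<open>x\<^sub>1, x\<^sub>2, \<dots>\<close> have the indices
  \<open>0, 1, \<dots>\<close>, and all polynomial rings over \<open>K\<close> live inside one type, so that
  \<open>K[x\<^sub>1,\<dots>,x\<^sub>n]\<close> is a subset of \<open>K[x\<^sub>1,\<dots>,x\<^bsub>n+m\<^esub>]\<close>.
\<close>

type_synonym monomial = "nat \<Rightarrow>\<^sub>0 nat"
type_synonym 'k polynomial = "monomial \<Rightarrow>\<^sub>0 'k"

definition monomials :: "nat \<Rightarrow> monomial set" where
  "monomials n = {u. Poly_Mapping.keys u \<subseteq> {..<n}}"

definition mdeg :: "monomial \<Rightarrow> nat" where
  "mdeg u = (\<Sum>i\<in>Poly_Mapping.keys u. Poly_Mapping.lookup u i)"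

definition monomial_poly :: "monomial \<Rightarrow> 'k::field polynomial" where
  "monomial_poly u = Poly_Mapping.single u 1"

definition const_poly :: "'k::field \<Rightarrow> 'k polynomial" where
  "const_poly c = Poly_Mapping.single 0 c"

definition indet :: "nat \<Rightarrow> 'k::field polynomial" where
  "indet i = monomial_poly (Poly_Mapping.single i 1)"

definition polys :: "nat \<Rightarrow> 'k::field polynomial set" where
  "polys n = {f. Poly_Mapping.keys f \<subseteq> monomials n}"

definition poly_ring :: "nat \<Rightarrow> 'k::field polynomial ring" where
  "poly_ring n = \<lparr>carrier = polys n, mult = (*), one = 1, zero = 0, add = (+)\<rparr>"

lemma polys_closed:
  "0 \<in> polys n" "1 \<in> polys n"
  "f \<in> polys n \<Longrightarrow> - f \<in> polys n"
  "f \<in> polys n \<Longrightarrow> g \<in> polys n \<Longrightarrow> f + g \<in> polys n"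
  "f \<in> polys n \<Longrightarrow> g \<in> polys n \<Longrightarrow> f * g \<in> polys n"
proof -
  show "0 \<in> polys n" "1 \<in> polys n" "f \<in> polys n \<Longrightarrow> - f \<in> polys n"
    by (auto simp: polys_def monomials_def)
  show "f + g \<in> polys n" if "f \<in> polys n" "g \<in> polys n"
    using that Poly_Mapping.keys_add[of f g] by (auto simp: polys_def)
  show "f * g \<in> polys n" if "f \<in> polys n" "g \<in> polys n"
  proof -
    have "a + b \<in> monomials n" if "a \<in> monomials n" "b \<in> monomials n" for a b
      using that Poly_Mapping.keys_add[of a b] by (auto simp: monomials_def)
    with that show ?thesis
      using keys_mult[of f g] by (fastforce simp: polys_def)
  qed
qed

lemma cring_poly_ring: "cring (poly_ring n)"
proof (rule cringI)
  show "abelian_group (poly_ring n)"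
    by (rule abelian_groupI)
      (auto simp: poly_ring_def polys_closed ac_simps intro!: bexI[of _ "- _"])
  show "comm_monoid (poly_ring n)"
    by (rule comm_monoidI) (auto simp: poly_ring_def polys_closed ac_simps)
qed (auto simp: poly_ring_def algebra_simps)

definition homogeneous :: "nat \<Rightarrow> 'k::field polynomial \<Rightarrow> bool" where
  "homogeneous q f \<longleftrightarrow> (\<forall>u\<in>Poly_Mapping.keys f. mdeg u = q)"

definition homogeneous_ideal :: "nat \<Rightarrow> 'k::field polynomial set \<Rightarrow> bool" where
  "homogeneous_ideal n I \<longleftrightarrow>
     (\<exists>F \<subseteq> polys n. (\<forall>f\<in>F. \<exists>q. homogeneous q f) \<and> I = Idl\<^bsub>poly_ring n\<^esub> F)"


section \<open>Hilbert functions\<close>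

definition quot_class :: "nat \<Rightarrow> 'k::field polynomial set \<Rightarrow> 'k polynomial \<Rightarrow> 'k polynomial set" where
  "quot_class n I f = I +>\<^bsub>poly_ring n\<^esub> f"

text \<open>
  \<open>dim\<^sub>K (A/I)\<^sub>q\<close>, computed inside the ring \<open>A/I\<close>: for \<open>I \<noteq> A\<close> the field \<open>K\<close> is identified with
  the subfield of \<open>A/I\<close> formed by the classes of the constants. (For \<open>I = A\<close> the value is 0 in
  every degree, so \<open>H 0 = 1\<close> excludes this case.)
\<close>

definition hilbert_function :: "nat \<Rightarrow> 'k::field polynomial set \<Rightarrow> nat \<Rightarrow> nat" where
  "hilbert_function n I q =
     ring.dim (poly_ring n Quot I)
       (quot_class n I ` range const_poly)
       (quot_class n I ` {f \<in> polys n. homogeneous q f})"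

definition macaulay_rep :: "nat \<Rightarrow> nat \<Rightarrow> (nat \<Rightarrow> nat) \<Rightarrow> nat \<Rightarrow> bool" where
  "macaulay_rep a q k j \<longleftrightarrow>
     1 \<le> j \<and> j \<le> q \<and> j \<le> k j \<and> (\<forall>i. j \<le> i \<and> i < q \<longrightarrow> k i < k (i + 1)) \<and>
     a = (\<Sum>i=j..q. k i choose i)"

definition macaulay_upper :: "nat \<Rightarrow> nat \<Rightarrow> nat" where
  "macaulay_upper a q =
     (if a = 0 then 0
      else THE b. \<exists>k j. macaulay_rep a q k j \<and> b = (\<Sum>i=j..q. (k i + 1) choose (i + 1)))"


section \<open>Depth\<close>

definition regular_sequence :: "('a, 'b) ring_scheme \<Rightarrow> 'a list \<Rightarrow> bool" where
  "regular_sequence R fs \<longleftrightarrow>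
     set fs \<subseteq> carrier R \<and>
     (\<forall>i<length fs. \<forall>g\<in>carrier R.
        fs ! i \<otimes>\<^bsub>R\<^esub> g \<in> Idl\<^bsub>R\<^esub> (set (take i fs)) \<longrightarrow> g \<in> Idl\<^bsub>R\<^esub> (set (take i fs))) \<and>
     Idl\<^bsub>R\<^esub> (set fs) \<noteq> carrier R"

text \<open>The supremum of the lengths of the regular sequences on \<open>R\<close> whose members lie in \<open>J\<close>.\<close>

definition ring_depth :: "('a, 'b) ring_scheme \<Rightarrow> 'a set \<Rightarrow> enat" where
  "ring_depth R J = (SUP fs \<in> {fs. set fs \<subseteq> J \<and> regular_sequence R fs}. enat (length fs))"

text \<open>
  The depth of \<open>A/I\<close> is taken with respect to the graded maximal ideal \<open>(x\<^sub>1,\<dots>,x\<^sub>n)\<close>; since an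
  element of \<open>A\<close> acts on \<open>A/I\<close> through its class, regular sequences may be taken in the ring \<open>A/I\<close>.
\<close>

definition depth :: "nat \<Rightarrow> 'k::field polynomial set \<Rightarrow> enat" where
  "depth n I =
     ring_depth (poly_ring n Quot I) (quot_class n I ` (Idl\<^bsub>poly_ring n\<^esub> (indet ` {..<n})))"


section \<open>Lexsegment ideals and critical functions\<close>

definition monomial_ideal :: "nat \<Rightarrow> 'k::field polynomial set \<Rightarrow> bool" where
  "monomial_ideal n I \<longleftrightarrow> (\<exists>U \<subseteq> monomials n. I = Idl\<^bsub>poly_ring n\<^esub> (monomial_poly ` U))"

text \<open>
  \<open>u <\<^bsub>lex\<^esub> v\<close> iff at the smallest index where the exponents differ, the one of \<open>v\<close> is larger;
  hence \<open>x\<^sub>1 > x\<^sub>2 > \<dots>\<close>.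
\<close>

definition lex_less :: "monomial \<Rightarrow> monomial \<Rightarrow> bool" where
  "lex_less u v \<longleftrightarrow>
     (\<exists>i. Poly_Mapping.lookup u i < Poly_Mapping.lookup v i \<and>
          (\<forall>j<i. Poly_Mapping.lookup u j = Poly_Mapping.lookup v j))"

lemma lex_less_iff_less: "lex_less u v \<longleftrightarrow> u < v"
  by (simp add: lex_less_def less_poly_mapping.rep_eq less_fun_def)

definition lexsegment_ideal :: "nat \<Rightarrow> 'k::field polynomial set \<Rightarrow> bool" where
  "lexsegment_ideal n L \<longleftrightarrow>
     monomial_ideal n L \<and>
     (\<forall>u\<in>monomials n. \<forall>v\<in>monomials n.
        monomial_poly u \<in> L \<and> mdeg v = mdeg u \<and> lex_less u v \<longrightarrow> monomial_poly v \<in> L)"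

definition universal_lexsegment_ideal :: "nat \<Rightarrow> 'k::field polynomial set \<Rightarrow> bool" where
  "universal_lexsegment_ideal n L \<longleftrightarrow>
     lexsegment_ideal n L \<and> (\<forall>m\<ge>1. lexsegment_ideal (n + m) (Idl\<^bsub>poly_ring (n + m)\<^esub> L))"

text \<open>The lexsegment ideal with a given Hilbert function is unique if it exists.\<close>

definition critical :: "'k::field itself \<Rightarrow> nat \<Rightarrow> (nat \<Rightarrow> nat) \<Rightarrow> bool" where
  "critical (_ :: 'k itself) n H \<longleftrightarrow>
     (\<exists>L :: 'k polynomial set.
        lexsegment_ideal n L \<and> hilbert_function n L = H \<and> universal_lexsegment_ideal n L)"

definition depth_set :: "'k::field itself \<Rightarrow> nat \<Rightarrow> (nat \<Rightarrow> nat) \<Rightarrow> nat set" where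
  "depth_set (_ :: 'k itself) n H =
     {r. r \<le> n \<and>
         (\<exists>I :: 'k polynomial set.
            homogeneous_ideal n I \<and> hilbert_function n I = H \<and> depth n I = enat r)}"

end

theory Submission
  imports Defs "HOL-Computational_Algebra.Polynomial_Factorial"
begin

text \<open>
  Let \<open>I\<close> have Hilbert function \<open>H\<close> and \<open>depth A/I = b\<close>, and let \<open>r < b\<close>. The forms
  \<open>\<xi>\<^sub>j = \<Sum>\<^sub>i t\<^sub>j\<^sup>i x\<^sub>i\<close> with independent parameters \<open>t\<^sub>j\<close> make up a regular sequence
  of length \<open>r\<close> on \<open>A/I\<close>. Dividing by them over \<open>K(t\<^sub>1, t\<^sub>2, \<dots>)\<close> and taking leading monomials
  shows that the \<open>r\<close>-fold difference function of \<open>H\<close> is the Hilbert function of a monomial ideal, so it satisfies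
  Macaulay's numerical condition and belongs to a lexsegment ideal \<open>L\<close> in \<open>n - r\<close> variables. The extension
  \<open>LA\<close> has Hilbert function \<open>H\<close>. If the socle of the quotient by \<open>L\<close> were zero, all extensions of \<open>L\<close>
  would be lexsegment ideals and \<open>H\<close> would be critical; so it is nonzero and \<open>depth A/LA = r\<close>. Regular sequences
  need not consist of forms of \<open>A\<close>, so they are compared with the generic sequence: if \<open>A/I\<close> has any
  regular sequence of length \<open>k\<close> in the irrelevant ideal, then \<open>k\<close> generic forms are regular as well, and
  dividing by one more regular element costs exactly one generic form.
\<close>

text \<open>Two obstacles shape the argument. The field may be finite, so a linear form of
  \<open>A\<close> that is regular on \<open>A/I\<close> need not exist even when the depth is
  positive. Variables of index at least \<open>n\<close>, available in the same type, therefore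
  serve as parameters, and generated ideals are mostly taken in the ring of all variables. Passing
  to the fraction field of the parameters changes the ground field, but only the numbers of standard
  monomials are carried back to \<open>K\<close>. The other obstacle is that Macaulay's bound is
  needed for the difference function of \<open>H\<close>, together with the converse existence
  statement; both are proved for sets of monomials by compression, before any polynomial occurs. The
  case \<open>r = 0\<close> is the lexsegment ideal belonging to \<open>H\<close> itself, so the set
  of depths is never empty, and \<open>r < b\<close> leaves at least one variable for
  \<open>L\<close>. A nonzero socle is always exhibited by a monomial \<open>w\<close> outside
  \<open>L\<close> all of whose multiples \<open>w x_i\<close> lie in \<open>L\<close>.\<close>

abbreviation lookup where "lookup \<equiv> Poly_Mapping.lookup"
abbreviation keys where "keys \<equiv> Poly_Mapping.keys"
abbreviation single where "single \<equiv> Poly_Mapping.single"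

section \<open>Upper sets of finite linear orders\<close>

text \<open>The order of the type \<open>monomial\<close> is the lexicographic one, with larger
  variables at smaller indices, so the upsets of the set of all monomials of one degree are the
  lexsegments. Below, \<open>x_i\<close> stands for \<open>var i\<close>.\<close>

definition upset :: "'a::linorder set \<Rightarrow> 'a set \<Rightarrow> bool" where
  "upset A L \<longleftrightarrow> L \<subseteq> A \<and> (\<forall>u\<in>L. \<forall>v\<in>A. u < v \<longrightarrow> v \<in> L)"

definition topk :: "'a::linorder set \<Rightarrow> nat \<Rightarrow> 'a set" where
  "topk A k = (SOME L. upset A L \<and> card L = k)"

lemma upset_exists:
  assumes "finite A" "k \<le> card A"
  shows "\<exists>L. upset A L \<and> card L = k"
  using assms(2)
proof (induction k)
  case 0
  show ?case by (rule exI[of _ "{}"]) (auto simp: upset_def)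
next
  case (Suc k)
  then obtain L where L: "upset A L" "card L = k" by auto
  have LA: "L \<subseteq> A" using L by (auto simp: upset_def)
  have ne: "A - L \<noteq> {}"
  proof
    assume "A - L = {}"
    then have "A = L" using LA by auto
    with L Suc.prems show False by auto
  qed
  let ?m = "Max (A - L)"
  have m: "?m \<in> A - L" using ne assms(1) by (intro Max_in) auto
  have mx: "v \<le> ?m" if "v \<in> A - L" for v using that assms(1) by (intro Max_ge) auto
  have "upset A (insert ?m L)" unfolding upset_def
  proof (intro conjI ballI impI)
    show "insert ?m L \<subseteq> A" using m LA by auto
    fix u v assume "u \<in> insert ?m L" "v \<in> A" "u < v"
    then show "v \<in> insert ?m L" using mx[of v] L(1) unfolding upset_def
      by (metis Diff_iff insert_iff leD)
  qed
  moreover have "card (insert ?m L) = Suc k"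
    using m L finite_subset[OF LA assms(1)] by simp
  ultimately show ?case by blast
qed

lemma topk:
  assumes "finite A" "k \<le> card A"
  shows "upset A (topk A k)" "card (topk A k) = k"
  using someI_ex[OF upset_exists[OF assms]] by (auto simp: topk_def)

lemma upset_linear:
  assumes "upset A L" "upset A M"
  shows "L \<subseteq> M \<or> M \<subseteq> L"
  using assms unfolding upset_def by (metis linorder_neqE subset_iff)

lemma upset_subset_if_card_le:
  assumes "finite A" "upset A L" "upset A M" "card L \<le> card M"
  shows "L \<subseteq> M"
proof -
  have "finite L" using assms by (auto simp: upset_def intro: finite_subset)
  with upset_linear[OF assms(2,3)] show ?thesis using assms(4) by (metis card_seteq order_refl)
qed

lemma upset_Un_card:
  assumes "finite A" "upset A L" "upset A M"
  shows "card (L \<union> M) = max (card L) (card M)"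
proof -
  have f: "finite L" "finite M" using assms by (auto simp: upset_def intro: finite_subset)
  from upset_linear[OF assms(2,3)] show ?thesis
  proof
    assume "L \<subseteq> M" then show ?thesis using card_mono[OF f(2), of L] by (simp add: Un_absorb1)
  next
    assume "M \<subseteq> L" then show ?thesis using card_mono[OF f(1), of M] by (simp add: Un_absorb2)
  qed
qed

text \<open>Every element of \<open>S - T\<close> lies below every element of \<open>T - S\<close>,
  since \<open>T\<close> is closed upwards, and the two differences have the same size. The maximum
  \<open>m\<close> of \<open>w\<close> on \<open>S - T\<close> separates the two sums.\<close>

lemma sum_less_sum_upset:
  fixes w :: "'a::linorder \<Rightarrow> nat"
  assumes "finite A" "upset A T" "S \<subseteq> A" "card S = card T"
    and mono: "\<And>u v. u \<in> A \<Longrightarrow> v \<in> A \<Longrightarrow> u < v \<Longrightarrow> w u < w v"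
  shows "sum w S \<le> sum w T" "S \<noteq> T \<Longrightarrow> sum w S < sum w T"
proof -
  have TA: "T \<subseteq> A" using assms by (auto simp: upset_def)
  have f: "finite S" "finite T" using assms TA by (auto intro: finite_subset)
  show lt: "sum w S < sum w T" if "S \<noteq> T"
  proof -
    have c: "card (S - T) = card (T - S)"
      using assms(4) f by (simp add: card_Diff_subset_Int Int_commute)
    have ne: "S - T \<noteq> {}"
    proof
      assume "S - T = {}"
      then have "S \<subseteq> T" by auto
      then show False using that assms(4) f by (metis card_subset_eq)
    qed
    define m where "m = Max (w ` (S - T))"
    have a: "w s \<le> m" if "s \<in> S - T" for s unfolding m_def using that f by auto
    have "m \<in> w ` (S - T)" unfolding m_def using ne f by (intro Max_in) auto
    then obtain s0 where s0: "s0 \<in> S - T" "m = w s0" by auto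
    have b: "m < w t" if t: "t \<in> T - S" for t
    proof -
      have "s0 < t" using t s0 assms(2,3) unfolding upset_def
        by (metis DiffD1 DiffD2 linorder_neqE subsetD)
      then show ?thesis using mono[of s0 t] s0 t assms(3) TA by auto
    qed
    have "sum w (S - T) \<le> card (S - T) * m" using sum_bounded_above[of "S-T" w m] a by simp
    also have "\<dots> = card (T - S) * m" using c by simp
    also have "\<dots> = (\<Sum>t\<in>T-S. m)" by simp
    also have "\<dots> < sum w (T - S)"
    proof (rule sum_strict_mono)
      show "T - S \<noteq> {}" using c ne f by (metis card_eq_0_iff finite_Diff)
    qed (use f b in auto)
    finally have "sum w (S - T) < sum w (T - S)" .
    moreover have "sum w S = sum w (S - T) + sum w (S \<inter> T)"
      using f by (metis sum.Int_Diff add.commute)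
    moreover have "sum w T = sum w (T - S) + sum w (S \<inter> T)"
      using f by (metis sum.Int_Diff add.commute Int_commute)
    ultimately show ?thesis by simp
  qed
  then show "sum w S \<le> sum w T" by (cases "S = T") (auto intro: less_imp_le)
qed

section \<open>Monomials of a fixed degree\<close>

definition var :: "nat \<Rightarrow> monomial" where "var i = single i 1"

lemma lookup_var: "lookup (var i) j = (if i = j then 1 else 0)"
  by (simp add: var_def lookup_single when_def)

lemma keys_var [simp]: "keys (var i) = {i}" by (simp add: var_def)

text \<open>The variables form an arbitrary set of indices because the inductions below delete a
  variable at any position, not only the last one.\<close>

definition mons :: "nat set \<Rightarrow> nat \<Rightarrow> monomial set" where
  "mons X q = {u. keys u \<subseteq> X \<and> mdeg u = q}"

lemma mdeg_eq_sum: "finite X \<Longrightarrow> keys u \<subseteq> X \<Longrightarrow> mdeg u = (\<Sum>i\<in>X. lookup u i)"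
  unfolding mdeg_def by (rule sum.mono_neutral_left) (auto simp: in_keys_iff)

lemma mdeg_add [simp]: "mdeg (u + v) = mdeg u + mdeg v"
proof -
  let ?X = "keys u \<union> keys v"
  have "mdeg (u + v) = (\<Sum>i\<in>?X. lookup (u + v) i)"
    using Poly_Mapping.keys_add[of u v] by (intro mdeg_eq_sum) auto
  also have "\<dots> = (\<Sum>i\<in>?X. lookup u i) + (\<Sum>i\<in>?X. lookup v i)"
    by (simp add: lookup_add sum.distrib)
  also have "\<dots> = mdeg u + mdeg v" by (simp add: mdeg_eq_sum[symmetric])
  finally show ?thesis .
qed

lemma mdeg_zero [simp]: "mdeg 0 = 0" by (simp add: mdeg_def)

lemma mdeg_single [simp]: "mdeg (single i k) = k"
  by (cases "k = 0") (auto simp: mdeg_def)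

lemma mdeg_var [simp]: "mdeg (var i) = 1" by (simp add: var_def)

lemma mdeg_eq_0_iff: "mdeg u = 0 \<longleftrightarrow> u = 0"
  by (auto simp: mdeg_def in_keys_iff intro!: poly_mapping_eqI)

lemma keys_add_nat: "keys (u + v) = keys u \<union> keys (v :: monomial)"
  by (auto simp: in_keys_iff lookup_add)

lemma keys_single_subset: "keys (single i k) \<subseteq> {i}" by auto

lemma finite_mons [simp]: "finite X \<Longrightarrow> finite (mons X q)"
proof -
  assume X: "finite X"
  let ?F = "{f. \<forall>i. (i \<in> X \<longrightarrow> f i \<in> {..q}) \<and> (i \<notin> X \<longrightarrow> f i = (0::nat))}"
  have "finite ?F" using X by (intro finite_set_of_finite_funs) auto
  moreover have "lookup ` mons X q \<subseteq> ?F"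
  proof (rule image_subsetI)
    fix u assume u: "u \<in> mons X q"
    have "lookup u i \<le> q" if "i \<in> X" for i
      using u X that member_le_sum[of i X "lookup u"] by (auto simp: mons_def mdeg_eq_sum)
    then show "lookup u \<in> ?F" using u by (auto simp: mons_def in_keys_iff)
  qed
  ultimately have "finite (lookup ` mons X q)" by (rule finite_subset[rotated])
  then show ?thesis by (rule finite_imageD) (simp add: inj_on_def lookup_inject)
qed

lemma monomial_less_iff:
  "u < v \<longleftrightarrow> (\<exists>i. lookup u i < lookup v i \<and> (\<forall>j<i. lookup u j = lookup v j))" for u v :: monomial
  by (simp add: lex_less_iff_less[symmetric] lex_less_def)

lemma var_less_iff: "var i < var j \<longleftrightarrow> j < i"
  by (cases i j rule: linorder_cases)
     (force simp: monomial_less_iff lookup_var split: if_splits)+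

lemma monomial_lookup_split:
  fixes u :: monomial
  obtains w where "u = w + single k (lookup u k)" "lookup w k = 0"
proof
  show "u = (u - single k (lookup u k)) + single k (lookup u k)"
    by (rule poly_mapping_eqI) (auto simp: lookup_add lookup_minus lookup_single when_def)
  show "lookup (u - single k (lookup u k)) k = 0" by (simp add: lookup_minus)
qed

lemma monomial_split_var:
  fixes u :: monomial
  assumes "k \<in> keys u"
  obtains w where "u = w + var k"
proof
  show "u = (u - var k) + var k"
    using assms by (intro poly_mapping_eqI) (auto simp: lookup_add lookup_minus lookup_var in_keys_iff)
qed

lemma mons_add_var: "u \<in> mons X q \<Longrightarrow> i \<in> X \<Longrightarrow> u + var i \<in> mons X (Suc q)"
  by (auto simp: mons_def keys_add_nat)

text \<open>If \<open>V\<close> consists of monomials of degree \<open>q\<close> in the variables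
  \<open>X\<close>, these are the monomials of degree \<open>q + 1\<close> in the ideal generated by
  \<open>V\<close>.\<close>

definition shade :: "nat set \<Rightarrow> monomial set \<Rightarrow> monomial set" where
  "shade X V = (\<Union>i\<in>X. (\<lambda>u. u + var i) ` V)"

lemma shade_mons: "V \<subseteq> mons X q \<Longrightarrow> shade X V \<subseteq> mons X (Suc q)"
  using mons_add_var by (fastforce simp: shade_def)

lemma shade_mono: "V \<subseteq> W \<Longrightarrow> shade X V \<subseteq> shade X W"
  by (auto simp: shade_def)

lemma finite_shade: "finite X \<Longrightarrow> finite V \<Longrightarrow> finite (shade X V)"
  by (auto simp: shade_def)

text \<open>Dividing \<open>v\<close> by its last variable \<open>x_m\<close> gives a
  \<open>v'\<close> that has to lie in \<open>L\<close>, which is clear if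
  \<open>u \<le> v'\<close>. Otherwise \<open>z < v\<close> forces \<open>m < i\<close>, while the
  first index at which \<open>v'\<close> falls short of \<open>u\<close> is at most
  \<open>m\<close>; together they give \<open>v < z\<close>.\<close>

lemma shade_upset:
  assumes X: "finite X" and L: "upset (mons X q) L"
  shows "upset (mons X (Suc q)) (shade X L)"
  unfolding upset_def
proof (intro conjI ballI impI)
  show "shade X L \<subseteq> mons X (Suc q)" using L shade_mons by (auto simp: upset_def)
  fix z v assume z: "z \<in> shade X L" and v: "v \<in> mons X (Suc q)" and zv: "z < v"
  from z obtain u i where u: "u \<in> L" "i \<in> X" "z = u + var i" by (auto simp: shade_def)
  have um: "u \<in> mons X q" using L u by (auto simp: upset_def)
  have "keys v \<noteq> {}" using v by (auto simp: mons_def)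
  define m where "m = Max (keys v)"
  have m: "m \<in> keys v" unfolding m_def using \<open>keys v \<noteq> {}\<close> by (intro Max_in) auto
  have mx: "lookup v l = 0" if "m < l" for l
    using that Max_ge[of "keys v" l] unfolding m_def
    by (metis finite_keys in_keys_iff leD)
  obtain v' where v': "v = v' + var m" using monomial_split_var[OF m] by blast
  have v'm: "v' \<in> mons X q" using v v' by (auto simp: mons_def keys_add_nat)
  have mX: "m \<in> X" using m v by (auto simp: mons_def)
  have "v' \<in> L"
  proof (cases "u \<le> v'")
    case True
    then show ?thesis using L u v'm unfolding upset_def by (metis order_le_less)
  next
    case False
    then have lt: "v' < u" by simp
    then have "v' + var m < u + var m" by simp
    moreover have "u + var i < v' + var m" using zv v' u by simp
    ultimately have "u + var i < u + var m" by (rule order_less_trans[rotated])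
    then have mi: "m < i" by (simp add: var_less_iff)
    from lt obtain j where j: "lookup v' j < lookup u j" "\<And>l. l < j \<Longrightarrow> lookup v' l = lookup u l"
      by (auto simp: monomial_less_iff)
    have v'0: "lookup v' l = 0" if "m < l" for l
      using mx[OF that] v' by (auto simp: lookup_add lookup_var)
    \<comment> \<open>For \<open>j > m\<close> the exponents of \<open>v'\<close>, which vanish
      beyond \<open>m\<close>, would be bounded by those of \<open>u\<close> with strict inequality
      at \<open>j\<close>, against equal degrees.\<close>
    have jm: "j \<le> m"
    proof (rule ccontr)
      assume "\<not> j \<le> m"
      have "lookup v' l \<le> lookup u l" for l
        using j(2)[of l] v'0[of l] \<open>\<not> j \<le> m\<close> by (cases "l < j") auto
      moreover have "j \<in> X" using j(1) um by (force simp: mons_def in_keys_iff)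
      ultimately have "(\<Sum>l\<in>X. lookup v' l) < (\<Sum>l\<in>X. lookup u l)"
        using X j(1) by (intro sum_strict_mono_ex1) auto
      then show False using um v'm X by (auto simp: mons_def mdeg_eq_sum)
    qed
    have eq: "lookup v l = lookup z l" if "l < j" for l
      using that jm mi j(2)[of l] by (simp add: v' u lookup_add lookup_var)
    have "lookup v j \<le> lookup z j" using j(1) jm mi by (auto simp: v' u lookup_add lookup_var)
    moreover have "lookup v j \<noteq> lookup z j" if "j < m"
      using j(1) that mi by (auto simp: v' u lookup_add lookup_var)
    moreover have "v < z" if "lookup v j < lookup z j" using eq that by (auto simp: monomial_less_iff)
    \<comment> \<open>Equality at \<open>j = m\<close> leaves a difference only behind
      \<open>m\<close>, where \<open>v\<close> has exponent 0 and \<open>z\<close> contains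
      \<open>x_i\<close>.\<close>
    moreover have "v < z" if "j = m" "lookup v j = lookup z j"
    proof -
      have "lookup v l \<le> lookup z l" for l
        using eq[of l] that mx[of l] by (cases l j rule: linorder_cases) auto
      moreover have "lookup v i < lookup z i" using mx[OF mi] by (simp add: u lookup_add lookup_var)
      ultimately have "\<exists>l. lookup v l < lookup z l \<and> (\<forall>k<l. \<not> lookup v k < lookup z k)"
        using exists_least_iff[of "\<lambda>l. lookup v l < lookup z l"] by blast
      then show ?thesis using \<open>\<And>l. lookup v l \<le> lookup z l\<close> unfolding monomial_less_iff
        by (meson order_le_less)
    qed
    ultimately show ?thesis using jm zv by force
  qed
  then show "v \<in> shade X L" using v' mX by (auto simp: shade_def)
qed

section \<open>Macaulay's theorem for sets of monomials\<close>

definition slice :: "nat \<Rightarrow> nat \<Rightarrow> monomial set \<Rightarrow> monomial set" where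
  "slice k j V = {w. lookup w k = 0 \<and> w + single k j \<in> V}"

lemma lookup_slice_elt: "lookup w k = 0 \<Longrightarrow> lookup (w + single k j) k = j"
  by (simp add: lookup_add)

lemma add_single_inject:
  fixes w w' :: monomial
  assumes w: "lookup w k = 0" "lookup w' k = 0"
  shows "w + single k j = w' + single k j' \<longleftrightarrow> w = w' \<and> j = j'"
proof
  assume e: "w + single k j = w' + single k j'"
  then have "j = j'" using lookup_slice_elt w by metis
  then show "w = w' \<and> j = j'" using e add_right_imp_eq by metis
qed simp

lemma slice_mons:
  assumes "V \<subseteq> mons X q"
  shows "slice k j V \<subseteq> mons (X - {k}) (q - j)" "slice k j V \<noteq> {} \<Longrightarrow> j \<le> q"
proof -
  show "slice k j V \<subseteq> mons (X - {k}) (q - j)"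
  proof
    fix w assume "w \<in> slice k j V"
    then have w: "lookup w k = 0" "w + single k j \<in> mons X q" using assms by (auto simp: slice_def)
    then have "keys w \<subseteq> X" "mdeg w + j = q" by (auto simp: mons_def keys_add_nat)
    then show "w \<in> mons (X - {k}) (q - j)" using w(1) by (auto simp: mons_def in_keys_iff)
  qed
  assume "slice k j V \<noteq> {}"
  then obtain w where "w + single k j \<in> mons X q" using assms by (auto simp: slice_def)
  then show "j \<le> q" by (auto simp: mons_def)
qed

lemma mons_lookup_zero: "w \<in> mons (X - {k}) q \<Longrightarrow> lookup w k = 0"
  by (auto simp: mons_def in_keys_iff)

lemma mons_add_single:
  "k \<in> X \<Longrightarrow> j \<le> q \<Longrightarrow> w \<in> mons (X - {k}) (q - j) \<Longrightarrow> w + single k j \<in> mons X q"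
  using keys_single_subset[of k j] by (auto simp: mons_def keys_add_nat)

lemma slice_decomp:
  assumes "V \<subseteq> mons X q"
  shows "V = (\<Union>j\<le>q. (\<lambda>w. w + single k j) ` slice k j V)"
proof (intro equalityI subsetI)
  fix u assume u: "u \<in> V"
  obtain w where w: "u = w + single k (lookup u k)" "lookup w k = 0" by (rule monomial_lookup_split)
  have "mdeg u = q" using u assms by (auto simp: mons_def)
  then have "lookup u k \<le> q" using w(1) by (metis le_add2 mdeg_add mdeg_single)
  then show "u \<in> (\<Union>j\<le>q. (\<lambda>w. w + single k j) ` slice k j V)"
    using w u by (auto simp: slice_def intro!: bexI[of _ "lookup u k"] image_eqI[of _ _ w])
qed (auto simp: slice_def)

lemma sum_slices:
  fixes f :: "monomial \<Rightarrow> nat"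
  assumes "finite X" "V \<subseteq> mons X q"
  shows "sum f V = (\<Sum>j\<le>q. \<Sum>w\<in>slice k j V. f (w + single k j))"
proof -
  have fin: "finite (slice k j V)" for j
    using slice_mons(1)[OF assms(2), of k j] assms(1) by (auto intro: finite_subset)
  have "sum f V = sum f (\<Union>j\<in>{..q}. (\<lambda>w. w + single k j) ` slice k j V)"
    using slice_decomp[OF assms(2)] by simp
  also have "\<dots> = (\<Sum>j\<le>q. sum f ((\<lambda>w. w + single k j) ` slice k j V))"
    using fin by (intro sum.UNION_disjoint) (auto simp: slice_def add_single_inject)
  also have "\<dots> = (\<Sum>j\<le>q. \<Sum>w\<in>slice k j V. f (w + single k j))"
    by (intro sum.cong refl sum.reindex[unfolded comp_def]) (auto simp: inj_on_def)
  finally show ?thesis .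
qed

lemma card_slices:
  assumes "finite X" "V \<subseteq> mons X q"
  shows "card V = (\<Sum>j\<le>q. card (slice k j V))"
  using sum_slices[OF assms, of "\<lambda>_. 1" k] by simp

text \<open>Compression in the style of Clements and Lindstroem: the slice at each exponent of
  \<open>x_k\<close> is replaced by the lexsegment of the same size in the remaining
  variables.\<close>

definition compress :: "nat set \<Rightarrow> nat \<Rightarrow> nat \<Rightarrow> monomial set \<Rightarrow> monomial set" where
  "compress X q k V = (\<Union>j\<le>q. (\<lambda>w. w + single k j) ` topk (mons (X - {k}) (q - j)) (card (slice k j V)))"

lemma topk_slice:
  assumes "finite X" "V \<subseteq> mons X q"
  shows "upset (mons (X - {k}) (q - j)) (topk (mons (X - {k}) (q - j)) (card (slice k j V)))"
    "card (topk (mons (X - {k}) (q - j)) (card (slice k j V))) = card (slice k j V)"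
proof -
  have f: "finite (mons (X - {k}) (q - j))" using assms(1) by simp
  have "card (slice k j V) \<le> card (mons (X - {k}) (q - j))"
    by (rule card_mono[OF f slice_mons(1)[OF assms(2)]])
  from topk[OF f this]
  show "upset (mons (X - {k}) (q - j)) (topk (mons (X - {k}) (q - j)) (card (slice k j V)))"
    "card (topk (mons (X - {k}) (q - j)) (card (slice k j V))) = card (slice k j V)" .
qed

lemma slice_compress:
  assumes "finite X" "V \<subseteq> mons X q" "j \<le> q"
  shows "slice k j (compress X q k V) = topk (mons (X - {k}) (q - j)) (card (slice k j V))"
proof -
  have z: "lookup w k = 0" if "w \<in> topk (mons (X - {k}) (q - i)) (card (slice k i V))" for w i
    using that topk_slice(1)[OF assms(1,2), of k i] by (auto simp: upset_def mons_lookup_zero)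
  show ?thesis
  proof (intro equalityI subsetI)
    fix w assume "w \<in> slice k j (compress X q k V)"
    then obtain i w' where "lookup w k = 0" "w + single k j = w' + single k i"
        "w' \<in> topk (mons (X - {k}) (q - i)) (card (slice k i V))"
      by (auto simp: slice_def compress_def)
    then show "w \<in> topk (mons (X - {k}) (q - j)) (card (slice k j V))"
      using add_single_inject z by metis
  next
    fix w assume "w \<in> topk (mons (X - {k}) (q - j)) (card (slice k j V))"
    then show "w \<in> slice k j (compress X q k V)"
      using z[of w j] assms(3) by (auto simp: slice_def compress_def)
  qed
qed

lemma compress_mons:
  assumes "finite X" "k \<in> X" "V \<subseteq> mons X q"
  shows "compress X q k V \<subseteq> mons X q"
proof
  fix u assume "u \<in> compress X q k V"
  then obtain j w where j: "j \<le> q" "u = w + single k j"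
      "w \<in> topk (mons (X - {k}) (q - j)) (card (slice k j V))"
    by (auto simp: compress_def)
  then have "w \<in> mons (X - {k}) (q - j)"
    using topk_slice(1)[OF assms(1,3), of k j] by (auto simp: upset_def)
  then show "u \<in> mons X q" using mons_add_single[OF assms(2) j(1)] j(2) by simp
qed

lemma card_compress:
  assumes "finite X" "k \<in> X" "V \<subseteq> mons X q"
  shows "card (compress X q k V) = card V"
  unfolding card_slices[OF assms(1) compress_mons[OF assms], of k] card_slices[OF assms(1,3), of k]
  using topk_slice(2)[OF assms(1,3)] slice_compress[OF assms(1,3)] by (intro sum.cong) auto

lemma slice_shade:
  assumes "k \<in> X"
  shows "slice k j (shade X V) =
    shade (X - {k}) (slice k j V) \<union> (if j = 0 then {} else slice k (j - 1) V)"
proof (intro equalityI subsetI)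
  fix w assume "w \<in> slice k j (shade X V)"
  then obtain u i where u: "lookup w k = 0" "w + single k j = u + var i" "i \<in> X" "u \<in> V"
    by (auto simp: slice_def shade_def)
  show "w \<in> shade (X - {k}) (slice k j V) \<union> (if j = 0 then {} else slice k (j - 1) V)"
  proof (cases "i = k")
    case True
    have "j = lookup u k + 1" using u(1,2) True
      by (metis lookup_add lookup_slice_elt lookup_var)
    then have j: "j \<noteq> 0" "single k j = single k (j - 1) + var k"
      by (auto simp: var_def single_add[symmetric])
    then have "w + single k (j - 1) = u"
      using u(2) True by (metis add.assoc add_right_cancel)
    then show ?thesis using u j by (auto simp: slice_def)
  next
    case False
    have "i \<in> keys (w + single k j)" using u(2) by (simp add: keys_add_nat)
    then have "i \<in> keys w" using False by (auto simp: keys_add_nat split: if_splits)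
    then obtain w' where w': "w = w' + var i" by (rule monomial_split_var)
    have "lookup w' k = 0" using u(1) w' by (simp add: lookup_add)
    moreover have "w' + single k j = u"
      using u(2) w' by (metis add.assoc add.commute add_right_cancel)
    ultimately have "w' \<in> slice k j V" using u by (simp add: slice_def)
    then show ?thesis using u False w' by (auto simp: shade_def)
  qed
next
  fix w assume "w \<in> shade (X - {k}) (slice k j V) \<union> (if j = 0 then {} else slice k (j - 1) V)"
  then consider "w \<in> shade (X - {k}) (slice k j V)" | "j \<noteq> 0" "w \<in> slice k (j - 1) V"
    by (auto split: if_splits)
  then show "w \<in> slice k j (shade X V)"
  proof cases
    case 1
    then obtain w' i where w': "w = w' + var i" "i \<in> X" "i \<noteq> k" "w' \<in> slice k j V"
      by (auto simp: shade_def)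
    then have "w + single k j = (w' + single k j) + var i" by (simp add: ac_simps)
    then show ?thesis using w' by (auto simp: slice_def shade_def lookup_add lookup_var)
  next
    case 2
    then have "w + single k j = (w + single k (j - 1)) + var k"
      by (simp add: var_def add.assoc single_add[symmetric])
    then show ?thesis using 2 assms by (auto simp: slice_def shade_def)
  qed
qed

text \<open>A slice of the shade of the compressed set is the union of two lexsegments of the same
  degree, hence only as large as the larger one. One is the shade of a compressed slice, controlled
  by the hypothesis on fewer variables; the other has the size of a slice of \<open>V\<close>. Both
  have counterparts inside the same slice of \<open>shade X V\<close>.\<close>

lemma card_shade_compress_le:
  assumes X: "finite X" "k \<in> X" and V: "V \<subseteq> mons X q"
    and IH: "\<And>j W. j \<le> q \<Longrightarrow> W \<subseteq> mons (X - {k}) j \<Longrightarrow>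
      card (shade (X - {k}) (topk (mons (X - {k}) j) (card W))) \<le> card (shade (X - {k}) W)"
  shows "card (shade X (compress X q k V)) \<le> card (shade X V)"
proof -
  let ?C = "compress X q k V" and ?X = "X - {k}"
  have CX: "?C \<subseteq> mons X q" by (rule compress_mons[OF X V])
  have "card (slice k j (shade X ?C)) \<le> card (slice k j (shade X V))" if j: "j \<le> Suc q" for j
  proof -
    have finV: "finite (slice k j (shade X V))"
      using slice_mons(1)[OF shade_mons[OF V], of k j] X(1) by (auto intro: finite_subset)
    let ?A = "mons ?X (Suc q - j)"
    let ?P = "shade ?X (slice k j ?C)" and ?Q = "if j = 0 then {} else slice k (j - 1) ?C"
    have c1: "card ?P \<le> card (shade ?X (slice k j V))"
    proof (cases "j \<le> q")
      case True
      have "card (shade ?X (topk (mons ?X (q - j)) (card (slice k j V)))) \<le> card (shade ?X (slice k j V))"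
        using IH[of "q - j" "slice k j V"] slice_mons(1)[OF V, of k j] by auto
      then show ?thesis using slice_compress[OF X(1) V True] by simp
    next
      case False
      then have "slice k j ?C = {}" using slice_mons(2)[OF CX] by blast
      then show ?thesis by (simp add: shade_def)
    qed
    have P: "upset ?A ?P"
    proof (cases "j \<le> q")
      case True
      have "upset (mons ?X (Suc (q - j))) ?P"
        using slice_compress[OF X(1) V True] topk_slice(1)[OF X(1) V, of k j] X(1)
        by (intro shade_upset) auto
      then show ?thesis using True by (simp add: Suc_diff_le)
    next
      case False
      then have "slice k j ?C = {}" using slice_mons(2)[OF CX] by blast
      then show ?thesis by (simp add: shade_def upset_def)
    qed
    have Q: "upset ?A ?Q \<and> card ?Q = card (if j = 0 then {} else slice k (j - 1) V)"
    proof (cases "j = 0")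
      case False
      then have "j - 1 \<le> q" "Suc q - j = q - (j - 1)" using j by auto
      then show ?thesis using slice_compress[OF X(1) V, of "j - 1" k] topk_slice[OF X(1) V, of k "j - 1"] False
        by simp
    qed (auto simp: upset_def)
    have "card (?P \<union> ?Q) = max (card ?P) (card ?Q)"
      using P Q X(1) by (intro upset_Un_card[of ?A]) auto
    also have "\<dots> \<le> card (slice k j (shade X V))"
    proof -
      have "card (shade ?X (slice k j V)) \<le> card (slice k j (shade X V))"
        "card (if j = 0 then {} else slice k (j - 1) V) \<le> card (slice k j (shade X V))"
        by (rule card_mono[OF finV], simp add: slice_shade[OF X(2)])+
      then show ?thesis using c1 Q by (metis max.bounded_iff order_trans)
    qed
    finally show ?thesis unfolding slice_shade[OF X(2)] .
  qed
  then show ?thesis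
    unfolding card_slices[OF X(1) shade_mons[OF CX], of k] card_slices[OF X(1) shade_mons[OF V], of k]
    by (intro sum_mono) auto
qed

text \<open>The exchange property of strongly stable (Borel-type) ideals.\<close>

definition stable :: "nat set \<Rightarrow> monomial set \<Rightarrow> bool" where
  "stable X V \<longleftrightarrow> (\<forall>i\<in>X. \<forall>j\<in>X. \<forall>w. i < j \<longrightarrow> w + var j \<in> V \<longrightarrow> w + var i \<in> V)"

lemma upset_stable:
  assumes "upset (mons X q) V"
  shows "stable X V"
  unfolding stable_def
proof (intro ballI allI impI)
  fix i j w assume a: "i \<in> X" "j \<in> X" "i < j" "w + var j \<in> V"
  then have "w + var j \<in> mons X q" using assms by (auto simp: upset_def)
  then have "w + var i \<in> mons X q" using a by (auto simp: mons_def keys_add_nat)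
  moreover have "w + var j < w + var i" using a(3) by (simp add: var_less_iff)
  ultimately show "w + var i \<in> V" using a assms by (auto simp: upset_def)
qed

lemma stable_move:
  assumes "stable X V" "i \<in> X" "j \<in> X" "i < j"
  shows "w + single j e \<in> V \<Longrightarrow> w + single i e \<in> V"
proof (induction e arbitrary: w)
  case (Suc e)
  have s: "single l (Suc e) = single l e + var l" for l by (simp add: var_def single_add[symmetric])
  have "(w + single j e) + var j \<in> V" using Suc.prems s by (simp add: ac_simps)
  then have "(w + single j e) + var i \<in> V" using assms unfolding stable_def by blast
  then have "(w + var i) + single j e \<in> V" by (simp add: ac_simps)
  then have "(w + var i) + single i e \<in> V" by (rule Suc.IH)
  then show ?case using s by (simp add: ac_simps)
qed simp

text \<open>If \<open>u = w x_n\<close> lies in \<open>V\<close>, then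
  \<open>u x_i = (w x_i) x_n\<close> with \<open>w x_i\<close> in \<open>V\<close> by stability. So
  only the monomials of \<open>V\<close> free of the last variable yield anything beyond
  \<open>x_n V\<close>, and what they yield is free of \<open>x_n\<close>.\<close>

lemma card_shade_stable:
  assumes X: "finite X" "n \<in> X" "\<And>i. i \<in> X \<Longrightarrow> i \<le> n" and V: "V \<subseteq> mons X q" and st: "stable X V"
  shows "card (shade X V) = card V + card (shade (X - {n}) (slice n 0 V))"
proof -
  let ?Y = "X - {n}" and ?A = "(\<lambda>u. u + var n) ` V"
  have "shade X V = ?A \<union> shade ?Y (slice n 0 V)"
  proof (intro equalityI subsetI)
    fix z assume "z \<in> shade X V"
    then obtain u i where u: "z = u + var i" "u \<in> V" "i \<in> X" by (auto simp: shade_def)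
    show "z \<in> ?A \<union> shade ?Y (slice n 0 V)"
    proof (cases "i = n \<or> n \<in> keys u")
      case True
      show ?thesis
      proof (cases "i = n")
        case False
        then have "i < n" using X(3)[OF u(3)] by simp
        obtain w where w: "u = w + var n" using True False monomial_split_var by blast
        have "w + var i \<in> V" using st u w X \<open>i < n\<close> unfolding stable_def by blast
        moreover have "z = (w + var i) + var n" using u w by (simp add: ac_simps)
        ultimately show ?thesis by blast
      qed (use u in auto)
    next
      case False
      then have "u \<in> slice n 0 V" using u by (auto simp: slice_def in_keys_iff)
      then show ?thesis using False u by (auto simp: shade_def)
    qed
  qed (use X(2) in \<open>auto simp: shade_def slice_def\<close>)
  moreover have "?A \<inter> shade ?Y (slice n 0 V) = {}"
  proof -
    have "lookup z n = 0" if "z \<in> shade ?Y (slice n 0 V)" for z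
      using that by (auto simp: shade_def slice_def lookup_add lookup_var split: if_splits)
    moreover have "lookup z n \<noteq> 0" if "z \<in> ?A" for z
      using that by (auto simp: lookup_add lookup_var)
    ultimately show ?thesis by blast
  qed
  moreover have "finite V" using V X(1) by (auto intro: finite_subset)
  moreover have "finite (slice n 0 V)" using slice_mons(1)[OF V, of n 0] X(1) by (auto intro: finite_subset)
  ultimately show ?thesis using X(1)
    by (simp add: card_Un_disjoint finite_shade card_image inj_on_def)
qed

lemma slice_upset:
  assumes "finite X" "n \<in> X" "upset (mons X q) V"
  shows "upset (mons (X - {n}) q) (slice n 0 V)"
  unfolding upset_def
proof (intro conjI ballI impI)
  show "slice n 0 V \<subseteq> mons (X - {n}) q"
    using slice_mons(1)[of V X q n 0] assms by (auto simp: upset_def)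
  fix u v assume a: "u \<in> slice n 0 V" "v \<in> mons (X - {n}) q" "u < v"
  then have "v \<in> mons X q" by (auto simp: mons_def)
  then show "v \<in> slice n 0 V" using a assms(3) mons_lookup_zero[of v X n q]
    by (auto simp: slice_def upset_def)
qed

text \<open>Moving the powers of the last variable to the preceding one maps \<open>V\<close> into its slice. Hence a monomial
  of \<open>L\<close> missing from that slice would be smaller than every element of \<open>V\<close>, making \<open>V\<close> a proper subset
  of \<open>L\<close>.\<close>

lemma card_slice_zero_le:
  assumes X: "finite X" "n \<in> X" "\<And>i. i \<in> X \<Longrightarrow> i \<le> n"
    and m: "m \<in> X" "m < n" "\<And>i. i \<in> X \<Longrightarrow> i < n \<Longrightarrow> i \<le> m"
    and V: "V \<subseteq> mons X q" and st: "stable X V" and up: "upset (mons (X - {n}) q) (slice n 0 V)"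
    and L: "upset (mons X q) L" and c: "card L = card V"
  shows "card (slice n 0 L) \<le> card (slice n 0 V)"
proof (rule ccontr)
  assume nle: "\<not> ?thesis"
  let ?A = "mons (X - {n}) q"
  have finA: "finite ?A" using X(1) by simp
  have "slice n 0 V \<subseteq> slice n 0 L"
    using upset_subset_if_card_le[OF finA up slice_upset[OF X(1,2) L]] nle by simp
  with nle obtain u where u: "u \<in> slice n 0 L" "u \<notin> slice n 0 V"
    by (metis order_refl subsetI subset_antisym)
  have uA: "u \<in> ?A" using slice_upset[OF X(1,2) L] u by (auto simp: upset_def)
  have u0: "lookup u n = 0" and uL: "u \<in> L" using u by (auto simp: slice_def)
  have finL: "finite L" using L X(1) by (auto simp: upset_def intro: finite_subset)
  have "v \<in> L \<and> v \<noteq> u" if v: "v \<in> V" for v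
  proof -
    have vm: "v \<in> mons X q" using v V by auto
    obtain w where w: "v = w + single n (lookup v n)" "lookup w n = 0" by (rule monomial_lookup_split)
    define a where "a = w + single m (lookup v n)"
    have "a \<in> V" unfolding a_def using stable_move[OF st m(1) X(2) m(2)] v w(1) by metis
    then have aS: "a \<in> slice n 0 V" using m(2) w(2) by (auto simp: slice_def a_def lookup_add lookup_single)
    then have aA: "a \<in> ?A" using up by (auto simp: upset_def)
    have "u < a"
    proof (rule ccontr)
      assume "\<not> u < a"
      then consider "a < u" | "a = u" by fastforce
      then show False using aS uA u(2) up unfolding upset_def by cases auto
    qed
    \<comment> \<open>A first index \<open>j\<close> with \<open>v\<close> below \<open>u\<close> is
      at most \<open>m\<close>. If \<open>j < m\<close>, it also puts \<open>a\<close> below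
      \<open>u\<close>, because \<open>a\<close> and \<open>v\<close> agree before \<open>m\<close>.
      If \<open>j = m\<close>, then \<open>a\<close> and \<open>u\<close> agree before
      \<open>m\<close>, and equal degrees make them equal.\<close>
    have "u < v"
    proof (rule ccontr)
      assume "\<not> u < v"
      moreover have "v \<noteq> u"
      proof
        assume "v = u"
        then have "a = u" using u0 w by (simp add: a_def)
        with \<open>u < a\<close> show False by simp
      qed
      ultimately have "v < u" by simp
      then obtain j where j: "lookup v j < lookup u j" "\<And>l. l < j \<Longrightarrow> lookup v l = lookup u l"
        by (auto simp: monomial_less_iff)
      have "lookup u j \<noteq> 0" using j(1) by linarith
      then have "j \<in> keys u" by (simp add: in_keys_iff)
      then have "j \<in> X" using uA by (auto simp: mons_def)
      moreover have "j \<noteq> n" using j(1) u0 by auto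
      ultimately have "j \<le> m" using m(3)[of j] X(3)[of j] by simp
      have al: "lookup a l = lookup v l" if "l < m" for l
      proof -
        have "lookup v l = lookup w l + lookup (single n (lookup v n)) l"
          by (subst w(1)) (simp add: lookup_add)
        then show ?thesis using that m(2) by (simp add: a_def lookup_add lookup_single when_def)
      qed
      show False
      proof (cases "j = m")
        case False
        then have "a < u" using j al \<open>j \<le> m\<close> unfolding monomial_less_iff
          by (intro exI[of _ j]) auto
        with \<open>u < a\<close> show False by simp
      next
        case True
        have md: "mdeg z = lookup z m + (\<Sum>l\<in>X - {n} - {m}. lookup z l)" if "z \<in> ?A" for z
          using that X(1) mdeg_eq_sum[of "X - {n}" z] sum.remove[of "X - {n}" m "lookup z"] m(1,2)
          by (auto simp: mons_def)
        have "(\<Sum>l\<in>X - {n} - {m}. lookup a l) = (\<Sum>l\<in>X - {n} - {m}. lookup u l)"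
        proof (rule sum.cong)
          fix l assume "l \<in> X - {n} - {m}"
          then have "l < m" using m(3)[of l] X(3)[of l] by force
          then show "lookup a l = lookup u l" using al j(2) True by simp
        qed simp
        then have "lookup a m = lookup u m" using aA uA md[OF aA] md[OF uA] by (simp add: mons_def)
        moreover have "lookup a l = lookup u l" if "l < m" for l using that al j(2) True by simp
        moreover have "lookup a l = lookup u l" if "m < l" for l
        proof -
          have "l \<notin> X - {n}" using that m(3)[of l] X(3)[of l] by force
          then have "l \<notin> keys a" "l \<notin> keys u" using aA uA by (auto simp: mons_def)
          then show ?thesis by (simp add: in_keys_iff)
        qed
        ultimately have "a = u" by (intro poly_mapping_eqI) (metis linorder_neqE_nat)
        with \<open>u < a\<close> show False by simp
      qed
    qed
    then show ?thesis using L uL vm by (auto simp: upset_def)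
  qed
  then have "V \<subset> L" using uL by auto
  then show False using psubset_card_mono[OF finL] c by auto
qed

text \<open>The least element of \<open>V\<close> times the smaller variable \<open>x_b\<close>
  precedes all products with \<open>x_a\<close>, so it is a new monomial. Two variables get this
  separate argument because no third variable is left from which compression could yield
  stability.\<close>

lemma card_less_card_shade_two:
  assumes "a < b" and V: "V \<subseteq> mons {a, b} q" "V \<noteq> {}"
  shows "card V < card (shade {a, b} V)"
proof -
  have finV: "finite V" using V(1) by (rule finite_subset) simp
  define v where "v = Min V"
  have v: "v \<in> V" "\<And>u. u \<in> V \<Longrightarrow> v \<le> u" using finV V(2) by (auto simp: v_def)
  let ?A = "(\<lambda>u. u + var a) ` V"
  have lt: "v + var b < u + var a" if "u \<in> V" for u
    using v(2)[OF that] assms(1) by (intro add_le_less_mono) (auto simp: var_less_iff)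
  have "v + var b \<notin> ?A"
  proof
    assume "v + var b \<in> ?A"
    then obtain u where "u \<in> V" "v + var b = u + var a" by auto
    then show False using lt[of u] by simp
  qed
  then have "Suc (card V) = card (insert (v + var b) ?A)"
    using finV by (simp add: card_image inj_on_def)
  also have "\<dots> \<le> card (shade {a, b} V)"
    using v(1) finV by (intro card_mono) (auto simp: finite_shade, auto simp: shade_def)
  finally show ?thesis by simp
qed

lemma mons_singleton: "mons {a} q \<subseteq> {single a q}"
proof
  fix u assume u: "u \<in> mons {a} q"
  then have "lookup u a = q" using mdeg_eq_sum[of "{a}" u] by (auto simp: mons_def)
  moreover have "lookup u i = 0" if "i \<noteq> a" for i using u that by (auto simp: mons_def in_keys_iff)
  ultimately have "u = single a q" by (intro poly_mapping_eqI) (auto simp: lookup_single when_def)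
  then show "u \<in> {single a q}" by simp
qed

text \<open>Among the sets of the same size whose shade is not larger, one of maximal total rank is compressed
  in every variable; with at least three variables this makes it stable.\<close>

theorem card_shade_topk_le:
  assumes "finite X" "V \<subseteq> mons X q"
  shows "card (shade X (topk (mons X q) (card V))) \<le> card (shade X V)"
  using assms
proof (induction "card X" arbitrary: X V q rule: less_induct)
  case (less X V q)
  note X = less.prems(1) and V = less.prems(2)
  let ?A = "mons X q"
  have finA: "finite ?A" using X by simp
  have finV: "finite V" using V finA by (rule finite_subset)
  define L where "L = topk ?A (card V)"
  have L: "upset ?A L" "card L = card V"
    using topk[OF finA card_mono[OF finA V]] by (auto simp: L_def)
  have LA: "L \<subseteq> ?A" using L by (auto simp: upset_def)
  \<comment> \<open>With at most one variable there is at most one monomial in each degree, so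
    \<open>V\<close> and \<open>L\<close> coincide.\<close>
  have eqcase: "card (shade X L) \<le> card (shade X V)" if "card X < 2"
  proof -
    have "card ?A \<le> 1"
    proof (cases "card X = 0")
      case True
      then have "?A \<subseteq> {0}" using X by (auto simp: mons_def)
      then show ?thesis using card_mono[of "{0::monomial}" ?A] by simp
    next
      case False
      then have "card X = 1" using that by simp
      then obtain a where "X = {a}" by (auto simp: card_1_singleton_iff)
      then show ?thesis using card_mono[OF _ mons_singleton[of a q]] by simp
    qed
    have "V = L"
    proof (cases "card V = 0")
      case True
      then show ?thesis using L finV finite_subset[OF LA finA] by auto
    next
      case False
      then have "card V = card ?A" "card L = card ?A"
        using \<open>card ?A \<le> 1\<close> card_mono[OF finA V] L(2) by linarith+
      then show ?thesis using card_subset_eq[OF finA V] card_subset_eq[OF finA LA] by simp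
    qed
    then show ?thesis by simp
  qed
  consider "card X < 2" | "card X = 2" | "card X \<ge> 3" by linarith
  then have "card (shade X L) \<le> card (shade X V)"
  proof cases
    case 1
    then show ?thesis by (rule eqcase)
  next
    case 2
    then obtain a b where ab: "X = {a, b}" "a < b"
      by (metis card_2_iff insert_commute linorder_neqE_nat)
    show ?thesis
    proof (cases "V = {}")
      case True
      then show ?thesis using L(2) finite_subset[OF LA finA] by auto
    next
      case False
      have "card (shade X L) = card L + card (shade (X - {b}) (slice b 0 L))"
        using ab by (intro card_shade_stable[OF X _ _ LA upset_stable[OF L(1)]]) auto
      also have "X - {b} = {a}" using ab by auto
      also have "card (shade {a} (slice b 0 L)) \<le> 1"
      proof -
        have "slice b 0 L \<subseteq> mons {a} q" using slice_mons(1)[OF LA, of b 0] \<open>X - {b} = {a}\<close> by simp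
        then have "shade {a} (slice b 0 L) \<subseteq> {single a (Suc q)}"
          using shade_mons mons_singleton by (metis subset_trans)
        then show ?thesis using card_mono[of "{single a (Suc q)}"] by force
      qed
      finally show ?thesis using card_less_card_shade_two[OF ab(2) _ False] V L(2) ab(1) by fastforce
    qed
  next
    case 3
    define rk where "rk u = card {v \<in> ?A. v \<le> u}" for u
    have rk_mono: "rk u < rk v" if "u \<in> ?A" "v \<in> ?A" "u < v" for u v
    proof -
      have "v \<in> {w \<in> ?A. w \<le> v}" "v \<notin> {w \<in> ?A. w \<le> u}" using that by auto
      moreover have "{w \<in> ?A. w \<le> u} \<subseteq> {w \<in> ?A. w \<le> v}" using that by auto
      ultimately have "{w \<in> ?A. w \<le> u} \<subset> {w \<in> ?A. w \<le> v}" by blast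
      then show ?thesis unfolding rk_def using finA by (intro psubset_card_mono) auto
    qed
    define P where "P W \<longleftrightarrow> W \<subseteq> ?A \<and> card W = card V \<and> card (shade X W) \<le> card (shade X V)" for W
    have "sum rk W < Suc (\<Sum>u\<in>?A. rk u)" if "P W" for W
      using that finA by (intro le_imp_less_Suc sum_mono2) (auto simp: P_def)
    moreover have "P V" using V by (simp add: P_def)
    ultimately obtain W where W: "P W" and Wmax: "\<And>W'. P W' \<Longrightarrow> sum rk W' \<le> sum rk W"
      using ex_has_greatest_nat[of P V "sum rk" "Suc (\<Sum>u\<in>?A. rk u)"] by blast
    have WA: "W \<subseteq> ?A" using W by (simp add: P_def)
    have comp: "upset (mons (X - {k}) (q - j)) (slice k j W)" if k: "k \<in> X" and j: "j \<le> q" for k j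
    proof (rule ccontr)
      assume no: "\<not> ?thesis"
      let ?C = "compress X q k W"
      have IH: "card (shade (X - {k}) (topk (mons (X - {k}) i) (card U))) \<le> card (shade (X - {k}) U)"
        if "U \<subseteq> mons (X - {k}) i" for i U
        using less.hyps[of "X - {k}" U i] that X k card_Diff1_less[OF X k] by simp
      have "card (shade X ?C) \<le> card (shade X W)"
        by (rule card_shade_compress_le[OF X k WA]) (rule IH)
      then have "P ?C" using W card_compress[OF X k WA] compress_mons[OF X k WA] by (simp add: P_def)
      moreover have "sum rk W < sum rk ?C"
        unfolding sum_slices[OF X WA, of rk k] sum_slices[OF X compress_mons[OF X k WA], of rk k]
      proof (rule sum_strict_mono_ex1)
        have le: "(\<Sum>w\<in>slice k i W. rk (w + single k i)) \<le> (\<Sum>w\<in>slice k i ?C. rk (w + single k i))"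
          "slice k i W \<noteq> slice k i ?C \<Longrightarrow>
            (\<Sum>w\<in>slice k i W. rk (w + single k i)) < (\<Sum>w\<in>slice k i ?C. rk (w + single k i))"
          if "i \<le> q" for i
        proof -
          have mono: "rk (u + single k i) < rk (v + single k i)"
            if "u \<in> mons (X - {k}) (q - i)" "v \<in> mons (X - {k}) (q - i)" "u < v" for u v
            using that mons_add_single[OF k \<open>i \<le> q\<close>] by (intro rk_mono) auto
          have up: "upset (mons (X - {k}) (q - i)) (slice k i ?C)"
            and cd: "card (slice k i W) = card (slice k i ?C)"
            using topk_slice[OF X WA, of k i] slice_compress[OF X WA \<open>i \<le> q\<close>, of k] by simp_all
          have fin: "finite (mons (X - {k}) (q - i))" using X by simp
          note sl = sum_less_sum_upset[OF fin up slice_mons(1)[OF WA] cd, of "\<lambda>w. rk (w + single k i)", OF mono]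
          show "(\<Sum>w\<in>slice k i W. rk (w + single k i)) \<le> (\<Sum>w\<in>slice k i ?C. rk (w + single k i))"
            by (rule sl(1))
          show "(\<Sum>w\<in>slice k i W. rk (w + single k i)) < (\<Sum>w\<in>slice k i ?C. rk (w + single k i))"
            if "slice k i W \<noteq> slice k i ?C" by (rule sl(2)) (use that in auto)
        qed
        show "\<forall>i\<in>{..q}. (\<Sum>w\<in>slice k i W. rk (w + single k i)) \<le> (\<Sum>w\<in>slice k i ?C. rk (w + single k i))"
          using le(1) by simp
        have "slice k j W \<noteq> slice k j ?C"
          using no topk_slice(1)[OF X WA, of k j] slice_compress[OF X WA j, of k] by auto
        then show "\<exists>i\<in>{..q}. (\<Sum>w\<in>slice k i W. rk (w + single k i)) < (\<Sum>w\<in>slice k i ?C. rk (w + single k i))"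
          using le(2) j by blast
      qed simp
      ultimately show False using Wmax by fastforce
    qed
    have st: "stable X W"
      unfolding stable_def
    proof (intro ballI allI impI)
      fix i j w assume a: "i \<in> X" "j \<in> X" "i < j" "w + var j \<in> W"
      \<comment> \<open>A third variable \<open>k\<close> exists. Both monomials have the same
        exponent \<open>e\<close> there, so they come from one slice, and that slice is an
        upset.\<close>
      have "card {i, j} < card X" using 3 card_insert_le_m1[of 2 "{j}" i] by simp
      then obtain k where k: "k \<in> X" "k \<noteq> i" "k \<noteq> j"
        by (metis X card_mono finite.emptyI finite.insertI insertCI leD subsetI)
      obtain w' where w': "w = w' + single k (lookup w k)" "lookup w' k = 0" by (rule monomial_lookup_split)
      define e where "e = lookup w k"
      have eqs: "w + var l = (w' + var l) + single k e" for l
        by (subst w'(1)) (simp add: e_def ac_simps)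
      have 1: "w' + var j \<in> slice k e W"
        using a k w'(2) eqs by (auto simp: slice_def lookup_add lookup_var)
      then have e: "e \<le> q" using slice_mons(2)[OF WA] by blast
      have 2: "w' + var j \<in> mons (X - {k}) (q - e)" using 1 slice_mons(1)[OF WA] by blast
      then have "w' + var i \<in> mons (X - {k}) (q - e)" using a k by (auto simp: mons_def keys_add_nat)
      moreover have "w' + var j < w' + var i" using a(3) by (simp add: var_less_iff)
      ultimately have "w' + var i \<in> slice k e W" using comp[OF k(1) e] 1 unfolding upset_def by blast
      then show "w + var i \<in> W" using eqs by (auto simp: slice_def)
    qed
    have "X \<noteq> {}" using 3 by auto
    define n where "n = Max X"
    have n: "n \<in> X" "\<And>i. i \<in> X \<Longrightarrow> i \<le> n" using X \<open>X \<noteq> {}\<close> by (auto simp: n_def)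
    have "X - {n} \<noteq> {}"
    proof
      assume "X - {n} = {}"
      then have "X \<subseteq> {n}" by auto
      then show False using 3 card_mono[of "{n}" X] by simp
    qed
    define m where "m = Max (X - {n})"
    have "m \<in> X - {n}" unfolding m_def using X \<open>X - {n} \<noteq> {}\<close> by (intro Max_in) auto
    then have m: "m \<in> X" "m < n" using n(2)[of m] by auto
    have m': "i \<le> m" if "i \<in> X" "i < n" for i unfolding m_def using X that by (intro Max_ge) auto
    have upW: "upset (mons (X - {n}) q) (slice n 0 W)" using comp[OF n(1), of 0] by simp
    have upL: "upset (mons (X - {n}) q) (slice n 0 L)" by (rule slice_upset[OF X n(1) L(1)])
    have cW: "card L = card W" using W L by (simp add: P_def)
    have "card (slice n 0 L) \<le> card (slice n 0 W)"
      by (rule card_slice_zero_le[OF X n m m' WA st upW L(1) cW])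
    then have "slice n 0 L \<subseteq> slice n 0 W"
      using upset_subset_if_card_le[OF _ upL upW] X by simp
    then have "card (shade (X - {n}) (slice n 0 L)) \<le> card (shade (X - {n}) (slice n 0 W))"
      using slice_mons(1)[OF WA, of n 0] X
      by (intro card_mono finite_shade shade_mono) (auto intro: finite_subset)
    then have "card (shade X L) \<le> card (shade X W)"
      using card_shade_stable[OF X n WA st] card_shade_stable[OF X n LA upset_stable[OF L(1)]] cW by simp
    then show ?thesis using W by (simp add: P_def)
  qed
  then show ?case by (simp add: L_def)
qed

section \<open>Macaulay representations\<close>

lemma mons_empty: "mons {} q = (if q = 0 then {0} else {})"
  by (auto simp: mons_def)

lemma slice_mons_eq:
  assumes "k \<in> X" "j \<le> q"
  shows "slice k j (mons X q) = mons (X - {k}) (q - j)"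
  using slice_mons(1)[of "mons X q" X q k j] mons_add_single[OF assms] mons_lookup_zero[of _ X k "q - j"]
  by (auto simp: slice_def)

lemma sum_flip: "(\<Sum>j\<le>q. f (q - j)) = (\<Sum>s\<le>q. f s)" for f :: "nat \<Rightarrow> nat"
  by (rule sum.reindex_bij_witness[of _ "\<lambda>j. q - j" "\<lambda>j. q - j"]) auto

text \<open>Truncated subtraction makes the formula correct for empty \<open>X\<close> as well:
  \<open>(q - 1) choose q\<close> is 1 for \<open>q = 0\<close> and 0 otherwise. Adding a variable
  sums over its exponent.\<close>

lemma card_mons:
  assumes "finite X"
  shows "card (mons X q) = (card X + q - 1) choose q"
  using assms
proof (induction X arbitrary: q rule: finite_induct)
  case (insert a Y)
  have "card (mons (insert a Y) q) = (\<Sum>j\<le>q. card (mons Y (q - j)))"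
  proof (subst card_slices[of "insert a Y" _ q a])
    show "(\<Sum>j\<le>q. card (slice a j (mons (insert a Y) q))) = (\<Sum>j\<le>q. card (mons Y (q - j)))"
      using insert.hyps by (intro sum.cong refl) (simp add: slice_mons_eq)
  qed (use insert in auto)
  also have "\<dots> = (\<Sum>s\<le>q. (card Y + s - 1) choose s)" unfolding insert.IH by (rule sum_flip)
  also have "\<dots> = (card Y + q) choose q"
  proof (cases "card Y")
    case 0
    have "(\<Sum>s\<le>q. (s - 1) choose s) = (\<Sum>s\<le>q. if s = 0 then 1 else 0)"
      by (intro sum.cong) auto
    then show ?thesis using 0 by simp
  next
    case (Suc p)
    then show ?thesis using sum_choose_lower[of p q] by simp
  qed
  finally show ?case using insert.hyps by simp
qed (auto simp: mons_empty)

lemma add_single_less_iff: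
  fixes w v :: monomial
  assumes "\<And>i. i \<le> a \<Longrightarrow> lookup w i = 0" "\<And>i. i \<le> a \<Longrightarrow> lookup v i = 0"
  shows "w + single a j < v + single a e \<longleftrightarrow> j < e \<or> j = e \<and> w < v"
proof (cases j e rule: linorder_cases)
  case less
  then have "w + single a j < v + single a e"
    unfolding monomial_less_iff using assms
    by (intro exI[of _ a]) (auto simp: lookup_add lookup_single when_def)
  then show ?thesis using less by simp
next
  case greater
  then have "v + single a e < w + single a j"
    unfolding monomial_less_iff using assms
    by (intro exI[of _ a]) (auto simp: lookup_add lookup_single when_def)
  then show ?thesis using greater by simp
qed auto

text \<open>Here \<open>x_a\<close> is the largest variable, so a monomial below
  \<open>v x_a^e\<close> has either a smaller exponent of \<open>x_a\<close> and an arbitrary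
  remaining factor, or the same exponent and a remaining factor below \<open>v\<close>.\<close>

lemma card_less_slices:
  assumes X: "finite X" "a \<in> X" "\<And>i. i \<in> X - {a} \<Longrightarrow> a < i"
    and v: "v \<in> mons (X - {a}) (q - e)" "e \<le> q"
  shows "card {w \<in> mons X q. w < v + single a e} =
    (\<Sum>j<e. card (mons (X - {a}) (q - j))) + card {w \<in> mons (X - {a}) (q - e). w < v}"
proof -
  let ?Y = "X - {a}" and ?S = "{w \<in> mons X q. w < v + single a e}"
  have z: "lookup w i = 0" if w: "w \<in> mons ?Y p" and i: "i \<le> a" for w p i
  proof -
    have "i \<notin> ?Y" using X(3)[of i] i by auto
    then have "i \<notin> keys w" using w unfolding mons_def by blast
    then show ?thesis by (simp add: in_keys_iff)
  qed
  have sl: "slice a j ?S = {w \<in> mons ?Y (q - j). j < e \<or> j = e \<and> w < v}" if "j \<le> q" for j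
  proof -
    have "slice a j ?S = {w \<in> slice a j (mons X q). w + single a j < v + single a e}"
      by (auto simp: slice_def)
    also have "\<dots> = {w \<in> mons ?Y (q - j). w + single a j < v + single a e}"
      using slice_mons_eq[OF X(2) that] by simp
    also have "\<dots> = {w \<in> mons ?Y (q - j). j < e \<or> j = e \<and> w < v}"
      using add_single_less_iff[of a _ v j e] z z[OF v(1)] by blast
    finally show ?thesis .
  qed
  have "card ?S = (\<Sum>j\<le>q. card (slice a j ?S))"
    using X(1) by (intro card_slices) auto
  also have "\<dots> = (\<Sum>j\<le>q. card {w \<in> mons ?Y (q - j). j < e \<or> j = e \<and> w < v})"
    using sl by simp
  also have "\<dots> = (\<Sum>j\<in>{..<e} \<union> {e}. card {w \<in> mons ?Y (q - j). j < e \<or> j = e \<and> w < v})"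
    using v(2) by (intro sum.mono_neutral_right) auto
  also have "\<dots> = (\<Sum>j<e. card (mons ?Y (q - j))) + card {w \<in> mons ?Y (q - e). w < v}"
    by (subst sum.union_disjoint) auto
  finally show ?thesis .
qed

lemma sum_upper_flip:
  fixes f :: "nat \<Rightarrow> nat"
  assumes "e \<le> q"
  shows "(\<Sum>j<e. f (q - j)) = (\<Sum>s\<in>{Suc (q - e)..q}. f s)"
  using assms by (intro sum.reindex_bij_witness[of _ "\<lambda>j. q - j" "\<lambda>j. q - j"]) auto

lemma sum_split_at:
  fixes f :: "nat \<Rightarrow> nat"
  assumes "p \<le> q"
  shows "(\<Sum>s\<in>{1..q}. f s) = (\<Sum>s\<in>{1..p}. f s) + (\<Sum>s\<in>{Suc p..q}. f s)"
proof -
  have "{1..q} = {1..p} \<union> {Suc p..q}" using assms by auto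
  then show ?thesis by (simp add: sum.union_disjoint)
qed

text \<open>The number of monomials below \<open>v\<close> becomes a sum of binomials with strictly
  increasing upper entries, as in a Macaulay representation, except that terms may vanish because
  \<open>k s = s - 1\<close> is allowed. Multiplying \<open>v\<close> by the last variable changes
  no other exponent, and each counted block of degree \<open>s\<close> becomes one of degree
  \<open>s + 1\<close>; this raises all entries by one. The bound
  \<open>k s + 2 \<le> card X + s\<close> serves the induction: it keeps the entries increasing when
  the next variable contributes its blocks.\<close>

lemma lex_count:
  assumes "finite X" "X \<noteq> {}" "v \<in> mons X q"
  shows "\<exists>k. (\<forall>s\<in>{1..q}. s \<le> Suc (k s) \<and> k s + 2 \<le> card X + s) \<and>
    (\<forall>s. 1 \<le> s \<and> s < q \<longrightarrow> k s < k (Suc s)) \<and>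
    card {w \<in> mons X q. w < v} = (\<Sum>s\<in>{1..q}. k s choose s) \<and>
    card {w \<in> mons X (Suc q). w < v + var (Max X)} = (\<Sum>s\<in>{1..q}. Suc (k s) choose Suc s)"
  using assms
proof (induction "card X" arbitrary: X v q rule: less_induct)
  case (less X v q)
  note X = less.prems(1,2) and v = less.prems(3)
  define a where "a = Min X"
  define Y where "Y = X - {a}"
  have a: "a \<in> X" "\<And>i. i \<in> X - {a} \<Longrightarrow> a < i"
    using X by (auto simp: a_def) (metis Min_le order_le_less)
  have finY: "finite Y" using X by (simp add: Y_def)
  have cX: "card X = Suc (card Y)" using X a(1) unfolding Y_def
    by (metis card_Suc_Diff1)
  show ?case
  proof (cases "Y = {}")
    case True
    then have Xa: "X = {a}" using a by (auto simp: Y_def)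
    have "u = single a p" if "u \<in> mons X p" for u p using mons_singleton[of a p] that Xa by auto
    then have "w = v" if "w \<in> mons X q" for w using that v by metis
    moreover have "w = v + var (Max X)" if "w \<in> mons X (Suc q)" for w
      using that mons_add_var[OF v a(1)] \<open>\<And>u p. u \<in> mons X p \<Longrightarrow> u = single a p\<close> Xa by (metis Max_singleton)
    ultimately have e: "{w \<in> mons X q. w < v} = {}" "{w \<in> mons X (Suc q). w < v + var (Max X)} = {}"
      by blast+
    \<comment> \<open>There is one monomial and nothing below it; the entries \<open>s - 1\<close>
      make every binomial zero.\<close>
    show ?thesis unfolding e by (intro exI[of _ "\<lambda>s. s - 1"]) (auto simp: Xa)
  next
    case False
    define e where "e = lookup v a"
    obtain v' where v': "v = v' + single a e" "lookup v' a = 0"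
      unfolding e_def by (rule monomial_lookup_split)
    have "v' \<in> slice a e (mons X q)" using v v' by (simp add: slice_def)
    then have e: "e \<le> q" and v'Y: "v' \<in> mons Y (q - e)"
      using slice_mons[of "mons X q" X q a e] by (auto simp: Y_def)
    have mx: "Max X = Max Y"
    proof -
      have "X = insert a Y" using a by (auto simp: Y_def)
      then have "Max X = max a (Max Y)" using finY False by simp
      moreover have "a < Max Y" using a(2)[of "Max Y"] Max_in[OF finY False] by (simp add: Y_def)
      ultimately show ?thesis by simp
    qed
    have "card Y < card X" using cX by simp
    from less.hyps[OF this finY False v'Y] obtain k where
      k: "\<forall>s\<in>{1..q - e}. s \<le> Suc (k s) \<and> k s + 2 \<le> card Y + s"
        "\<forall>s. 1 \<le> s \<and> s < q - e \<longrightarrow> k s < k (Suc s)"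
        "card {w \<in> mons Y (q - e). w < v'} = (\<Sum>s\<in>{1..q - e}. k s choose s)"
        "card {w \<in> mons Y (Suc (q - e)). w < v' + var (Max Y)} = (\<Sum>s\<in>{1..q - e}. Suc (k s) choose Suc s)"
      by blast
    have Y1: "card Y \<ge> 1" using finY False by (simp add: Suc_leI card_gt_0_iff)
    \<comment> \<open>The exponents \<open>j < e\<close> of \<open>x_a\<close> contribute all
      monomials in \<open>Y\<close> of degree \<open>s = q - j > q - e\<close>, and there are
      \<open>(card Y + s - 1) choose s\<close> of them.\<close>
    define k' where "k' s = (if s \<le> q - e then k s else card Y + s - 1)" for s
    have b: "s \<le> Suc (k' s) \<and> k' s + 2 \<le> card X + s" if "s \<in> {1..q}" for s
    proof (cases "s \<le> q - e")
      case True
      then have "s \<le> Suc (k s) \<and> k s + 2 \<le> card Y + s" using k(1) that by simp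
      then show ?thesis using True cX by (simp add: k'_def)
    next
      case False
      then show ?thesis using Y1 cX by (simp add: k'_def)
    qed
    have inc: "k' s < k' (Suc s)" if s: "1 \<le> s \<and> s < q" for s
    proof -
      consider "Suc s \<le> q - e" | "s = q - e" | "s > q - e" by linarith
      then show ?thesis
      proof cases
        case 1
        then show ?thesis using k(2) s by (simp add: k'_def)
      next
        case 2
        then have "k s + 2 \<le> card Y + s" using k(1) s by auto
        then show ?thesis using 2 by (simp add: k'_def)
      next
        case 3
        then show ?thesis using Y1 by (simp add: k'_def)
      qed
    qed
    have c1: "card {w \<in> mons X q. w < v} = (\<Sum>s\<in>{1..q}. k' s choose s)"
    proof -
      have "card {w \<in> mons X q. w < v} = (\<Sum>j<e. card (mons Y (q - j))) + card {w \<in> mons Y (q - e). w < v'}"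
        unfolding v'(1) Y_def using card_less_slices[OF X(1) a _ e] v'Y by (simp add: Y_def)
      also have "(\<Sum>j<e. card (mons Y (q - j))) = (\<Sum>s\<in>{Suc (q - e)..q}. card (mons Y s))"
        by (rule sum_upper_flip[OF e])
      also have "\<dots> = (\<Sum>s\<in>{Suc (q - e)..q}. k' s choose s)"
        by (intro sum.cong refl) (auto simp: card_mons[OF finY] k'_def)
      also have "card {w \<in> mons Y (q - e). w < v'} = (\<Sum>s\<in>{1..q - e}. k' s choose s)"
        unfolding k(3) by (intro sum.cong refl) (auto simp: k'_def)
      finally show ?thesis using sum_split_at[of "q - e" q "\<lambda>s. k' s choose s"] by simp
    qed
    have c2: "card {w \<in> mons X (Suc q). w < v + var (Max X)} = (\<Sum>s\<in>{1..q}. Suc (k' s) choose Suc s)"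
    proof -
      have eq: "v + var (Max X) = (v' + var (Max Y)) + single a e" by (simp add: v'(1) mx ac_simps)
      have "v' + var (Max Y) \<in> mons Y (Suc (q - e))"
        using mons_add_var[OF v'Y Max_in[OF finY False]] .
      then have m: "v' + var (Max Y) \<in> mons (X - {a}) (Suc q - e)" using e by (simp add: Y_def Suc_diff_le)
      have "card {w \<in> mons X (Suc q). w < v + var (Max X)} = (\<Sum>j<e. card (mons Y (Suc q - j)))
          + card {w \<in> mons Y (Suc q - e). w < v' + var (Max Y)}"
        unfolding eq using card_less_slices[OF X(1) a m] e by (simp add: Y_def)
      also have "(\<Sum>j<e. card (mons Y (Suc q - j))) = (\<Sum>j<e. card (mons Y (Suc (q - j))))"
        using e by (intro sum.cong refl) (simp add: Suc_diff_le)
      also have "\<dots> = (\<Sum>s\<in>{Suc (q - e)..q}. card (mons Y (Suc s)))"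
        by (rule sum_upper_flip[OF e])
      also have "\<dots> = (\<Sum>s\<in>{Suc (q - e)..q}. Suc (k' s) choose Suc s)"
        using Y1 by (intro sum.cong refl) (auto simp: card_mons[OF finY] k'_def simp del: binomial_Suc_Suc)
      also have "card {w \<in> mons Y (Suc q - e). w < v' + var (Max Y)} = (\<Sum>s\<in>{1..q - e}. Suc (k s) choose Suc s)"
        using k(4) e by (simp add: Suc_diff_le)
      also have "\<dots> = (\<Sum>s\<in>{1..q - e}. Suc (k' s) choose Suc s)"
        by (intro sum.cong refl) (auto simp: k'_def)
      finally show ?thesis using sum_split_at[of "q - e" q "\<lambda>s. Suc (k' s) choose Suc s"] by simp
    qed
    show ?thesis using b inc c1 c2 by (intro exI[of _ k']) blast
  qed
qed

text \<open>By induction the terms below the top one add up to less than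
  \<open>Suc (k q) choose q \<le> k (Suc q) choose q\<close>, and Pascal's rule adds the top term.
  So \<open>a\<close> determines the top entry.\<close>

lemma macaulay_rep_bounds:
  assumes "macaulay_rep a q k j"
  shows "k q choose q \<le> a" "a < Suc (k q) choose q"
proof -
  have "k q choose q \<le> a \<and> a < Suc (k q) choose q \<and> q \<le> k q"
    using assms
  proof (induction q arbitrary: a)
    case 0
    then show ?case by (auto simp: macaulay_rep_def)
  next
    case (Suc q)
    note r = Suc.prems[unfolded macaulay_rep_def]
    show ?case
    proof (cases "j = Suc q")
      case True
      then show ?thesis using r by auto
    next
      case False
      then have jq: "j \<le> q" using r by simp
      define a' where "a' = (\<Sum>i=j..q. k i choose i)"
      have a': "a = a' + (k (Suc q) choose Suc q)" using r jq by (simp add: a'_def)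
      have "macaulay_rep a' q k j" using r jq by (auto simp: macaulay_rep_def a'_def)
      then have IH: "a' < Suc (k q) choose q" "q \<le> k q" using Suc.IH by blast+
      have lt: "k q < k (Suc q)" using r jq by simp
      then have "Suc (k q) choose q \<le> k (Suc q) choose q"
        by (intro binomial_right_mono) auto
      then show ?thesis using a' IH lt by auto
    qed
  qed
  then show "k q choose q \<le> a" "a < Suc (k q) choose q" by auto
qed

text \<open>Only the raised sums are compared, since \<open>k\<close> is arbitrary outside
  \<open>{j..q}\<close>; this is what the \<open>THE\<close> in \<open>macaulay_upper\<close>
  requires. The top entries agree by the bounds, and the rest of \<open>a\<close> is zero exactly if
  the representation consists of its top term.\<close>

lemma macaulay_rep_unique:
  assumes "macaulay_rep a q k j" "macaulay_rep a q k' j'"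
  shows "(\<Sum>i=j..q. (k i + 1) choose (i + 1)) = (\<Sum>i=j'..q. (k' i + 1) choose (i + 1))"
  using assms
proof (induction q arbitrary: a)
  case 0
  then show ?case by (simp add: macaulay_rep_def)
next
  case (Suc q)
  have b: "k (Suc q) choose Suc q \<le> a" "a < Suc (k (Suc q)) choose Suc q"
    "k' (Suc q) choose Suc q \<le> a" "a < Suc (k' (Suc q)) choose Suc q"
    using macaulay_rep_bounds Suc.prems by blast+
  have eq: "k (Suc q) = k' (Suc q)"
  proof (rule ccontr)
    assume "\<not> ?thesis"
    then consider "Suc (k (Suc q)) \<le> k' (Suc q)" | "Suc (k' (Suc q)) \<le> k (Suc q)" by linarith
    then show False
    proof cases
      case 1
      then have "Suc (k (Suc q)) choose Suc q \<le> k' (Suc q) choose Suc q" by (rule binomial_right_mono)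
      then show False using b by simp
    next
      case 2
      then have "Suc (k' (Suc q)) choose Suc q \<le> k (Suc q) choose Suc q" by (rule binomial_right_mono)
      then show False using b by simp
    qed
  qed
  have dec: "a = (\<Sum>i=l..q. h i choose i) + (h (Suc q) choose Suc q) \<and>
      (\<Sum>i=l..Suc q. (h i + 1) choose (i + 1)) =
      (\<Sum>i=l..q. (h i + 1) choose (i + 1)) + ((h (Suc q) + 1) choose (Suc q + 1))"
    if "macaulay_rep a (Suc q) h l" for h l
    using that by (auto simp: macaulay_rep_def)
  have pos: "0 < (\<Sum>i=l..q. h i choose i) \<longleftrightarrow> l \<noteq> Suc q" if "macaulay_rep a (Suc q) h l" for h l
  proof (cases "l = Suc q")
    case False
    then have "l \<le> q" "l \<le> h l" using that by (auto simp: macaulay_rep_def)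
    then have "0 < h l choose l" "h l choose l \<le> (\<Sum>i=l..q. h i choose i)"
      by (auto intro!: member_le_sum)
    then show ?thesis using False by linarith
  qed simp
  have sub: "macaulay_rep (\<Sum>i=l..q. h i choose i) q h l" if "macaulay_rep a (Suc q) h l" "l \<noteq> Suc q" for h l
    using that by (auto simp: macaulay_rep_def)
  note d1 = dec[OF Suc.prems(1)] and d2 = dec[OF Suc.prems(2)]
  have s: "(\<Sum>i=j..q. k i choose i) = (\<Sum>i=j'..q. k' i choose i)" using d1 d2 eq by simp
  show ?case
  proof (cases "j = Suc q")
    case True
    then have "j' = Suc q" using pos[OF Suc.prems(1)] pos[OF Suc.prems(2)] s by metis
    then show ?thesis using True eq by simp
  next
    case False
    then have "j' \<noteq> Suc q" using pos[OF Suc.prems(1)] pos[OF Suc.prems(2)] s by metis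
    then have "(\<Sum>i=j..q. (k i + 1) choose (i + 1)) = (\<Sum>i=j'..q. (k' i + 1) choose (i + 1))"
      using Suc.IH[OF sub[OF Suc.prems(1) False]] sub[OF Suc.prems(2)] s by simp
    then show ?thesis using d1 d2 eq by simp
  qed
qed

lemma macaulay_upper_eq:
  assumes "macaulay_rep a q k j" "0 < a"
  shows "macaulay_upper a q = (\<Sum>i=j..q. (k i + 1) choose (i + 1))"
proof -
  have "(THE b. \<exists>k j. macaulay_rep a q k j \<and> b = (\<Sum>i=j..q. (k i + 1) choose (i + 1)))
      = (\<Sum>i=j..q. (k i + 1) choose (i + 1))"
    using assms macaulay_rep_unique by (intro the_equality) blast+
  then show ?thesis using assms(2) by (simp add: macaulay_upper_def)
qed

text \<open>The complement of a nonempty lexsegment consists of the monomials below its least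
  element \<open>v\<close>, and the least element of the shade is \<open>v\<close> times the last
  variable. So \<open>lex_count\<close> computes both complements; what remains is to drop its
  vanishing terms.\<close>

lemma card_compl_shade_upset:
  assumes X: "finite X" "X \<noteq> {}" and q: "q \<ge> 1" and L: "upset (mons X q) L"
  shows "card (mons X (Suc q) - shade X L) = macaulay_upper (card (mons X q - L)) q"
proof (cases "L = {}")
  case True
  let ?p = "card X + q - 1"
  have "card X \<ge> 1" using X by (simp add: Suc_leI card_gt_0_iff)
  then have "macaulay_rep (?p choose q) q (\<lambda>_. ?p) q" "0 < ?p choose q"
    using q by (auto simp: macaulay_rep_def)
  then have "macaulay_upper (?p choose q) q = Suc ?p choose Suc q"
    by (subst macaulay_upper_eq) auto
  then show ?thesis using True \<open>card X \<ge> 1\<close> by (simp add: card_mons[OF X(1)] shade_def del: binomial_Suc_Suc)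
next
  case False
  have LA: "L \<subseteq> mons X q" using L by (simp add: upset_def)
  have finL: "finite L" using LA X by (auto intro: finite_subset)
  define v where "v = Min L"
  have v: "v \<in> L" "\<And>u. u \<in> L \<Longrightarrow> v \<le> u" using finL False by (auto simp: v_def)
  have W: "mons X q - L = {w \<in> mons X q. w < v}"
  proof (intro equalityI subsetI)
    fix w assume w: "w \<in> mons X q - L"
    then have "\<not> v < w" "w \<noteq> v" using L v(1) by (auto simp: upset_def)
    then show "w \<in> {w \<in> mons X q. w < v}" using w by auto
  qed (use v(2) in force)
  define z where "z = v + var (Max X)"
  have mX: "Max X \<in> X" using X by simp
  have zS: "z \<in> shade X L" using v(1) mX by (auto simp: shade_def z_def)
  have zle: "z \<le> u" if "u \<in> shade X L" for u
  proof -
    from that obtain w i where w: "u = w + var i" "w \<in> L" "i \<in> X" by (auto simp: shade_def)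
    have "i \<le> Max X" using X w(3) by simp
    then have "\<not> var i < var (Max X)" by (simp add: var_less_iff)
    then have "var (Max X) \<le> var i" by simp
    then show ?thesis using v(2)[OF w(2)] w(1) by (auto simp: z_def intro: add_mono)
  qed
  have W': "mons X (Suc q) - shade X L = {w \<in> mons X (Suc q). w < z}"
  proof (intro equalityI subsetI)
    fix w assume w: "w \<in> mons X (Suc q) - shade X L"
    then have "\<not> z < w" "w \<noteq> z" using shade_upset[OF X(1) L] zS by (auto simp: upset_def)
    then show "w \<in> {w \<in> mons X (Suc q). w < z}" using w by auto
  qed (use zle in force)
  obtain k where k: "\<forall>s\<in>{1..q}. s \<le> Suc (k s) \<and> k s + 2 \<le> card X + s"
      "\<forall>s. 1 \<le> s \<and> s < q \<longrightarrow> k s < k (Suc s)"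
      "card {w \<in> mons X q. w < v} = (\<Sum>s\<in>{1..q}. k s choose s)"
      "card {w \<in> mons X (Suc q). w < v + var (Max X)} = (\<Sum>s\<in>{1..q}. Suc (k s) choose Suc s)"
    using lex_count[OF X, of v q] v(1) LA by blast
  let ?a = "card (mons X q - L)"
  have a: "?a = (\<Sum>s\<in>{1..q}. k s choose s)" using k(3) W by simp
  have a': "card (mons X (Suc q) - shade X L) = (\<Sum>s\<in>{1..q}. Suc (k s) choose Suc s)"
    using k(4) W' by (simp add: z_def)
  show ?thesis
  proof (cases "?a = 0")
    case True
    then have "\<forall>s\<in>{1..q}. k s choose s = 0" using a by simp
    then have "\<forall>s\<in>{1..q}. k s < s" by (simp add: binomial_eq_0_iff)
    then have "(\<Sum>s\<in>{1..q}. Suc (k s) choose Suc s) = 0" by (auto simp: binomial_eq_0_iff simp del: binomial_Suc_Suc)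
    then show ?thesis using True a' by (simp add: macaulay_upper_def)
  next
    case False
    then obtain s0 where s0: "s0 \<in> {1..q}" "k s0 choose s0 \<noteq> 0" unfolding a by (meson sum.neutral)
    then have s0': "1 \<le> s0 \<and> s0 \<le> q \<and> s0 \<le> k s0"
      using binomial_eq_0[of "k s0" s0] by (metis atLeastAtMost_iff not_le)
    \<comment> \<open>Below the first \<open>j\<close> with \<open>j \<le> k j\<close> the terms of
      both sums vanish: \<open>k s < s\<close> also gives \<open>Suc (k s) < Suc s\<close>.\<close>
    define j where "j = (LEAST s. 1 \<le> s \<and> s \<le> q \<and> s \<le> k s)"
    have j: "1 \<le> j" "j \<le> q" "j \<le> k j"
      using LeastI[of "\<lambda>s. 1 \<le> s \<and> s \<le> q \<and> s \<le> k s", OF s0'] by (auto simp: j_def)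
    have jl: "k s < s" if "1 \<le> s" "s < j" for s
      using not_less_Least[of s "\<lambda>s. 1 \<le> s \<and> s \<le> q \<and> s \<le> k s", folded j_def] that j
      by (metis leI le_trans less_imp_le)
    have "(\<Sum>s\<in>{1..q}. k s choose s) = (\<Sum>i=j..q. k i choose i)"
      using j jl by (intro sum.mono_neutral_right) (auto simp: binomial_eq_0_iff)
    then have "macaulay_rep ?a q k j" using j k(2) a by (auto simp: macaulay_rep_def)
    then have "macaulay_upper ?a q = (\<Sum>i=j..q. (k i + 1) choose (i + 1))"
      using macaulay_upper_eq False by blast
    also have "\<dots> = (\<Sum>s\<in>{1..q}. Suc (k s) choose Suc s)"
      using j jl by (intro sum.mono_neutral_cong_left) (auto simp: binomial_eq_0_iff simp del: binomial_Suc_Suc)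
    finally show ?thesis using a' by simp
  qed
qed

section \<open>Macaulay's theorem in terms of order ideals of monomials\<close>

definition order_ideal :: "nat \<Rightarrow> monomial set \<Rightarrow> bool" where
  "order_ideal n D \<longleftrightarrow> D \<subseteq> monomials n \<and> (\<forall>u i. u + var i \<in> D \<longrightarrow> u \<in> D)"

definition lex_closed :: "nat \<Rightarrow> monomial set \<Rightarrow> bool" where
  "lex_closed n D \<longleftrightarrow> (\<forall>u\<in>D. \<forall>v\<in>monomials n. mdeg v = mdeg u \<and> v < u \<longrightarrow> v \<in> D)"

lemma in_mons_iff: "u \<in> mons {..<n} q \<longleftrightarrow> u \<in> monomials n \<and> mdeg u = q"
  by (simp add: mons_def monomials_def)

text \<open>The complement \<open>V\<close> of \<open>D\<close> in degree \<open>q\<close> has a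
  shade disjoint from \<open>D\<close>. Passing to the lexsegment of the size of \<open>V\<close>
  does not enlarge the shade, and for lexsegments the bound is an equality.\<close>

lemma order_ideal_macaulay:
  assumes n: "n \<ge> 1" and D: "order_ideal n D" and q: "q \<ge> 1"
  shows "card (D \<inter> mons {..<n} (Suc q)) \<le> macaulay_upper (card (D \<inter> mons {..<n} q)) q"
proof -
  let ?X = "{..<n}" and ?A = "mons {..<n} q" and ?B = "mons {..<n} (Suc q)"
  have fin: "finite ?A" "finite ?B" by simp_all
  have X0: "?X \<noteq> {}" using n by (metis lessThan_iff less_eq_Suc_le One_nat_def empty_iff)
  define V where "V = ?A - D"
  define L where "L = topk ?A (card V)"
  have VA: "V \<subseteq> ?A" by (auto simp: V_def)
  have L: "upset ?A L" "card L = card V"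
    using topk[OF fin(1) card_mono[OF fin(1) VA]] by (auto simp: L_def)
  have LA: "L \<subseteq> ?A" using L by (simp add: upset_def)
  have "D \<inter> ?B \<subseteq> ?B - shade ?X V"
    using D by (auto simp: shade_def V_def order_ideal_def)
  then have "card (D \<inter> ?B) \<le> card (?B - shade ?X V)" using fin by (intro card_mono) auto
  also have "\<dots> = card ?B - card (shade ?X V)"
    using shade_mons[OF VA] fin by (intro card_Diff_subset) (auto intro: finite_subset)
  also have "\<dots> \<le> card ?B - card (shade ?X L)"
    using card_shade_topk_le[of ?X V q] VA unfolding L_def by (intro diff_le_mono2) simp
  also have "\<dots> = card (?B - shade ?X L)"
    using shade_mons[OF LA] fin by (intro card_Diff_subset[symmetric]) (auto intro: finite_subset)
  also have "\<dots> = macaulay_upper (card (?A - L)) q"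
    using X0 q L(1) by (intro card_compl_shade_upset) auto
  also have "card (?A - L) = card ?A - card V"
    using LA fin L(2) by (subst card_Diff_subset) (auto intro: finite_subset)
  also have "\<dots> = card (?A - V)"
    using VA fin by (intro card_Diff_subset[symmetric]) (auto intro: finite_subset)
  also have "?A - V = D \<inter> ?A" by (auto simp: V_def)
  finally show ?thesis .
qed

text \<open>In each degree the complement of \<open>W\<close> is the lexsegment whose size leaves
  \<open>h q\<close> monomials. The growth condition on \<open>h\<close> says that the shade of one
  is not larger than the next, and between lexsegments that means inclusion.\<close>

lemma lex_order_ideal_exists:
  assumes n: "n \<ge> 1" and h: "h 0 = 1" "h 1 \<le> n" "\<And>q. q \<ge> 1 \<Longrightarrow> h (Suc q) \<le> macaulay_upper (h q) q"
  shows "\<exists>W. order_ideal n W \<and> lex_closed n W \<and> (\<forall>q. card (W \<inter> mons {..<n} q) = h q)"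
proof -
  let ?X = "{..<n}" and ?M = "\<lambda>q. mons {..<n} q"
  define L where "L q = topk (?M q) (card (?M q) - h q)" for q
  have fin: "finite (?M q)" for q by simp
  have X0: "?X \<noteq> {}" using n by (metis lessThan_iff less_eq_Suc_le One_nat_def empty_iff)
  have L: "upset (?M q) (L q)" "card (L q) = card (?M q) - h q" for q
    using topk[OF fin[of q], of "card (?M q) - h q"] by (auto simp: L_def)
  have LM: "L q \<subseteq> ?M q" for q using L(1) by (simp add: upset_def)
  have cW: "card (?M q - L q) = h q" if "h q \<le> card (?M q)" for q
    using that L(2)[of q] LM[of q] fin[of q] by (subst card_Diff_subset) (auto intro: finite_subset)
  have up: "card (?M (Suc q) - shade ?X (L q)) = macaulay_upper (h q) q" if "q \<ge> 1" "h q \<le> card (?M q)" for q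
    using card_compl_shade_upset[of ?X q "L q"] that X0 L(1) cW by auto
  have le: "h q \<le> card (?M q)" for q
  proof (induction q)
    case 0
    then show ?case using n h(1) by (simp add: card_mons)
  next
    case (Suc q)
    show ?case
    proof (cases "q = 0")
      case True
      then show ?thesis using h(2) by (simp add: card_mons)
    next
      case False
      then have "h (Suc q) \<le> card (?M (Suc q) - shade ?X (L q))" using up[of q] Suc h(3)[of q] by simp
      also have "\<dots> \<le> card (?M (Suc q))" by (intro card_mono) auto
      finally show ?thesis .
    qed
  qed
  have sub: "shade ?X (L q) \<subseteq> L (Suc q)" for q
  proof (cases "q = 0")
    case True
    \<comment> \<open>In degree 0 the lexsegment is empty because \<open>h 0 = 1\<close>; the growth
      condition starts only at \<open>q = 1\<close>.\<close>
    have "card (?M 0) = 1" using n by (simp add: card_mons)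
    then have "card (L 0) = 0" using L(2)[of 0] h(1) by simp
    then have "L 0 = {}" using LM[of 0] fin[of 0] by (metis card_eq_0_iff finite_subset)
    then show ?thesis using True by (simp add: shade_def)
  next
    case False
    have s: "upset (?M (Suc q)) (shade ?X (L q))" using L(1) by (intro shade_upset) auto
    have sM: "shade ?X (L q) \<subseteq> ?M (Suc q)" using s by (simp add: upset_def)
    have "card (?M (Suc q) - shade ?X (L q)) = card (?M (Suc q)) - card (shade ?X (L q))"
      using sM fin by (intro card_Diff_subset) (auto intro: finite_subset)
    moreover have "h (Suc q) \<le> card (?M (Suc q) - shade ?X (L q))"
      using up[of q] h(3)[of q] le False by simp
    moreover have "card (shade ?X (L q)) \<le> card (?M (Suc q))" using sM by (intro card_mono) auto
    ultimately have "card (shade ?X (L q)) \<le> card (L (Suc q))"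
      using L(2)[of "Suc q"] le[of "Suc q"] by linarith
    then show ?thesis using upset_subset_if_card_le[OF fin s L(1)] by simp
  qed
  define W where "W = {u \<in> monomials n. u \<notin> L (mdeg u)}"
  have Wq: "W \<inter> ?M q = ?M q - L q" for q by (auto simp: W_def in_mons_iff)
  have "order_ideal n W" unfolding order_ideal_def
  proof (intro conjI allI impI)
    show "W \<subseteq> monomials n" by (auto simp: W_def)
    fix u i assume a: "u + var i \<in> W"
    then have "u \<in> monomials n" "i \<in> ?X" by (auto simp: W_def monomials_def keys_add_nat)
    moreover have "u \<notin> L (mdeg u)"
    proof
      assume "u \<in> L (mdeg u)"
      then have "u + var i \<in> L (Suc (mdeg u))" using sub[of "mdeg u"] \<open>i \<in> ?X\<close> by (auto simp: shade_def)
      then show False using a by (simp add: W_def)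
    qed
    ultimately show "u \<in> W" by (simp add: W_def)
  qed
  moreover have "lex_closed n W" unfolding lex_closed_def
  proof (intro ballI impI)
    fix u v assume a: "u \<in> W" "v \<in> monomials n" "mdeg v = mdeg u \<and> v < u"
    then have "u \<in> ?M (mdeg u)" by (simp add: W_def in_mons_iff)
    then have "v \<notin> L (mdeg u)" using a L(1)[of "mdeg u"] unfolding upset_def W_def by blast
    then show "v \<in> W" using a by (simp add: W_def)
  qed
  moreover have "card (W \<inter> ?M q) = h q" for q using Wq cW le by simp
  ultimately show ?thesis by blast
qed

section \<open>Regular sequences and socles\<close>

lemma module_mult: "Modules.module ((*) :: 'a::comm_ring_1 \<Rightarrow> 'a \<Rightarrow> 'a)"
  by standard (simp_all add: algebra_simps)

text \<open>A commutative ring is a module over itself, and its submodules are the ideals. For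
  \<open>polynomial\<close> the ideal is generated in the ring of all variables, including those of
  index at least \<open>n\<close>.\<close>

abbreviation ideal_span :: "'a::comm_ring_1 set \<Rightarrow> 'a set" where
  "ideal_span \<equiv> Modules.module.span (*)"

lemmas ideal_span_zero = Modules.module.span_zero[OF module_mult]
lemmas ideal_span_base = Modules.module.span_base[OF module_mult]
lemmas ideal_span_add = Modules.module.span_add[OF module_mult]
lemmas ideal_span_neg = Modules.module.span_neg[OF module_mult]
lemmas ideal_span_diff = Modules.module.span_diff[OF module_mult]
lemmas ideal_span_sum = Modules.module.span_sum[OF module_mult]
lemmas ideal_span_mult = Modules.module.span_scale[OF module_mult]
lemmas ideal_span_insert = Modules.module.span_insert[OF module_mult]
lemmas ideal_span_induct =
  Modules.module.span_induct_alt[OF module_mult, consumes 1, case_names base step]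

definition nonzerodiv :: "'a::comm_ring_1 \<Rightarrow> 'a set \<Rightarrow> bool" where
  "nonzerodiv f A \<longleftrightarrow> (\<forall>g. f * g \<in> A \<longrightarrow> g \<in> A)"

definition no_socle :: "'a::comm_ring_1 set \<Rightarrow> 'a set \<Rightarrow> bool" where
  "no_socle X A \<longleftrightarrow> (\<forall>g. (\<forall>x\<in>X. x * g \<in> A) \<longrightarrow> g \<in> A)"

text \<open>Weak regularity on the quotient by the ideal generated by \<open>S\<close>: the final
  ideal may be the whole ring. Carrying generators instead of an ideal lets elements of the list
  join \<open>S\<close> one by one.\<close>

fun regular_list :: "'a::comm_ring_1 set \<Rightarrow> 'a list \<Rightarrow> bool" where
  "regular_list S [] \<longleftrightarrow> True"
| "regular_list S (f # fs) \<longleftrightarrow> nonzerodiv f (ideal_span S) \<and> regular_list (insert f S) fs"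

lemma regular_list_append:
  "regular_list S (fs @ gs) \<longleftrightarrow> regular_list S fs \<and> regular_list (set fs \<union> S) gs"
  by (induction fs arbitrary: S) auto

lemma span_insert_iff: "x \<in> ideal_span (insert f S) \<longleftrightarrow> (\<exists>k. x - k * f \<in> ideal_span S)"
  for f :: "'a::comm_ring_1"
  by (simp add: ideal_span_insert)

lemma span_mult_left: "x \<in> ideal_span S \<Longrightarrow> c * x \<in> ideal_span S" for x :: "'a::comm_ring_1"
  by (rule ideal_span_mult)

lemma span_mult_right: "x \<in> ideal_span S \<Longrightarrow> x * c \<in> ideal_span S" for x :: "'a::comm_ring_1"
  using ideal_span_mult[of x S c] by (simp add: mult.commute)

text \<open>The half of permutability of regular sequences that holds without grading or local
  assumptions: in \<open>a m = k b\<close> modulo \<open>S\<close> the factor \<open>k\<close> is a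
  multiple of \<open>a\<close> modulo \<open>S\<close>, because \<open>b\<close> is regular modulo
  \<open>a\<close>, and then \<open>a\<close> cancels.\<close>

lemma nonzerodiv_swap:
  assumes a: "nonzerodiv a (ideal_span S)" and ba: "nonzerodiv b (ideal_span (insert a S))"
  shows "nonzerodiv a (ideal_span (insert b S))"
  unfolding nonzerodiv_def
proof (intro allI impI)
  fix m assume "a * m \<in> ideal_span (insert b S)"
  then obtain k where k: "a * m - k * b \<in> ideal_span S" by (auto simp: span_insert_iff)
  have "b * k - m * a = - (a * m - k * b)" by (simp add: algebra_simps)
  then have "b * k - m * a \<in> ideal_span S" using ideal_span_neg[OF k] by (simp add: mult.commute)
  then have "b * k \<in> ideal_span (insert a S)" by (auto simp: span_insert_iff)
  then have "k \<in> ideal_span (insert a S)" using ba by (simp add: nonzerodiv_def)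
  then obtain l where l: "k - l * a \<in> ideal_span S" by (auto simp: span_insert_iff)
  have "a * (m - l * b) = (a * m - k * b) + b * (k - l * a)" by (simp add: algebra_simps)
  then have "a * (m - l * b) \<in> ideal_span S"
    using ideal_span_add[OF k span_mult_left[OF l]] by simp
  then have "m - l * b \<in> ideal_span S" using a by (simp add: nonzerodiv_def)
  then show "m \<in> ideal_span (insert b S)" by (auto simp: span_insert_iff)
qed

lemma mult_mem_if_generators:
  assumes "f \<in> ideal_span X" "\<forall>x\<in>X. x * g \<in> ideal_span S"
  shows "f * g \<in> ideal_span S"
  using assms(1)
proof (induction rule: ideal_span_induct)
  case (step c x y)
  have "c * (x * g) + y * g \<in> ideal_span S"
    using step assms(2) by (blast intro: ideal_span_add span_mult_left)
  then show ?case by (simp add: algebra_simps)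
qed (simp add: ideal_span_zero)

lemma nonzerodiv_no_socle:
  assumes "f \<in> ideal_span X" "nonzerodiv f (ideal_span S)"
  shows "no_socle X (ideal_span S)"
  unfolding no_socle_def
proof (intro allI impI)
  fix g assume "\<forall>x\<in>X. x * g \<in> ideal_span S"
  from mult_mem_if_generators[OF assms(1) this] show "g \<in> ideal_span S"
    using assms(2) by (simp add: nonzerodiv_def)
qed

text \<open>For two regular elements \<open>a\<close>, \<open>b\<close> of the ideal \<open>(X)\<close> the socles of \<open>M/aM\<close> and \<open>M/bM\<close> are isomorphic:
  \<open>m\<close> is sent to \<open>m'\<close> with \<open>b m = a m'\<close>.\<close>

lemma no_socle_exchange:
  assumes a: "a \<in> ideal_span X" "nonzerodiv a (ideal_span S)"
    and b: "b \<in> ideal_span X" "nonzerodiv b (ideal_span S)"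
    and soc: "no_socle X (ideal_span (insert b S))"
  shows "no_socle X (ideal_span (insert a S))"
  unfolding no_socle_def
proof (intro allI impI)
  fix m assume m: "\<forall>x\<in>X. x * m \<in> ideal_span (insert a S)"
  have "b * m \<in> ideal_span (insert a S)" by (rule mult_mem_if_generators[OF b(1) m])
  then obtain m' where m': "b * m - m' * a \<in> ideal_span S" by (auto simp: span_insert_iff)
  have "x * m' \<in> ideal_span (insert b S)" if x: "x \<in> X" for x
  proof -
    obtain k where k: "x * m - k * a \<in> ideal_span S" using m x by (auto simp: span_insert_iff)
    have "a * (x * m' - k * b) = b * (x * m - k * a) - x * (b * m - m' * a)"
      by (simp add: algebra_simps)
    then have "a * (x * m' - k * b) \<in> ideal_span S"
      using ideal_span_diff[OF span_mult_left[OF k] span_mult_left[OF m']] by simp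
    then show ?thesis using a(2) by (auto simp: nonzerodiv_def span_insert_iff)
  qed
  then have "m' \<in> ideal_span (insert b S)" using soc by (simp add: no_socle_def)
  then obtain l where l: "m' - l * b \<in> ideal_span S" by (auto simp: span_insert_iff)
  have "b * (m - l * a) = (b * m - m' * a) + a * (m' - l * b)" by (simp add: algebra_simps)
  then have "b * (m - l * a) \<in> ideal_span S"
    using ideal_span_add[OF m' span_mult_left[OF l]] by simp
  then have "m - l * a \<in> ideal_span S" using b(2) by (simp add: nonzerodiv_def)
  then show "m \<in> ideal_span (insert a S)" by (auto simp: span_insert_iff)
qed

section \<open>Coefficients with respect to a set of variables\<close>

lemma poly_sum_singles: "f = (\<Sum>u\<in>keys f. single u (lookup f u))" for f :: "'a \<Rightarrow>\<^sub>0 'b::comm_monoid_add"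
proof (rule poly_mapping_eqI)
  fix u
  have "lookup (\<Sum>u\<in>keys f. single u (lookup f u)) u = (\<Sum>v\<in>keys f. if v = u then lookup f v else 0)"
    by (simp add: lookup_sum lookup_single when_def)
  then show "lookup f u = lookup (\<Sum>u\<in>keys f. single u (lookup f u)) u" by (simp add: in_keys_iff)
qed

lemma poly_induct [case_names zero single add]:
  fixes f :: "'a \<Rightarrow>\<^sub>0 'b::comm_monoid_add"
  assumes "P 0" "\<And>u c. P (single u c)" "\<And>f g. P f \<Longrightarrow> P g \<Longrightarrow> P (f + g)"
  shows "P f"
proof -
  have "P (\<Sum>u\<in>A. single u (lookup f u))" if "finite A" for A
    using that by (induction rule: finite_induct) (auto intro: assms)
  then show ?thesis using poly_sum_singles[of f] by (metis finite_keys)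
qed

lemma monomial_dvd_iff: "(\<exists>v. u = w + v) \<longleftrightarrow> (\<forall>i. lookup w i \<le> lookup u i)" for u w :: monomial
proof
  assume "\<forall>i. lookup w i \<le> lookup u i"
  then have "u = w + (u - w)" by (intro poly_mapping_eqI) (simp add: lookup_add lookup_minus)
  then show "\<exists>v. u = w + v" ..
qed (auto simp: lookup_add)

lemma lookup_single_mult:
  fixes f :: "monomial \<Rightarrow>\<^sub>0 'b::comm_ring_1"
  shows "lookup (single w c * f) u =
    (if \<forall>i. lookup w i \<le> lookup u i then c * lookup f (u - w) else 0)"
proof (induction f rule: poly_induct)
  case (single v d)
  have eq: "w + v = u \<longleftrightarrow> (\<forall>i. lookup w i \<le> lookup u i) \<and> v = u - w"
    by (metis add_diff_cancel_left' monomial_dvd_iff)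
  show ?case by (auto simp: mult_single lookup_single when_def eq)
qed (auto simp: lookup_add algebra_simps)

lemma lookup_single_mult_add:
  "lookup (single w c * f) (w + v) = c * lookup f v" for f :: "monomial \<Rightarrow>\<^sub>0 'b::comm_ring_1"
  by (simp add: lookup_single_mult lookup_add)

lemma lookup_single_mult_zero:
  "\<not> (\<forall>i. lookup w i \<le> lookup u i) \<Longrightarrow> lookup (single w c * f) u = 0"
  for f :: "monomial \<Rightarrow>\<^sub>0 'b::comm_ring_1"
  by (simp only: lookup_single_mult if_False)

lemma keys_single_mult:
  fixes f :: "monomial \<Rightarrow>\<^sub>0 'b::idom"
  assumes "c \<noteq> 0"
  shows "keys (single w c * f) = (+) w ` keys f"
proof (intro equalityI subsetI)
  fix u assume "u \<in> keys (single w c * f)"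
  then have "\<forall>i. lookup w i \<le> lookup u i" "lookup f (u - w) \<noteq> 0"
    by (auto simp: in_keys_iff lookup_single_mult split: if_splits)
  moreover from this obtain v where "u = w + v" using monomial_dvd_iff by blast
  ultimately show "u \<in> (+) w ` keys f" by (auto simp: in_keys_iff)
qed (use assms in \<open>auto simp: in_keys_iff lookup_single_mult_add\<close>)

text \<open>The coefficient of \<open>b\<close> when \<open>f\<close> is read as a polynomial in the
  variables \<open>Y\<close> over the remaining ones; it is meant for \<open>b\<close> supported in
  \<open>Y\<close>.\<close>

definition pslice :: "nat set \<Rightarrow> monomial \<Rightarrow> (monomial \<Rightarrow>\<^sub>0 'b::comm_ring_1) \<Rightarrow> (monomial \<Rightarrow>\<^sub>0 'b)" where
  "pslice Y b f = Abs_poly_mapping (\<lambda>u. if keys u \<inter> Y = {} then lookup f (u + b) else 0)"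

lemma lookup_pslice: "lookup (pslice Y b f) u = (if keys u \<inter> Y = {} then lookup f (u + b) else 0)"
proof -
  have "finite ((\<lambda>u. u + b) -` keys f)" by (rule finite_vimageI) (auto simp: inj_on_def)
  then have "finite {u. (if keys u \<inter> Y = {} then lookup f (u + b) else 0) \<noteq> 0}"
    by (rule finite_subset[rotated]) (auto simp: in_keys_iff)
  then show ?thesis by (simp add: pslice_def)
qed

lemma pslice_add: "pslice Y b (f + g) = pslice Y b f + pslice Y b g"
  by (rule poly_mapping_eqI) (simp add: lookup_pslice lookup_add)

lemma pslice_zero [simp]: "pslice Y b 0 = 0"
  by (rule poly_mapping_eqI) (simp add: lookup_pslice)

lemma pslice_sum: "pslice Y b (sum f A) = (\<Sum>a\<in>A. pslice Y b (f a))"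
  by (induction A rule: infinite_finite_induct) (auto simp: pslice_add)

definition free_of :: "nat set \<Rightarrow> (monomial \<Rightarrow>\<^sub>0 'b::zero) \<Rightarrow> bool" where
  "free_of Y f \<longleftrightarrow> (\<forall>u\<in>keys f. keys u \<inter> Y = {})"

lemma pslice_single_mult:
  assumes "keys b \<subseteq> Y" "keys w \<inter> Y = {}"
  shows "pslice Y b (single w c * f) = single w c * pslice Y b f"
proof (rule poly_mapping_eqI)
  fix u :: monomial
  have wb: "lookup w i = 0 \<or> lookup b i = 0" for i
    using assms by (meson disjoint_iff in_keys_iff subsetD)
  show "lookup (pslice Y b (single w c * f)) u = lookup (single w c * pslice Y b f) u"
  proof (cases "\<forall>i. lookup w i \<le> lookup u i")
    case True
    then obtain v where v: "u = w + v" using monomial_dvd_iff by blast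
    have "keys u \<inter> Y = {} \<longleftrightarrow> keys v \<inter> Y = {}" using assms(2) by (auto simp: v keys_add_nat)
    then show ?thesis
      by (simp add: lookup_pslice v lookup_single_mult_add add.assoc)
  next
    case False
    then have "\<not> (\<forall>i. lookup w i \<le> lookup (u + b) i)"
      using wb by (metis add.right_neutral lookup_add zero_le)
    from lookup_single_mult_zero[OF this, of c f] lookup_single_mult_zero[OF False, of c "pslice Y b f"]
    show ?thesis by (simp only: lookup_pslice if_cancel)
  qed
qed

lemma pslice_mult:
  assumes "keys b \<subseteq> Y" "free_of Y p"
  shows "pslice Y b (p * f) = p * pslice Y b f"
proof -
  have "p * f = (\<Sum>w\<in>keys p. single w (lookup p w) * f)"
    by (subst poly_sum_singles[of p]) (simp add: sum_distrib_right)
  then have "pslice Y b (p * f) = (\<Sum>w\<in>keys p. pslice Y b (single w (lookup p w) * f))"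
    by (simp add: pslice_sum)
  also have "\<dots> = (\<Sum>w\<in>keys p. single w (lookup p w) * pslice Y b f)"
    using assms by (intro sum.cong refl pslice_single_mult) (auto simp: free_of_def)
  also have "\<dots> = p * pslice Y b f"
    by (subst (3) poly_sum_singles[of p]) (simp add: sum_distrib_right)
  finally show ?thesis .
qed

text \<open>Taking coefficients is linear over the polynomials free of \<open>Y\<close>. Together
  with \<open>span_if_pslices\<close>, membership in an ideal with such generators is decided
  coefficient by coefficient.\<close>

lemma pslice_span:
  assumes "keys b \<subseteq> Y" "\<forall>p\<in>S. free_of Y p" "f \<in> ideal_span S"
  shows "pslice Y b f \<in> ideal_span S"
  using assms(3)
proof (induction rule: ideal_span_induct)
  case (step c x y)
  have "pslice Y b (c * x + y) = x * pslice Y b c + pslice Y b y"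
    using pslice_mult[OF assms(1), of x c] step.hyps assms(2) by (simp add: pslice_add mult.commute)
  also have "\<dots> \<in> ideal_span S"
    using step by (blast intro: ideal_span_add span_mult_right ideal_span_base)
  finally show ?case .
qed (simp add: ideal_span_zero)

definition restr :: "nat set \<Rightarrow> monomial \<Rightarrow> monomial" where
  "restr Y u = Abs_poly_mapping (\<lambda>i. if i \<in> Y then lookup u i else 0)"

lemma lookup_restr: "lookup (restr Y u) i = (if i \<in> Y then lookup u i else 0)"
proof -
  have "finite {i. (if i \<in> Y then lookup u i else 0) \<noteq> 0}"
    by (rule finite_subset[OF _ finite_keys[of u]]) (auto simp: in_keys_iff)
  then show ?thesis by (simp add: restr_def)
qed

lemma keys_restr: "keys (restr Y u) = keys u \<inter> Y"
  by (auto simp: in_keys_iff lookup_restr split: if_splits)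

lemma restr_split: "restr (- Y) u + restr Y u = u"
  by (rule poly_mapping_eqI) (simp add: lookup_add lookup_restr)

lemma restr_add: "restr Y (u + v) = restr Y u + restr Y v"
  by (rule poly_mapping_eqI) (simp add: lookup_add lookup_restr)

lemma restr_id: "keys u \<subseteq> Y \<Longrightarrow> restr Y u = u"
  by (rule poly_mapping_eqI) (auto simp: lookup_restr in_keys_iff)

lemma restr_zero: "keys u \<inter> Y = {} \<Longrightarrow> restr Y u = 0"
  by (rule poly_mapping_eqI) (auto simp: lookup_restr in_keys_iff)

lemma poly_sum_pslices:
  "f = (\<Sum>b\<in>restr Y ` keys f. single b 1 * pslice Y b f)"
proof (rule poly_mapping_eqI)
  fix u
  have tm: "lookup (single b 1 * pslice Y b f) u = (if b = restr Y u then lookup f u else 0)"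
    if "b \<in> restr Y ` keys f" for b
  proof (cases "\<forall>i. lookup b i \<le> lookup u i")
    case True
    then obtain v where v: "u = b + v" using monomial_dvd_iff by blast
    have bY: "keys b \<subseteq> Y" using that by (auto simp: keys_restr)
    have "keys v \<inter> Y = {} \<longleftrightarrow> b = restr Y u"
    proof
      assume "keys v \<inter> Y = {}"
      then show "b = restr Y u" using bY by (simp add: v restr_add restr_id restr_zero)
    next
      assume "b = restr Y u"
      then have "b = b + restr Y v" using bY by (simp add: v restr_add restr_id)
      then have "restr Y v = 0" by simp
      then show "keys v \<inter> Y = {}" using keys_restr[of Y v] by simp
    qed
    then show ?thesis by (simp add: v lookup_single_mult_add lookup_pslice add.commute)
  next
    case False
    then have "b \<noteq> restr Y u" by (auto simp: lookup_restr split: if_splits)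
    then show ?thesis using False by (simp add: lookup_single_mult_zero del: not_all)
  qed
  have "lookup (\<Sum>b\<in>restr Y ` keys f. single b 1 * pslice Y b f) u
      = (\<Sum>b\<in>restr Y ` keys f. if b = restr Y u then lookup f u else 0)"
    unfolding lookup_sum using tm by (intro sum.cong) auto
  also have "\<dots> = (if restr Y u \<in> restr Y ` keys f then lookup f u else 0)"
    by simp
  also have "\<dots> = lookup f u" by (auto simp: in_keys_iff)
  finally show "lookup f u = lookup (\<Sum>b\<in>restr Y ` keys f. single b 1 * pslice Y b f) u" ..
qed

lemma span_if_pslices:
  assumes "\<And>b. keys b \<subseteq> Y \<Longrightarrow> pslice Y b f \<in> ideal_span S"
  shows "f \<in> ideal_span S"
proof -
  have "(\<Sum>b\<in>restr Y ` keys f. single b 1 * pslice Y b f) \<in> ideal_span S"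
    using assms by (intro ideal_span_sum span_mult_left) (auto simp: keys_restr)
  then show ?thesis using poly_sum_pslices[of f Y] by simp
qed

section \<open>Generic linear forms\<close>

text \<open>The parameter of the form is the variable of index \<open>j\<close> itself, hence the
  later assumption \<open>n \<le> j\<close>. Powers of a single parameter suffice because McCoy's
  argument only uses that the coefficients with respect to \<open>x_j\<close> are the variables of
  \<open>A\<close>.\<close>

definition generic_form :: "nat \<Rightarrow> nat \<Rightarrow> 'k::field polynomial" where
  "generic_form n j = (\<Sum>i<n. single (single j i + var i) 1)"

lemma pslice_power_mult:
  "pslice {j} (single j e) (single (single j l) 1 * g) =
    (if l \<le> e then pslice {j} (single j (e - l)) g else 0)"
proof (rule poly_mapping_eqI)
  fix u
  show "lookup (pslice {j} (single j e) (single (single j l) 1 * g)) u =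
    lookup (if l \<le> e then pslice {j} (single j (e - l)) g else 0) u"
  proof (cases "keys u \<inter> {j} = {}")
    case True
    then have uj: "lookup u j = 0" by (auto simp: in_keys_iff)
    then have c: "(\<forall>i. lookup (single j l) i \<le> lookup (u + single j e) i) \<longleftrightarrow> l \<le> e"
      by (auto simp: lookup_add lookup_single when_def)
    have "u + single j e - single j l = u + single j (e - l)" if "l \<le> e"
      using uj that by (intro poly_mapping_eqI) (auto simp: lookup_add lookup_minus lookup_single when_def)
    then show ?thesis using True by (simp add: lookup_pslice lookup_single_mult c)
  qed (simp add: lookup_pslice)
qed

lemma free_of_indet: "i \<notin> Y \<Longrightarrow> free_of Y (indet i)"
  by (auto simp: free_of_def indet_def monomial_poly_def)

lemma generic_form_eq: "generic_form n j = (\<Sum>i<n. single (single j i) 1 * indet i)"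
  unfolding generic_form_def indet_def monomial_poly_def var_def by (simp add: mult_single)

text \<open>McCoy's argument: the leading coefficient of a zero divisor with respect to \<open>x\<^sub>j\<close>
  would be annihilated by all the coefficients of the form.\<close>

theorem nonzerodiv_generic_form:
  fixes S :: "'k::field polynomial set"
  assumes S: "\<forall>p\<in>S. free_of {j} p" and j: "n \<le> j"
    and soc: "no_socle (indet ` {..<n}) (ideal_span S)"
  shows "nonzerodiv (generic_form n j) (ideal_span S)"
proof -
  let ?A = "ideal_span S" and ?t = "\<lambda>e. single (single j e) (1::'k)"
  let ?s = "\<lambda>e. pslice {j} (single j e)"
  have "g \<in> ?A" if "\<And>u. u \<in> keys g \<Longrightarrow> lookup u j < d" "generic_form n j * g \<in> ?A" for g d
    using that
  proof (induction d arbitrary: g)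
    case 0
    then have "keys g = {}" by blast
    then have "g = 0" by (simp add: poly_mapping_eq_iff fun_eq_iff in_keys_iff set_eq_iff)
    then show ?case by (simp add: ideal_span_zero)
  next
    case (Suc d)
    \<comment> \<open>\<open>top\<close> is the part of \<open>g\<close> of degree exactly
      \<open>d\<close> in \<open>x_j\<close>; for the remainder \<open>g'\<close> the products
      \<open>x_i g'\<close> fall under the outer induction.\<close>
    define top where "top = ?t d * ?s d g"
    define g' where "g' = g - top"
    have deg: "lookup u j < d" if "u \<in> keys g'" for u
    proof (rule ccontr)
      assume n: "\<not> lookup u j < d"
      have lt: "lookup top u = (if lookup u j = d then lookup g u else 0)"
      proof (cases "d \<le> lookup u j")
        case True
        then have le: "\<forall>i. lookup (single j d) i \<le> lookup u i" by (simp add: lookup_single when_def)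
        then obtain v where v: "u = single j d + v" using monomial_dvd_iff by blast
        have "keys v \<inter> {j} = {} \<longleftrightarrow> lookup u j = d" by (auto simp: v lookup_add in_keys_iff)
        moreover have "lookup top u = lookup (?s d g) v" by (simp add: top_def v lookup_single_mult_add)
        moreover have "v + single j d = u" by (simp add: v add.commute)
        ultimately show ?thesis by (simp add: lookup_pslice)
      next
        case False then show ?thesis using n by simp
      qed
      have "lookup g' u \<noteq> 0" using that by (simp add: in_keys_iff)
      then have "lookup g u \<noteq> 0 \<and> lookup u j \<noteq> d"
        using lt by (cases "lookup u j = d") (simp_all add: g'_def lookup_minus)
      then show False using Suc.prems(1)[of u] n by (auto simp: in_keys_iff)
    qed
    have sz: "?s e g = 0" if "d < e" for e
    proof (rule poly_mapping_eqI)
      fix u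
      have "lookup (u + single j e) j \<ge> Suc d" using that by (simp add: lookup_add)
      then have "u + single j e \<notin> keys g" using Suc.prems(1)[of "u + single j e"] by fastforce
      then show "lookup (?s e g) u = lookup 0 u" by (simp add: lookup_pslice in_keys_iff)
    qed
    \<comment> \<open>Downwards in \<open>i\<close>: once the products \<open>x_l g\<close> with
      \<open>l > i\<close> are known to lie in the ideal, the coefficient of
      \<open>x_j^(d+i)\<close> in the remaining part of the product is \<open>x_i\<close> times the
      coefficient of \<open>x_j^d\<close> in \<open>g\<close>, as higher powers of
      \<open>x_j\<close> do not occur in \<open>g\<close>. So \<open>x_i top\<close> lies in the
      ideal, and \<open>x_i g'\<close> follows from the outer induction.\<close>
    have main: "indet i * g \<in> ?A" if "i < n" for i
      using that
    proof (induction "n - i" arbitrary: i rule: less_induct)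
      case (less i)
      have hi: "indet l * g \<in> ?A" if "i < l" "l < n" for l
        using less.hyps[of l] that less.prems by simp
      have split: "{..<n} = {..<Suc i} \<union> {Suc i..<n}" using less.prems by auto
      have "generic_form n j * g = (\<Sum>l<n. ?t l * (indet l * g))"
        by (simp add: generic_form_eq sum_distrib_right mult.assoc)
      also have "\<dots> = (\<Sum>l<Suc i. ?t l * (indet l * g)) + (\<Sum>l\<in>{Suc i..<n}. ?t l * (indet l * g))"
        unfolding split by (rule sum.union_disjoint) auto
      finally have "(\<Sum>l<Suc i. ?t l * (indet l * g)) = generic_form n j * g - (\<Sum>l\<in>{Suc i..<n}. ?t l * (indet l * g))"
        by simp
      also have "\<dots> \<in> ?A"
        by (rule ideal_span_diff[OF Suc.prems(2)], rule ideal_span_sum, rule span_mult_left, rule hi) auto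
      finally have "?s (d + i) (\<Sum>l<Suc i. ?t l * (indet l * g)) \<in> ?A"
        using pslice_span[OF _ S] by simp
      also have "?s (d + i) (\<Sum>l<Suc i. ?t l * (indet l * g)) = (\<Sum>l<Suc i. indet l * ?s (d + i - l) g)"
        unfolding pslice_sum
      proof (intro sum.cong refl)
        fix l assume l: "l \<in> {..<Suc i}"
        then have "l \<noteq> j" using less.prems j by auto
        then have "?s e (indet l * g) = indet l * ?s e g" for e
          by (intro pslice_mult free_of_indet) auto
        then show "?s (d + i) (?t l * (indet l * g)) = indet l * ?s (d + i - l) g"
          using l by (simp add: pslice_power_mult)
      qed
      also have "\<dots> = indet i * ?s d g" using sz by simp
      finally have "indet i * ?s d g \<in> ?A" .
      then have "?t d * (indet i * ?s d g) \<in> ?A" by (rule span_mult_left)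
      then have top: "indet i * top \<in> ?A" by (simp add: top_def mult.left_commute)
      have "generic_form n j * (indet i * g') = indet i * (generic_form n j * g) - generic_form n j * (indet i * top)"
        by (simp add: g'_def algebra_simps)
      then have 1: "generic_form n j * (indet i * g') \<in> ?A"
        using ideal_span_diff[OF span_mult_left[OF Suc.prems(2)] span_mult_left[OF top]] by simp
      have 2: "lookup u j < d" if "u \<in> keys (indet i * g')" for u
      proof -
        have "i \<noteq> j" using less.prems j by auto
        then show ?thesis using that deg
          by (auto simp: indet_def monomial_poly_def keys_single_mult lookup_add lookup_single when_def)
      qed
      have "indet i * g' \<in> ?A" by (rule Suc.IH[OF 2 1])
      then have "indet i * g' + indet i * top \<in> ?A" using top by (rule ideal_span_add)
      then show ?case by (simp add: g'_def algebra_simps)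
    qed
    then show ?case using soc by (auto simp: no_socle_def)
  qed
  moreover have "\<exists>d. \<forall>u\<in>keys g. lookup u j < d" for g :: "'k polynomial"
  proof (intro exI ballI)
    fix u assume "u \<in> keys g"
    then show "lookup u j < Suc (Max ((\<lambda>u. lookup u j) ` keys g))"
      by (auto simp: less_Suc_eq_le)
  qed
  ultimately show ?thesis unfolding nonzerodiv_def by blast
qed

lemma generic_form_in_span: "generic_form n j \<in> ideal_span (indet ` {..<n})"
  unfolding generic_form_eq by (intro ideal_span_sum span_mult_left ideal_span_base) auto

lemma free_of_generic_form:
  assumes "j \<notin> Y" "Y \<inter> {..<n} = {}"
  shows "free_of Y (generic_form n j :: 'k::field polynomial)"
  unfolding free_of_def
proof
  fix u assume "u \<in> keys (generic_form n j :: 'k polynomial)"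
  then have "u \<in> (\<Union>i\<in>{..<n}. keys (single (single j i + var i) (1::'k)))"
    unfolding generic_form_def using keys_sum[of "\<lambda>i. single (single j i + var i) (1::'k)" "{..<n}"] by blast
  then obtain i where "i < n" "u = single j i + var i" by auto
  then show "keys u \<inter> Y = {}" using assms by (auto simp: keys_add_nat split: if_splits)
qed

text \<open>\<open>nonzerodiv_swap\<close> carries \<open>a\<close> past the entries of
  \<open>p\<close> one at a time.\<close>

lemma regular_list_swap:
  assumes "nonzerodiv a (ideal_span S)" "regular_list (insert a S) p" "regular_list S p"
  shows "nonzerodiv a (ideal_span (set p \<union> S))"
  using assms
proof (induction p arbitrary: S)
  case (Cons b p)
  have "nonzerodiv a (ideal_span (insert b S))"
    by (rule nonzerodiv_swap) (use Cons.prems in auto)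
  moreover have "regular_list (insert a (insert b S)) p"
    using Cons.prems(2) by (simp add: insert_commute)
  ultimately have "nonzerodiv a (ideal_span (set p \<union> insert b S))"
    by (rule Cons.IH) (use Cons.prems(3) in simp)
  then show ?case by simp
qed simp

text \<open>The first form \<open>f\<close> of the given sequence stays regular modulo all but one of the generic forms
  (by induction and swapping), so the socle modulo these vanishes and the last generic form is regular by
  McCoy's argument.\<close>

theorem regular_list_generic_forms:
  fixes S :: "'k::field polynomial set"
  assumes "regular_list S fs" "length js = length fs" "distinct js"
    and "\<And>j p. j \<in> set js \<Longrightarrow> p \<in> S \<union> set fs \<Longrightarrow> free_of {j} p"
    and "\<And>j. j \<in> set js \<Longrightarrow> n \<le> j"
    and "set fs \<subseteq> ideal_span (indet ` {..<n})"
  shows "regular_list S (map (generic_form n) js)"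
  using assms
proof (induction "length fs" arbitrary: S fs js)
  case (Suc l)
  obtain f fs' where fs: "fs = f # fs'" using Suc.hyps(2) by (metis length_Suc_conv)
  have "js \<noteq> []" using Suc by auto
  then obtain js' j where js: "js = js' @ [j]" by (metis rev_exhaust)
  let ?p = "map (generic_form n :: nat \<Rightarrow> 'k polynomial) js'"
  have l: "l = length fs'" "length js' = length fs'" using Suc.hyps Suc.prems(2) fs js by auto
  have 1: "regular_list (insert f S) ?p"
    by (rule Suc.hyps(1)[of fs']) (use Suc.prems fs js l in auto)
  have 2: "regular_list S ?p"
  proof (rule Suc.hyps(1)[of "butlast fs"])
    have fs2: "fs = butlast fs @ [last fs]" using fs by simp
    show "regular_list S (butlast fs)"
      using Suc.prems(1) regular_list_append[of S "butlast fs" "[last fs]"] fs2 by simp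
    have sub: "set (butlast fs) \<subseteq> set fs" by (meson in_set_butlastD subsetI)
    show "\<And>i p. i \<in> set js' \<Longrightarrow> p \<in> S \<union> set (butlast fs) \<Longrightarrow> free_of {i} p"
      using Suc.prems(4) sub js by auto
    show "set (butlast fs) \<subseteq> ideal_span (indet ` {..<n})" using sub Suc.prems(6) by blast
  qed (use Suc.prems fs js l in auto)
  have "nonzerodiv f (ideal_span (set ?p \<union> S))"
    by (rule regular_list_swap[OF _ 1 2]) (use Suc.prems(1) fs in auto)
  then have "no_socle (indet ` {..<n}) (ideal_span (set ?p \<union> S))"
    by (rule nonzerodiv_no_socle[rotated]) (use Suc.prems(6) fs in auto)
  moreover have "free_of {j} p" if p: "p \<in> set ?p \<union> S" for p
  proof (cases "p \<in> S")
    case True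
    then show ?thesis using Suc.prems(4) js by auto
  next
    case False
    then obtain i where "i \<in> set js'" "p = generic_form n i" using p by auto
    then have "i \<notin> {j}" "{j} \<inter> {..<n} = {}" using Suc.prems(3) Suc.prems(5)[of j] js by auto
    then show ?thesis unfolding \<open>p = generic_form n i\<close> by (rule free_of_generic_form)
  qed
  ultimately have "nonzerodiv (generic_form n j) (ideal_span (set ?p \<union> S))"
    using Suc.prems(5) js by (intro nonzerodiv_generic_form) auto
  then show ?case using 2 js by (simp add: regular_list_append)
qed auto

text \<open>The form after \<open>generic_form n i\<close> in the list is regular modulo it, so the
  socle modulo \<open>generic_form n i\<close> vanishes. By the exchange of socles it vanishes
  modulo \<open>y\<close>, and McCoy's argument makes \<open>generic_form n i\<close> regular modulo
  \<open>y\<close>. A swap keeps \<open>y\<close> regular for the next step. The last form is the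
  one that is used up.\<close>

theorem regular_list_generic_forms_insert:
  fixes S :: "'k::field polynomial set"
  assumes "regular_list S (map (generic_form n) (js @ [j]))" "distinct (js @ [j])"
    and "\<And>i p. i \<in> set (js @ [j]) \<Longrightarrow> p \<in> insert y S \<Longrightarrow> free_of {i} p"
    and "\<And>i. i \<in> set (js @ [j]) \<Longrightarrow> n \<le> i"
    and "nonzerodiv y (ideal_span S)" "y \<in> ideal_span (indet ` {..<n})"
  shows "regular_list (insert y S) (map (generic_form n) js)"
  using assms
proof (induction js arbitrary: S)
  case (Cons i js)
  let ?X = "indet ` {..<n} :: 'k polynomial set"
  have r: "nonzerodiv (generic_form n i) (ideal_span S)"
    and rs: "regular_list (insert (generic_form n i) S) (map (generic_form n) (js @ [j]))"
    using Cons.prems(1) by auto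
  obtain h where "nonzerodiv (generic_form n h) (ideal_span (insert (generic_form n i) S))"
    using rs by (cases js) auto
  then have "no_socle ?X (ideal_span (insert (generic_form n i) S))"
    by (rule nonzerodiv_no_socle[OF generic_form_in_span])
  then have "no_socle ?X (ideal_span (insert y S))"
    by (rule no_socle_exchange[OF Cons.prems(6,5) generic_form_in_span r])
  then have yi: "nonzerodiv (generic_form n i) (ideal_span (insert y S))"
    using Cons.prems(3,4) by (intro nonzerodiv_generic_form) auto
  have "nonzerodiv y (ideal_span (insert (generic_form n i) S))"
    by (rule nonzerodiv_swap[OF Cons.prems(5) yi])
  moreover have "free_of {h} p" if h: "h \<in> set (js @ [j])" and p: "p \<in> insert y (insert (generic_form n i) S)" for h p
  proof (cases "p = generic_form n i")
    case True
    have "i \<notin> {h}" using h Cons.prems(2) by auto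
    moreover have "{h} \<inter> {..<n} = {}" using h Cons.prems(4)[of h] by auto
    ultimately show ?thesis unfolding True by (rule free_of_generic_form)
  next
    case False
    then show ?thesis using p h Cons.prems(3)[of h p] by auto
  qed
  ultimately have "regular_list (insert y (insert (generic_form n i) S)) (map (generic_form n) js)"
    using Cons.prems rs by (intro Cons.IH) auto
  then show ?case using yi by (simp add: insert_commute)
qed simp

text \<open>The source of upper bounds for the depth: \<open>ys\<close> cannot leave a nonzero socle
  if some regular list is longer by one. The longer list yields as many generic forms, each entry of
  \<open>ys\<close> uses up one of them, and the surviving form rules out a socle.\<close>

corollary no_socle_if_longer_regular_list:
  fixes S :: "'k::field polynomial set"
  assumes "regular_list S fs" "length fs = Suc (length ys)"
    and fr: "\<And>p j. p \<in> S \<union> set fs \<union> set ys \<Longrightarrow> n \<le> j \<Longrightarrow> free_of {j} p"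
    and fX: "set fs \<subseteq> ideal_span (indet ` {..<n})"
    and ys: "regular_list S ys" "set ys \<subseteq> ideal_span (indet ` {..<n})"
  shows "no_socle (indet ` {..<n}) (ideal_span (set ys \<union> S))"
proof -
  have xs: "regular_list S (map (generic_form n) [n..<n + Suc (length ys)])"
    by (rule regular_list_generic_forms[OF assms(1)]) (use assms in auto)
  have "regular_list (set ys \<union> S) (map (generic_form n) [n..<Suc n])"
    using ys fr xs
  proof (induction ys arbitrary: S)
    case (Cons y ys)
    have "regular_list (insert y S) (map (generic_form n) [n..<n + Suc (length ys)])"
      by (rule regular_list_generic_forms_insert[where j = "n + Suc (length ys)"]) (use Cons.prems in auto)
    then have "regular_list (set ys \<union> insert y S) (map (generic_form n) [n..<Suc n])"
      using Cons.prems by (intro Cons.IH) auto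
    then show ?case by simp
  qed simp
  then have "nonzerodiv (generic_form n n) (ideal_span (set ys \<union> S))" by simp
  then show ?thesis by (rule nonzerodiv_no_socle[OF generic_form_in_span])
qed

section \<open>Leading monomials\<close>

definition scale :: "'k::field \<Rightarrow> 'k polynomial \<Rightarrow> 'k polynomial" where
  "scale c f = const_poly c * f"

lemma lookup_const_mult: "lookup (const_poly c * f) u = c * lookup f u"
  using lookup_single_mult_add[of 0 c f u] by (simp add: const_poly_def)

lemma lookup_scale [simp]: "lookup (scale c f) u = c * lookup f u"
  by (simp add: scale_def lookup_const_mult)

lemma keys_scale: "keys (scale c f) \<subseteq> keys f"
  by (auto simp: in_keys_iff)

lemma vector_space_scale: "Vector_Spaces.vector_space (scale :: 'k::field \<Rightarrow> 'k polynomial \<Rightarrow> 'k polynomial)"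
  by standard (auto intro!: poly_mapping_eqI simp: lookup_add algebra_simps)

lemma module_scale: "Modules.module (scale :: 'k::field \<Rightarrow> 'k polynomial \<Rightarrow> 'k polynomial)"
  using vector_space_scale by (simp add: Vector_Spaces.vector_space_def Modules.module_def)

abbreviation "vspan \<equiv> Modules.module.span scale"
abbreviation "vindependent B \<equiv> \<not> Modules.module.dependent scale B"
abbreviation "vdim \<equiv> Vector_Spaces.vector_space.dim scale"

lemmas vspan_zero = Modules.module.span_zero[OF module_scale]
lemmas vspan_base = Modules.module.span_base[OF module_scale]
lemmas vspan_add = Modules.module.span_add[OF module_scale]
lemmas vspan_scale = Modules.module.span_scale[OF module_scale]
lemmas vspan_insert = Modules.module.span_insert[OF module_scale]
lemmas vspan_induct =
  Modules.module.span_induct_alt[OF module_scale, consumes 1, case_names base step]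
lemmas vindependent_insert = Vector_Spaces.vector_space.independent_insertI[OF vector_space_scale]
lemmas vindependent_empty = Modules.module.independent_empty[OF module_scale]
lemmas vdim_unique = Vector_Spaces.vector_space.dim_unique[OF vector_space_scale]

text \<open>The leading monomial for the lexicographic order, without regard to degree. Its value at
  0 is unspecified, so \<open>leads\<close> leaves 0 out.\<close>

definition lead :: "'k::zero polynomial \<Rightarrow> monomial" where
  "lead f = Max (keys f)"

definition leads :: "'k::zero polynomial set \<Rightarrow> monomial set" where
  "leads V = lead ` (V - {0})"

lemma lead_in_keys: "f \<noteq> 0 \<Longrightarrow> lead f \<in> keys f" for f :: "'k::ab_group_add polynomial"
  unfolding lead_def by (intro Max_in) (auto simp: poly_mapping_eq_iff fun_eq_iff in_keys_iff set_eq_iff)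

lemma le_lead: "u \<in> keys f \<Longrightarrow> u \<le> lead f"
  unfolding lead_def by simp

lemma leadI: "u \<in> keys f \<Longrightarrow> (\<And>v. v \<in> keys f \<Longrightarrow> v \<le> u) \<Longrightarrow> lead f = u"
  unfolding lead_def by (intro Max_eqI) auto

definition linear_set :: "'k::field polynomial set \<Rightarrow> bool" where
  "linear_set W \<longleftrightarrow> 0 \<in> W \<and> (\<forall>f\<in>W. \<forall>g\<in>W. f + g \<in> W) \<and> (\<forall>c. \<forall>f\<in>W. scale c f \<in> W)"

lemma vspan_linear_set:
  assumes "linear_set W" "B \<subseteq> W" shows "vspan B \<subseteq> W"
proof
  fix f assume "f \<in> vspan B"
  then show "f \<in> W"
    by (induction rule: vspan_induct) (use assms in \<open>auto simp: linear_set_def\<close>)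
qed

lemma linear_set_diff: "linear_set W \<Longrightarrow> f \<in> W \<Longrightarrow> g \<in> W \<Longrightarrow> f - g \<in> W"
proof -
  assume a: "linear_set W" "f \<in> W" "g \<in> W"
  then have "f + scale (-1) g \<in> W" by (auto simp: linear_set_def)
  also have "f + scale (-1) g = f - g" by (rule poly_mapping_eqI) (simp add: lookup_add lookup_minus)
  finally show ?thesis .
qed

text \<open>Division restricted to a finite set \<open>T\<close> of leading monomials: cancelling
  the largest key of \<open>f\<close> in \<open>T\<close> only creates smaller keys there. The
  measure counts the elements of \<open>T\<close> that are at or below some key of \<open>f\<close>
  in \<open>T\<close>.\<close>

lemma reduce_modulo:
  fixes F :: "monomial \<Rightarrow> 'k::field polynomial"
  assumes "finite T" "\<And>u. u \<in> T \<Longrightarrow> F u \<noteq> 0 \<and> lead (F u) = u"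
  shows "\<exists>g\<in>vspan (F ` T). keys (f - g) \<inter> T = {}"
proof (induction "card {v \<in> T. \<exists>u\<in>keys f \<inter> T. v \<le> u}" arbitrary: f rule: less_induct)
  case (less f)
  show ?case
  proof (cases "keys f \<inter> T = {}")
    case True
    then show ?thesis by (intro bexI[of _ 0]) (auto simp: vspan_zero)
  next
    case False
    define u where "u = Max (keys f \<inter> T)"
    have u: "u \<in> keys f \<inter> T" unfolding u_def using False by (intro Max_in) auto
    have umax: "v \<le> u" if "v \<in> keys f \<inter> T" for v unfolding u_def using that by (intro Max_ge) auto
    have Fu: "F u \<noteq> 0" "lead (F u) = u" using assms(2) u by auto
    then have uF: "lookup (F u) u \<noteq> 0" using lead_in_keys[of "F u"] by (simp add: in_keys_iff)
    define c where "c = lookup f u / lookup (F u) u"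
    define f' where "f' = f - scale c (F u)"
    have f'u: "v < u" if "v \<in> keys f' \<inter> T" for v
    proof -
      have "lookup f' u = 0" using uF by (simp add: f'_def lookup_minus c_def)
      then have "v \<noteq> u" using that by (auto simp: in_keys_iff)
      moreover have "v \<le> u"
      proof (cases "v \<in> keys (F u)")
        case True
        then show ?thesis using le_lead Fu(2) by metis
      next
        case False
        then have "v \<in> keys f" using that by (auto simp: in_keys_iff f'_def lookup_minus)
        then show ?thesis using umax that by auto
      qed
      ultimately show ?thesis by simp
    qed
    have "{v \<in> T. \<exists>u\<in>keys f' \<inter> T. v \<le> u} \<subset> {v \<in> T. \<exists>u\<in>keys f \<inter> T. v \<le> u}"
    proof
      show "{v \<in> T. \<exists>u\<in>keys f' \<inter> T. v \<le> u} \<subseteq> {v \<in> T. \<exists>u\<in>keys f \<inter> T. v \<le> u}"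
        using f'u u by (fastforce intro: bexI[of _ u])
      have "u \<notin> {v \<in> T. \<exists>u\<in>keys f' \<inter> T. v \<le> u}" using f'u by (auto simp: not_le)
      moreover have "u \<in> {v \<in> T. \<exists>u\<in>keys f \<inter> T. v \<le> u}" using u by auto
      ultimately show "{v \<in> T. \<exists>u\<in>keys f' \<inter> T. v \<le> u} \<noteq> {v \<in> T. \<exists>u\<in>keys f \<inter> T. v \<le> u}" by blast
    qed
    then have "card {v \<in> T. \<exists>u\<in>keys f' \<inter> T. v \<le> u} < card {v \<in> T. \<exists>u\<in>keys f \<inter> T. v \<le> u}"
      using assms(1) by (intro psubset_card_mono) auto
    then obtain g where g: "g \<in> vspan (F ` T)" "keys (f' - g) \<inter> T = {}" using less.hyps by blast
    have "g + scale c (F u) \<in> vspan (F ` T)" using g(1) u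
      by (blast intro: vspan_add vspan_scale vspan_base)
    moreover have "f - (g + scale c (F u)) = f' - g" by (simp add: f'_def algebra_simps)
    ultimately show ?thesis using g(2) by metis
  qed
qed

lemma independent_distinct_leads:
  fixes F :: "monomial \<Rightarrow> 'k::field polynomial"
  assumes "finite T" "\<And>u. u \<in> T \<Longrightarrow> F u \<noteq> 0 \<and> lead (F u) = u"
  shows "vindependent (F ` T)"
  using assms
proof (induction T rule: finite_linorder_max_induct)
  case (insert b A)
  have "v < b" if "g \<in> vspan (F ` A)" "v \<in> keys g" for g v
    using that
  proof (induction arbitrary: v rule: vspan_induct)
    case (step c x y)
    then consider "v \<in> keys (scale c x)" | "v \<in> keys y"
      using Poly_Mapping.keys_add[of "scale c x" y] by auto
    then show ?case
    proof cases
      case 1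
      then have "v \<in> keys x" using keys_scale by blast
      obtain a where a: "a \<in> A" "x = F a" using step by auto
      then have "lead x = a" using insert.prems by auto
      then have "v \<le> a" using le_lead[OF \<open>v \<in> keys x\<close>] by simp
      then show ?thesis using insert.hyps a by auto
    qed (rule step)
  qed simp
  moreover have "b \<in> keys (F b)" using insert.prems[of b] lead_in_keys[of "F b"] by auto
  ultimately have "F b \<notin> vspan (F ` A)" by blast
  then show ?case using insert by (simp add: vindependent_insert)
qed (simp add: vindependent_empty)

text \<open>One element of \<open>W\<close> for each leading monomial gives a basis: distinct
  leading monomials make them independent, and a remainder of the division has no leading monomial
  left, so it is 0.\<close>

lemma vdim_leads:
  fixes W :: "'k::field polynomial set"
  assumes W: "linear_set W" and fin: "finite (leads W)"
  shows "vdim W = card (leads W)"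
proof -
  have "\<forall>u\<in>leads W. \<exists>f. f \<in> W \<and> f \<noteq> 0 \<and> lead f = u" by (auto simp: leads_def)
  then obtain F where F: "\<And>u. u \<in> leads W \<Longrightarrow> F u \<in> W \<and> F u \<noteq> 0 \<and> lead (F u) = u"
    by metis
  then have F': "F u \<noteq> 0 \<and> lead (F u) = u" if "u \<in> leads W" for u using that by blast
  show ?thesis
  proof (rule vdim_unique[of "F ` leads W"])
    show FW: "F ` leads W \<subseteq> W" using F by auto
    show "W \<subseteq> vspan (F ` leads W)"
    proof
      fix w assume w: "w \<in> W"
      obtain g where g: "g \<in> vspan (F ` leads W)" "keys (w - g) \<inter> leads W = {}"
        using reduce_modulo[OF fin F'] by blast
      have gW: "w - g \<in> W" using linear_set_diff[OF W w] vspan_linear_set[OF W FW] g(1) by blast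
      have "w - g = 0"
      proof (rule ccontr)
        assume "w - g \<noteq> 0"
        then have "lead (w - g) \<in> leads W" using gW by (auto simp: leads_def)
        then show False using g(2) lead_in_keys[OF \<open>w - g \<noteq> 0\<close>] by blast
      qed
      then show "w \<in> vspan (F ` leads W)" using g(1) by simp
    qed
    show "vindependent (F ` leads W)" by (rule independent_distinct_leads[OF fin F'])
    have "inj_on F (leads W)" using F by (metis inj_onI)
    then show "card (F ` leads W) = card (leads W)" by (rule card_image)
  qed
qed

section \<open>Graded ideals and standard monomials\<close>

definition hcomp :: "nat \<Rightarrow> 'k::field polynomial \<Rightarrow> 'k polynomial" where
  "hcomp q f = Abs_poly_mapping (\<lambda>u. if mdeg u = q then lookup f u else 0)"

lemma lookup_hcomp: "lookup (hcomp q f) u = (if mdeg u = q then lookup f u else 0)"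
proof -
  have "finite {u. (if mdeg u = q then lookup f u else 0) \<noteq> 0}"
    by (rule finite_subset[OF _ finite_keys[of f]]) (auto simp: in_keys_iff split: if_splits)
  then show ?thesis by (simp add: hcomp_def)
qed

lemma keys_hcomp: "keys (hcomp q f) = {u \<in> keys f. mdeg u = q}"
  by (auto simp: in_keys_iff lookup_hcomp split: if_splits)

lemma hcomp_add: "hcomp q (f + g) = hcomp q f + hcomp q g"
  by (rule poly_mapping_eqI) (simp add: lookup_hcomp lookup_add)

lemma hcomp_zero [simp]: "hcomp q 0 = 0"
  by (rule poly_mapping_eqI) (simp add: lookup_hcomp)

lemma hcomp_sum: "hcomp q (sum f A) = (\<Sum>a\<in>A. hcomp q (f a))"
  by (induction A rule: infinite_finite_induct) (auto simp: hcomp_add)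

lemma homogeneous_zero [simp]: "homogeneous q 0"
  by (simp add: homogeneous_def)

lemma homogeneous_hcomp: "homogeneous q (hcomp q f)"
  by (simp add: homogeneous_def keys_hcomp)

lemma hcomp_id: "homogeneous q f \<Longrightarrow> hcomp q f = f"
  by (rule poly_mapping_eqI) (auto simp: lookup_hcomp homogeneous_def in_keys_iff)

lemma hcomp_other: "homogeneous p f \<Longrightarrow> p \<noteq> q \<Longrightarrow> hcomp q f = 0"
  by (rule poly_mapping_eqI) (metis homogeneous_def in_keys_iff lookup_hcomp lookup_zero)

lemma homogeneous_mult:
  assumes "homogeneous p f" "homogeneous q g" shows "homogeneous (p + q) (f * g)"
  unfolding homogeneous_def
proof
  fix u assume "u \<in> keys (f * g)"
  then obtain a b where "u = a + b" "a \<in> keys f" "b \<in> keys g" using keys_mult by blast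
  then show "mdeg u = p + q" using assms by (simp add: homogeneous_def)
qed

lemma homogeneous_add: "homogeneous q f \<Longrightarrow> homogeneous q g \<Longrightarrow> homogeneous q (f + g)"
  using Poly_Mapping.keys_add[of f g] by (auto simp: homogeneous_def)

lemma homogeneous_scale: "homogeneous q f \<Longrightarrow> homogeneous q (scale c f)"
  using keys_scale[of c f] by (auto simp: homogeneous_def)

lemma scale_minus_one: "scale (-1) f = - f"
  by (rule poly_mapping_eqI) simp

lemma homogeneous_diff: "homogeneous q f \<Longrightarrow> homogeneous q g \<Longrightarrow> homogeneous q (f - g)"
  using homogeneous_add[of q f "scale (-1) g"] homogeneous_scale[of q g "-1"]
  by (simp add: scale_minus_one)

lemma poly_sum_hcomp: "f = (\<Sum>q\<in>mdeg ` keys f. hcomp q f)"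
proof (rule poly_mapping_eqI)
  fix u
  have "lookup (\<Sum>q\<in>mdeg ` keys f. hcomp q f) u = (\<Sum>q\<in>mdeg ` keys f. if q = mdeg u then lookup f u else 0)"
    unfolding lookup_sum by (intro sum.cong refl) (auto simp: lookup_hcomp)
  also have "\<dots> = lookup f u" by (auto simp: in_keys_iff)
  finally show "lookup f u = lookup (\<Sum>q\<in>mdeg ` keys f. hcomp q f) u" ..
qed

lemma hcomp_homogeneous_mult:
  assumes "homogeneous p f"
  shows "hcomp (p + q) (f * g) = f * hcomp q g"
proof -
  have hc: "hcomp (p + q) (f * hcomp r g) = (if r = q then f * hcomp q g else 0)" for r
  proof (cases "r = q")
    case False
    have "homogeneous (p + r) (f * hcomp r g)" by (rule homogeneous_mult[OF assms homogeneous_hcomp])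
    then have "hcomp (p + q) (f * hcomp r g) = 0"
      by (rule hcomp_other) (use False in simp)
    then show ?thesis using False by simp
  qed (simp add: hcomp_id homogeneous_mult[OF assms homogeneous_hcomp])
  have "f * g = (\<Sum>r\<in>mdeg ` keys g. f * hcomp r g)"
    by (subst poly_sum_hcomp[of g]) (simp add: sum_distrib_left)
  also have "hcomp (p + q) \<dots> = (\<Sum>r\<in>mdeg ` keys g. hcomp (p + q) (f * hcomp r g))"
    by (rule hcomp_sum)
  also have "\<dots> = (if q \<in> mdeg ` keys g then f * hcomp q g else 0)" by (simp add: hc)
  also have "\<dots> = f * hcomp q g"
  proof (cases "q \<in> mdeg ` keys g")
    case False
    then have "hcomp q g = 0" by (intro poly_mapping_eqI) (auto simp: lookup_hcomp in_keys_iff)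
    then show ?thesis by simp
  qed simp
  finally show ?thesis .
qed

definition graded_ideal :: "nat \<Rightarrow> 'k::field polynomial set \<Rightarrow> bool" where
  "graded_ideal n V \<longleftrightarrow> V \<subseteq> polys n \<and> 0 \<in> V \<and> (\<forall>f\<in>V. \<forall>g\<in>V. f + g \<in> V) \<and>
    (\<forall>f\<in>polys n. \<forall>g\<in>V. f * g \<in> V) \<and> (\<forall>f\<in>V. \<forall>q. hcomp q f \<in> V)"

definition std_monomials :: "nat \<Rightarrow> 'k::field polynomial set \<Rightarrow> nat \<Rightarrow> monomial set" where
  "std_monomials n V q = mons {..<n} q - leads V"

definition degree_part :: "'k::field polynomial set \<Rightarrow> nat \<Rightarrow> 'k polynomial set" where
  "degree_part V q = {f \<in> V. homogeneous q f}"

lemma const_polys: "const_poly c \<in> polys n"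
  by (cases "c = 0") (auto simp: polys_def const_poly_def monomials_def)

lemma graded_ideal_linear: "graded_ideal n V \<Longrightarrow> linear_set V"
  unfolding graded_ideal_def linear_set_def scale_def by (simp add: const_polys)

lemma degree_part_linear: "graded_ideal n V \<Longrightarrow> linear_set (degree_part V q)"
  using graded_ideal_linear[of n V]
  by (auto simp: degree_part_def linear_set_def intro: homogeneous_add homogeneous_scale)

lemma leads_degree_part:
  assumes "graded_ideal n V"
  shows "leads (degree_part V q) = leads V \<inter> mons {..<n} q"
proof (intro equalityI subsetI)
  fix u assume "u \<in> leads (degree_part V q)"
  then obtain f where f: "f \<in> V" "homogeneous q f" "f \<noteq> 0" "u = lead f" by (auto simp: leads_def degree_part_def)
  then have "u \<in> keys f" using lead_in_keys by blast
  moreover have "keys f \<subseteq> monomials n" using f assms by (auto simp: graded_ideal_def polys_def)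
  ultimately show "u \<in> leads V \<inter> mons {..<n} q" using f by (auto simp: leads_def in_mons_iff homogeneous_def)
next
  fix u assume u: "u \<in> leads V \<inter> mons {..<n} q"
  then obtain f where f: "f \<in> V" "f \<noteq> 0" "u = lead f" by (auto simp: leads_def)
  have uk: "u \<in> keys (hcomp q f)" using f u lead_in_keys[of f] by (simp add: keys_hcomp in_mons_iff)
  moreover have "lead (hcomp q f) = u"
    using uk f le_lead by (intro leadI) (auto simp: keys_hcomp)
  moreover have "hcomp q f \<in> degree_part V q" using assms f homogeneous_hcomp by (auto simp: degree_part_def graded_ideal_def)
  ultimately show "u \<in> leads (degree_part V q)" by (force simp: leads_def)
qed

lemma std_reduce:
  assumes V: "graded_ideal n V" and f: "f \<in> polys n" "homogeneous q f"
  shows "\<exists>g. keys g \<subseteq> std_monomials n V q \<and> f - g \<in> degree_part V q"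
proof -
  let ?T = "leads (degree_part V q)"
  have fin: "finite ?T" using leads_degree_part[OF V] by simp
  have "\<forall>u\<in>?T. \<exists>f. f \<in> degree_part V q \<and> f \<noteq> 0 \<and> lead f = u" by (auto simp: leads_def)
  then obtain F where F: "\<And>u. u \<in> ?T \<Longrightarrow> F u \<in> degree_part V q \<and> F u \<noteq> 0 \<and> lead (F u) = u"
    by metis
  then have F': "F u \<noteq> 0 \<and> lead (F u) = u" if "u \<in> ?T" for u using that by blast
  obtain h where h: "h \<in> vspan (F ` ?T)" "keys (f - h) \<inter> ?T = {}"
    using reduce_modulo[OF fin F'] by blast
  have hV: "h \<in> degree_part V q"
    using vspan_linear_set[OF degree_part_linear[OF V]] F h(1) by blast
  then have hh: "h \<in> polys n" "homogeneous q h" using V by (auto simp: degree_part_def graded_ideal_def)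
  have "f - h \<in> polys n" using f(1) hh(1) polys_closed(3,4)[of _ n] by (metis diff_conv_add_uminus)
  then have "keys (f - h) \<subseteq> mons {..<n} q"
    using homogeneous_diff[OF f(2) hh(2)] by (auto simp: polys_def in_mons_iff homogeneous_def)
  then have "keys (f - h) \<subseteq> std_monomials n V q" using h(2) leads_degree_part[OF V, of q] by (auto simp: std_monomials_def)
  then show ?thesis using hV by (intro exI[of _ "f - h"]) simp
qed

lemma std_zero:
  assumes "g \<in> V" "keys g \<subseteq> std_monomials n V q"
  shows "g = 0"
proof (rule ccontr)
  assume "g \<noteq> 0"
  then have "lead g \<in> leads V" "lead g \<in> keys g" using assms(1) lead_in_keys by (auto simp: leads_def)
  then show False using assms(2) by (auto simp: std_monomials_def)
qed

section \<open>Adding a linear form to a graded ideal\<close>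

definition add_form :: "nat \<Rightarrow> 'k::field polynomial \<Rightarrow> 'k polynomial set \<Rightarrow> 'k polynomial set" where
  "add_form n l V = {f + l * g | f g. f \<in> V \<and> g \<in> polys n}"

lemma hcomp_polys: "f \<in> polys n \<Longrightarrow> hcomp q f \<in> polys n"
  by (auto simp: polys_def keys_hcomp)

lemma hcomp_linear_mult: "homogeneous 1 l \<Longrightarrow> hcomp q (l * g) = (if q = 0 then 0 else l * hcomp (q - 1) g)"
proof (cases q)
  case 0
  assume l: "homogeneous 1 l"
  have "mdeg u \<noteq> 0" if "u \<in> keys (l * g)" for u
    using that keys_mult[of l g] l by (force simp: homogeneous_def)
  then have "hcomp 0 (l * g) = 0"
    by (intro poly_mapping_eqI) (metis in_keys_iff lookup_hcomp lookup_zero)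
  then show ?thesis using 0 by simp
next
  case (Suc p)
  assume l: "homogeneous 1 l"
  show ?thesis using hcomp_homogeneous_mult[OF l, of p g] Suc by simp
qed

lemma add_form_graded:
  fixes V :: "'k::field polynomial set"
  assumes V: "graded_ideal n V" and l: "l \<in> polys n" "homogeneous 1 l"
  shows "graded_ideal n (add_form n l V)"
  unfolding graded_ideal_def
proof (intro conjI ballI allI)
  have P: "\<And>f g. f \<in> polys n \<Longrightarrow> g \<in> polys n \<Longrightarrow> f + g \<in> polys n \<and> f * g \<in> polys n" "0 \<in> polys n"
    using polys_closed(1,4,5) by blast+
  show "add_form n l V \<subseteq> polys n"
    using V l(1) unfolding add_form_def graded_ideal_def by (blast intro: polys_closed(4,5))
  show "0 \<in> add_form n l V" using V P(2) unfolding add_form_def graded_ideal_def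
    by (metis (mono_tags, lifting) add.right_neutral mem_Collect_eq mult_zero_right)
  fix f assume "f \<in> add_form n l V"
  then obtain a b where f: "f = a + l * b" "a \<in> V" "b \<in> polys n" by (auto simp: add_form_def)
  show "hcomp q f \<in> add_form n l V" for q
  proof -
    have "hcomp q f = hcomp q a + l * (if q = 0 then 0 else hcomp (q - 1) b)"
      using hcomp_linear_mult[OF l(2)] by (simp add: f hcomp_add)
    moreover have "hcomp q a \<in> V" using V f by (auto simp: graded_ideal_def)
    moreover have "(if q = 0 then 0 else hcomp (q - 1) b) \<in> polys n" using f hcomp_polys P by auto
    ultimately show ?thesis unfolding add_form_def by blast
  qed
  fix g assume "g \<in> add_form n l V"
  then obtain a' b' where g: "g = a' + l * b'" "a' \<in> V" "b' \<in> polys n" by (auto simp: add_form_def)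
  have "f + g = (a + a') + l * (b + b')" by (simp add: f g algebra_simps)
  moreover have "a + a' \<in> V" "b + b' \<in> polys n" using V f g P by (auto simp: graded_ideal_def)
  ultimately show "f + g \<in> add_form n l V" unfolding add_form_def by blast
next
  fix h f :: "'k polynomial" assume h: "h \<in> polys n" and "f \<in> add_form n l V"
  then obtain a b where f: "f = a + l * b" "a \<in> V" "b \<in> polys n" by (auto simp: add_form_def)
  have "h * f = h * a + l * (h * b)" by (simp add: f algebra_simps)
  moreover have "h * a \<in> V" "h * b \<in> polys n"
    using V f h polys_closed(5)[OF h] by (auto simp: graded_ideal_def)
  ultimately show "h * f \<in> add_form n l V" unfolding add_form_def by blast
qed

text \<open>The multiplier of \<open>l\<close> may be replaced by its remainder on standard
  monomials, because the difference is in \<open>V\<close>. For an \<open>l\<close> regular modulo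
  \<open>V\<close> this makes the multiplier unique.\<close>

lemma part_add_form:
  assumes V: "graded_ideal n V" and l: "l \<in> polys n" "homogeneous 1 l"
  shows "degree_part (add_form n l V) (Suc q) =
    {f + l * g | f g. f \<in> degree_part V (Suc q) \<and> keys g \<subseteq> std_monomials n V q}"
proof (intro equalityI subsetI)
  fix h assume h: "h \<in> degree_part (add_form n l V) (Suc q)"
  then obtain a b where ab: "h = a + l * b" "a \<in> V" "b \<in> polys n" "homogeneous (Suc q) h"
    by (auto simp: degree_part_def add_form_def)
  obtain g where g: "keys g \<subseteq> std_monomials n V q" "hcomp q b - g \<in> degree_part V q"
    using std_reduce[OF V hcomp_polys[OF ab(3)] homogeneous_hcomp] by blast
  have "h = hcomp (Suc q) (a + l * b)" using ab by (simp add: hcomp_id)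
  also have "\<dots> = hcomp (Suc q) a + l * hcomp q b"
    using hcomp_linear_mult[OF l(2), of "Suc q" b] by (simp add: hcomp_add)
  finally have "h = (hcomp (Suc q) a + l * (hcomp q b - g)) + l * g" by (simp add: algebra_simps)
  moreover have "hcomp (Suc q) a + l * (hcomp q b - g) \<in> degree_part V (Suc q)"
  proof -
    have "l * (hcomp q b - g) \<in> V" "hcomp (Suc q) a \<in> V"
      using V l g(2) ab(2) by (auto simp: graded_ideal_def degree_part_def)
    moreover have "homogeneous (Suc q) (l * (hcomp q b - g))"
      using homogeneous_mult[OF l(2), of q] g(2) by (simp add: degree_part_def)
    ultimately show ?thesis
      using graded_ideal_linear[OF V] homogeneous_add[OF homogeneous_hcomp]
      by (simp add: degree_part_def linear_set_def)
  qed
  ultimately show "h \<in> {f + l * g | f g. f \<in> degree_part V (Suc q) \<and> keys g \<subseteq> std_monomials n V q}" using g(1) by blast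
next
  fix h assume "h \<in> {f + l * g | f g. f \<in> degree_part V (Suc q) \<and> keys g \<subseteq> std_monomials n V q}"
  then obtain f g where fg: "h = f + l * g" "f \<in> degree_part V (Suc q)" "keys g \<subseteq> std_monomials n V q" by blast
  have "keys g \<subseteq> mons {..<n} q" using fg by (auto simp: std_monomials_def)
  then have g: "g \<in> polys n" "homogeneous q g" by (auto simp: polys_def homogeneous_def in_mons_iff)
  have "homogeneous (Suc q) h"
    unfolding fg using homogeneous_mult[OF l(2) g(2)] fg(2) by (intro homogeneous_add) (auto simp: degree_part_def)
  then show "h \<in> degree_part (add_form n l V) (Suc q)" using fg g by (auto simp: degree_part_def add_form_def)
qed

lemma card_std: "card (std_monomials n V q) + card (leads V \<inter> mons {..<n} q) = card (mons {..<n} q)"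
proof -
  let ?A = "mons {..<n} q"
  have "card ((?A - leads V) \<union> (leads V \<inter> ?A)) = card (?A - leads V) + card (leads V \<inter> ?A)"
    by (intro card_Un_disjoint) auto
  moreover have "(?A - leads V) \<union> (leads V \<inter> ?A) = ?A" by blast
  ultimately show ?thesis by (simp add: std_monomials_def)
qed

text \<open>In degree \<open>q + 1\<close> a basis of the enlarged ideal consists of a basis of the
  part of \<open>V\<close> and the products of \<open>l\<close> with the standard monomials of
  degree \<open>q\<close>. A linear relation would, after cancelling \<open>l\<close>, put a nonzero
  combination of standard monomials into \<open>V\<close>. So adding \<open>l\<close> replaces the
  Hilbert function by its difference function.\<close>

theorem card_std_add_form:
  assumes V: "graded_ideal n V" and l: "l \<in> polys n" "homogeneous 1 l"
    and reg: "\<And>g. g \<in> polys n \<Longrightarrow> l * g \<in> V \<Longrightarrow> g \<in> V"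
  shows "card (std_monomials n (add_form n l V) 0) = card (std_monomials n V 0)"
    "card (std_monomials n (add_form n l V) (Suc q)) + card (std_monomials n V q) = card (std_monomials n V (Suc q))"
proof -
  let ?V = "add_form n l V"
  have V': "graded_ideal n ?V" by (rule add_form_graded[OF V l])
  have "degree_part ?V 0 = degree_part V 0"
  proof (intro equalityI subsetI)
    fix h assume "h \<in> degree_part ?V 0"
    then obtain a b where ab: "h = a + l * b" "a \<in> V" "homogeneous 0 h"
      by (auto simp: degree_part_def add_form_def)
    have "h = hcomp 0 (a + l * b)" using ab by (simp add: hcomp_id)
    also have "\<dots> = hcomp 0 a" using hcomp_linear_mult[OF l(2), of 0 b] by (simp add: hcomp_add)
    finally show "h \<in> degree_part V 0" using V ab by (auto simp: degree_part_def graded_ideal_def)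
  next
    fix h assume "h \<in> degree_part V 0"
    moreover have "h = h + l * 0" by simp
    ultimately show "h \<in> degree_part ?V 0" using polys_closed(1) unfolding degree_part_def add_form_def by blast
  qed
  then show "card (std_monomials n ?V 0) = card (std_monomials n V 0)"
    using leads_degree_part[OF V, of 0] leads_degree_part[OF V', of 0] by (auto simp: std_monomials_def intro!: arg_cong[of _ _ card])
  \<comment> \<open>The products of \<open>l\<close> with standard monomials are adjoined one at a
    time.\<close>
  have ex: "\<exists>B. finite B \<and> vindependent B \<and> card B = card (leads (degree_part V (Suc q))) + card T \<and>
      vspan B = {f + l * g | f g. f \<in> degree_part V (Suc q) \<and> keys g \<subseteq> T}"
    if "finite T" "T \<subseteq> std_monomials n V q" for T
    using that
  proof (induction T rule: finite_induct)
    case empty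
    let ?W = "degree_part V (Suc q)"
    have W: "linear_set ?W" by (rule degree_part_linear[OF V])
    have fin: "finite (leads ?W)" using leads_degree_part[OF V] by simp
    obtain B where B: "B \<subseteq> ?W" "vindependent B" "?W \<subseteq> vspan B" "card B = vdim ?W"
      using Vector_Spaces.vector_space.basis_exists[OF vector_space_scale, of ?W] by blast
    \<comment> \<open>As \<open>card\<close> is 0 for infinite sets, finiteness of \<open>B\<close>
      needs an argument when there is no leading monomial: then the space contains only 0.\<close>
    have "finite B \<or> leads ?W = {}" using B(4) vdim_leads[OF W fin] fin by (metis card_eq_0_iff)
    moreover have "finite B" if "leads ?W = {}"
    proof -
      have "B \<subseteq> {0}" using B(1) that by (auto simp: leads_def)
      then show ?thesis by (rule finite_subset) simp
    qed
    moreover have "{f + l * g | f g. f \<in> ?W \<and> keys g \<subseteq> {}} = ?W"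
    proof (intro equalityI subsetI)
      fix h assume "h \<in> ?W"
      moreover have "h = h + l * 0" by simp
      ultimately show "h \<in> {f + l * g | f g. f \<in> ?W \<and> keys g \<subseteq> {}}" by fastforce
    qed (auto simp: keys_eq_empty)
    moreover have "vspan B = ?W" using B(3) vspan_linear_set[OF W B(1)] by blast
    ultimately show ?case using B vdim_leads[OF W fin] by (intro exI[of _ B]) auto
  next
    case (insert v T)
    then obtain B where B: "finite B" "vindependent B" "card B = card (leads (degree_part V (Suc q))) + card T"
        "vspan B = {f + l * g | f g. f \<in> degree_part V (Suc q) \<and> keys g \<subseteq> T}" by auto
    let ?x = "l * single v 1"
    have xB: "?x \<notin> vspan B"
    proof
      assume "?x \<in> vspan B"
      then obtain f g where fg: "?x = f + l * g" "f \<in> V" "keys g \<subseteq> T"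
        unfolding B(4) degree_part_def by blast
      have k: "keys (single v 1 - g) \<subseteq> insert v T"
        using fg(3) by (auto simp: in_keys_iff lookup_minus lookup_single when_def split: if_splits)
      then have ks: "keys (single v 1 - g) \<subseteq> std_monomials n V q" using insert.prems by auto
      then have "single v 1 - g \<in> polys n" by (auto simp: polys_def std_monomials_def in_mons_iff)
      moreover have "l * (single v 1 - g) = f" using fg(1) by (simp add: algebra_simps)
      ultimately have "single v 1 - g \<in> V" using reg fg(2) by simp
      then have "single v 1 - g = 0" using ks by (rule std_zero)
      then have "v \<in> keys g" by (metis eq_iff_diff_eq_0 insertI1 keys_single zero_neq_one)
      then show False using fg(3) insert.hyps(2) by auto
    qed
    have "vspan (insert ?x B) = {f + l * g | f g. f \<in> degree_part V (Suc q) \<and> keys g \<subseteq> insert v T}"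
    proof (intro equalityI subsetI)
      fix h assume "h \<in> vspan (insert ?x B)"
      then obtain c where "h - scale c ?x \<in> vspan B" unfolding vspan_insert by blast
      then obtain f g where fg: "h - scale c ?x = f + l * g" "f \<in> degree_part V (Suc q)" "keys g \<subseteq> T"
        unfolding B(4) by blast
      have "h = (h - scale c ?x) + scale c ?x" by simp
      also have "\<dots> = f + l * (g + scale c (single v 1))"
        by (simp only: fg(1)) (simp add: scale_def algebra_simps)
      finally have "h = f + l * (g + scale c (single v 1))" .
      moreover have "keys (g + scale c (single v 1)) \<subseteq> insert v T"
        using Poly_Mapping.keys_add[of g "scale c (single v 1)"] keys_scale[of c "single v 1"] fg(3) by auto
      ultimately show "h \<in> {f + l * g | f g. f \<in> degree_part V (Suc q) \<and> keys g \<subseteq> insert v T}" using fg(2) by blast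
    next
      fix h assume "h \<in> {f + l * g | f g. f \<in> degree_part V (Suc q) \<and> keys g \<subseteq> insert v T}"
      then obtain f g where fg: "h = f + l * g" "f \<in> degree_part V (Suc q)" "keys g \<subseteq> insert v T" by blast
      define c where "c = lookup g v"
      define g' where "g' = g - scale c (single v 1)"
      have "keys g' \<subseteq> T"
      proof
        fix u assume "u \<in> keys g'"
        then have "lookup g' u \<noteq> 0" by (simp add: in_keys_iff)
        then have "u \<noteq> v \<and> lookup g u \<noteq> 0"
          by (auto simp: g'_def c_def lookup_minus lookup_single when_def split: if_splits)
        then show "u \<in> T" using fg(3) by (auto simp: in_keys_iff)
      qed
      moreover have "h - scale c ?x = f + l * g'" by (simp add: fg(1) g'_def scale_def algebra_simps)
      ultimately have "h - scale c ?x \<in> vspan B" unfolding B(4) using fg(2) by blast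
      then show "h \<in> vspan (insert ?x B)" unfolding vspan_insert by blast
    qed
    moreover have "?x \<notin> B" using xB vspan_base by blast
    ultimately show ?case using B insert.hyps vindependent_insert[OF xB B(2)]
      by (intro exI[of _ "insert ?x B"]) simp
  qed
  obtain B where B: "vindependent B" "card B = card (leads (degree_part V (Suc q))) + card (std_monomials n V q)"
      "vspan B = degree_part ?V (Suc q)"
    using ex[of "std_monomials n V q"] part_add_form[OF V l, of q] by (auto simp: std_monomials_def)
  have "B \<subseteq> degree_part ?V (Suc q)" using B(3) vspan_base by blast
  then have "vdim (degree_part ?V (Suc q)) = card (leads (degree_part V (Suc q))) + card (std_monomials n V q)"
    using B by (intro vdim_unique[of B]) auto
  moreover have "vdim (degree_part ?V (Suc q)) = card (leads (degree_part ?V (Suc q)))"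
    using leads_degree_part[OF V'] by (intro vdim_leads degree_part_linear[OF V']) simp
  ultimately show "card (std_monomials n ?V (Suc q)) + card (std_monomials n V q) = card (std_monomials n V (Suc q))"
    using card_std[of n V "Suc q"] card_std[of n ?V "Suc q"] leads_degree_part[OF V] leads_degree_part[OF V'] by simp
qed

section \<open>Extension of the ground field\<close>

text \<open>The variables with index at least \<open>n\<close> play the role of transcendental parameters: exponents of
  these are shifted down by \<open>n\<close> to obtain coefficients in \<open>K[t\<^sub>0, t\<^sub>1, \<dots>]\<close>, hence in its
  field of fractions.\<close>

definition shift_up :: "nat \<Rightarrow> monomial \<Rightarrow> monomial" where
  "shift_up n v = Abs_poly_mapping (\<lambda>i. if n \<le> i then lookup v (i - n) else 0)"

lemma lookup_shift_up: "lookup (shift_up n v) i = (if n \<le> i then lookup v (i - n) else 0)"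
proof -
  have "finite {i. (if n \<le> i then lookup v (i - n) else 0) \<noteq> 0}"
  proof (rule finite_subset)
    show "{i. (if n \<le> i then lookup v (i - n) else 0) \<noteq> 0} \<subseteq> (\<lambda>i. i + n) ` keys v"
    proof
      fix i assume "i \<in> {i. (if n \<le> i then lookup v (i - n) else 0) \<noteq> 0}"
      then have "n \<le> i" "i - n \<in> keys v" by (auto simp: in_keys_iff split: if_splits)
      then show "i \<in> (\<lambda>i. i + n) ` keys v" by (intro image_eqI[of _ _ "i - n"]) auto
    qed
  qed simp
  then show ?thesis by (simp add: shift_up_def)
qed

lemma shift_up_add: "shift_up n (u + v) = shift_up n u + shift_up n v"
  by (rule poly_mapping_eqI) (simp add: lookup_shift_up lookup_add)

lemma shift_up_zero [simp]: "shift_up n 0 = 0"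
  by (rule poly_mapping_eqI) (simp add: lookup_shift_up)

lemma shift_up_inject [simp]: "shift_up n u = shift_up n v \<longleftrightarrow> u = v"
proof
  assume a: "shift_up n u = shift_up n v"
  have "lookup u i = lookup v i" for i
    using arg_cong[OF a, of "\<lambda>w. lookup w (i + n)"] by (simp add: lookup_shift_up)
  then show "u = v" by (rule poly_mapping_eqI)
qed simp

lemma monomials_disjoint: "u \<in> monomials n \<longleftrightarrow> keys u \<inter> {n..} = {}"
  by (simp add: monomials_def subset_iff disjoint_iff not_le)

lemma monomials_iff: "u \<in> monomials n \<longleftrightarrow> (\<forall>i\<ge>n. lookup u i = 0)"
  by (auto simp: monomials_disjoint disjoint_iff in_keys_iff simp del: neq0_conv)

lemma monomial_decomp:
  obtains a b where "w = a + shift_up n b" "a \<in> monomials n"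
proof
  define b where "b = Poly_Mapping.map_key (\<lambda>i. i + n) w"
  have lb: "lookup b i = lookup w (i + n)" for i
    by (simp add: b_def map_key.rep_eq inj_on_def)
  show "w = restr {..<n} w + shift_up n b"
    by (rule poly_mapping_eqI) (auto simp: lookup_add lookup_restr lookup_shift_up lb)
  show "restr {..<n} w \<in> monomials n" by (simp add: monomials_iff lookup_restr)
qed

lemma decomp_le_iff:
  assumes "a \<in> monomials n" "u \<in> monomials n"
  shows "(\<forall>i. lookup (a + shift_up n b) i \<le> lookup (u + shift_up n v) i) \<longleftrightarrow>
    (\<forall>i. lookup a i \<le> lookup u i) \<and> (\<forall>i. lookup b i \<le> lookup v i)"
proof (intro iffI conjI allI)
  assume a: "\<forall>i. lookup (a + shift_up n b) i \<le> lookup (u + shift_up n v) i"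
  show "lookup a i \<le> lookup u i" for i
    using spec[OF a, of i] assms by (cases "n \<le> i") (auto simp: lookup_add lookup_shift_up monomials_iff)
  show "lookup b i \<le> lookup v i" for i
    using spec[OF a, of "i + n"] assms by (auto simp: lookup_add lookup_shift_up monomials_iff)
qed (auto simp: lookup_add lookup_shift_up intro!: add_mono)

definition coeff_in :: "nat \<Rightarrow> monomial \<Rightarrow> 'k::field polynomial \<Rightarrow> 'k polynomial" where
  "coeff_in n u f = Abs_poly_mapping (\<lambda>v. lookup f (u + shift_up n v))"

lemma lookup_coeff_in: "lookup (coeff_in n u f) v = lookup f (u + shift_up n v)"
proof -
  have "finite ((\<lambda>v. u + shift_up n v) -` keys f)" by (rule finite_vimageI) (auto simp: inj_on_def)
  then have "finite {v. lookup f (u + shift_up n v) \<noteq> 0}"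
    by (rule finite_subset[rotated]) (auto simp: in_keys_iff)
  then show ?thesis by (simp add: coeff_in_def)
qed

lemma coeff_in_add: "coeff_in n u (f + g) = coeff_in n u f + coeff_in n u g"
  by (rule poly_mapping_eqI) (simp add: lookup_coeff_in lookup_add)

definition to_frac :: "nat \<Rightarrow> 'k::field polynomial \<Rightarrow> 'k polynomial fract polynomial" where
  "to_frac n f = Abs_poly_mapping (\<lambda>u. if u \<in> monomials n then to_fract (coeff_in n u f) else 0)"

lemma lookup_to_frac:
  "lookup (to_frac n f) u = (if u \<in> monomials n then to_fract (coeff_in n u f) else 0)"
proof -
  have "finite {u. (if u \<in> monomials n then to_fract (coeff_in n u f) else 0) \<noteq> 0}"
  proof (rule finite_subset)
    show "{u. (if u \<in> monomials n then to_fract (coeff_in n u f) else 0) \<noteq> 0} \<subseteq> restr {..<n} ` keys f"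
    proof
      fix u assume "u \<in> {u. (if u \<in> monomials n then to_fract (coeff_in n u f) else 0) \<noteq> 0}"
      then have u: "u \<in> monomials n" "coeff_in n u f \<noteq> 0" by (auto split: if_splits)
      then obtain v where v: "u + shift_up n v \<in> keys f"
        by (metis in_keys_iff lookup_coeff_in lookup_zero poly_mapping_eqI)
      have "restr {..<n} (u + shift_up n v) = u"
        using u(1) by (intro poly_mapping_eqI) (auto simp: lookup_restr lookup_add lookup_shift_up monomials_iff)
      then show "u \<in> restr {..<n} ` keys f" using v by (metis imageI)
    qed
  qed simp
  then show ?thesis by (simp add: to_frac_def)
qed

lemma to_frac_polys: "to_frac n f \<in> polys n"
  by (auto simp: polys_def in_keys_iff lookup_to_frac split: if_splits)

lemma to_frac_add: "to_frac n (f + g) = to_frac n f + to_frac n g"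
  by (rule poly_mapping_eqI) (simp add: lookup_to_frac lookup_add coeff_in_add)

lemma to_frac_zero [simp]: "to_frac n 0 = 0"
proof (rule poly_mapping_eqI)
  fix u
  have "coeff_in n u (0 :: 'a polynomial) = 0" by (rule poly_mapping_eqI) (simp add: lookup_coeff_in)
  then show "lookup (to_frac n (0 :: 'a polynomial)) u = lookup 0 u" by (simp add: lookup_to_frac)
qed

lemma to_frac_sum: "to_frac n (sum f A) = (\<Sum>a\<in>A. to_frac n (f a))"
  by (induction A rule: infinite_finite_induct) (auto simp: to_frac_add)

lemma to_frac_inject:
  assumes "to_frac n f = to_frac n g" shows "f = g"
proof (rule poly_mapping_eqI)
  fix w
  obtain a b where w: "w = a + shift_up n b" "a \<in> monomials n" by (rule monomial_decomp)
  have "coeff_in n a f = coeff_in n a g"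
    using arg_cong[OF assms, of "\<lambda>h. lookup h a"] w(2) by (simp add: lookup_to_frac)
  then show "lookup f w = lookup g w" unfolding w(1) lookup_coeff_in[symmetric] by simp
qed

lemma monomials_eq_decomp:
  assumes "a \<in> monomials n" "u \<in> monomials n"
  shows "u + shift_up n v = a + shift_up n b \<longleftrightarrow> u = a \<and> v = b"
proof
  assume e: "u + shift_up n v = a + shift_up n b"
  have "lookup u i = lookup a i" for i
    using arg_cong[OF e, of "\<lambda>w. lookup w i"] assms
    by (cases "n \<le> i") (auto simp: lookup_add lookup_shift_up monomials_iff)
  then have "u = a" by (rule poly_mapping_eqI)
  then show "u = a \<and> v = b" using e by simp
qed simp

lemma to_frac_single:
  assumes "a \<in> monomials n"
  shows "to_frac n (single (a + shift_up n b) c) = single a (to_fract (single b c))"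
proof (rule poly_mapping_eqI)
  fix u
  show "lookup (to_frac n (single (a + shift_up n b) c)) u = lookup (single a (to_fract (single b c))) u"
  proof (cases "u \<in> monomials n")
    case True
    have "coeff_in n u (single (a + shift_up n b) c) = (if u = a then single b c else 0)"
    proof (rule poly_mapping_eqI)
      fix v
      show "lookup (coeff_in n u (single (a + shift_up n b) c)) v = lookup (if u = a then single b c else 0) v"
        using monomials_eq_decomp[OF assms True, of v b]
        by (auto simp: lookup_coeff_in lookup_single when_def)
    qed
    then show ?thesis using True by (simp add: lookup_to_frac lookup_single when_def)
  next
    case False
    then show ?thesis using assms by (auto simp: lookup_to_frac lookup_single when_def)
  qed
qed

lemma to_frac_single_mult:
  assumes a: "a \<in> monomials n"
  shows "to_frac n (single (a + shift_up n b) c * f) = single a (to_fract (single b c)) * to_frac n f"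
proof (rule poly_mapping_eqI)
  fix u
  show "lookup (to_frac n (single (a + shift_up n b) c * f)) u =
    lookup (single a (to_fract (single b c)) * to_frac n f) u"
  proof (cases "u \<in> monomials n")
    case u: True
    show ?thesis
    proof (cases "\<forall>i. lookup a i \<le> lookup u i")
      case True
      then obtain u' where u': "u = a + u'" using monomial_dvd_iff by blast
      have u'm: "u' \<in> monomials n" using u u' by (simp add: monomials_iff lookup_add)
      have "coeff_in n u (single (a + shift_up n b) c * f) = single b c * coeff_in n u' f"
      proof (rule poly_mapping_eqI)
        fix v
        show "lookup (coeff_in n u (single (a + shift_up n b) c * f)) v = lookup (single b c * coeff_in n u' f) v"
        proof (cases "\<forall>i. lookup b i \<le> lookup v i")
          case True
          then obtain v' where v': "v = b + v'" using monomial_dvd_iff by blast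
          have "u + shift_up n v = (a + shift_up n b) + (u' + shift_up n v')"
            by (simp add: u' v' shift_up_add ac_simps)
          then show ?thesis by (simp only: lookup_coeff_in lookup_single_mult_add v')
        next
          case False
          then have "\<not> (\<forall>i. lookup (a + shift_up n b) i \<le> lookup (u + shift_up n v) i)"
            using decomp_le_iff[OF a u] by blast
          then show ?thesis using False by (metis lookup_coeff_in lookup_single_mult_zero)
        qed
      qed
      then show ?thesis
        using u u'm by (simp add: lookup_to_frac) (simp add: u' lookup_single_mult_add lookup_to_frac)
    next
      case False
      have "coeff_in n u (single (a + shift_up n b) c * f) = 0"
      proof (rule poly_mapping_eqI)
        fix v
        have "\<not> (\<forall>i. lookup (a + shift_up n b) i \<le> lookup (u + shift_up n v) i)"
          using decomp_le_iff[OF a u] False by blast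
        then show "lookup (coeff_in n u (single (a + shift_up n b) c * f)) v = lookup 0 v"
          by (metis lookup_coeff_in lookup_single_mult_zero lookup_zero)
      qed
      then show ?thesis using lookup_single_mult_zero[OF False] by (simp add: lookup_to_frac)
    qed
  next
    case False
    have "single a (to_fract (single b c)) * to_frac n f \<in> polys n"
      using a by (intro polys_closed(5) to_frac_polys) (auto simp: polys_def)
    then have "u \<notin> keys (single a (to_fract (single b c)) * to_frac n f)" using False by (auto simp: polys_def)
    then show ?thesis using False by (simp add: lookup_to_frac in_keys_iff)
  qed
qed

lemma to_frac_mult: "to_frac n (f * g) = to_frac n f * to_frac n g"
proof (induction f rule: poly_induct)
  case (single w c)
  obtain a b where w: "w = a + shift_up n b" "a \<in> monomials n" by (rule monomial_decomp)
  show ?case by (simp only: w(1) to_frac_single_mult[OF w(2)] to_frac_single[OF w(2)])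
next
  case (add f f')
  then show ?case by (simp add: distrib_right to_frac_add)
qed simp

lemma to_frac_const: "\<exists>d. to_frac n d = const_poly (to_fract a)" for a :: "'k::field polynomial"
proof (induction a rule: poly_induct)
  case zero
  then show ?case by (intro exI[of _ 0]) (simp add: const_poly_def)
next
  case (single v c)
  have "to_frac n (single (0 + shift_up n v) c) = single 0 (to_fract (single v c))"
    by (rule to_frac_single) (simp add: monomials_def)
  then show ?case by (intro exI[of _ "single (shift_up n v) c"]) (simp add: const_poly_def)
next
  case (add a b)
  then obtain d e where "to_frac n d = const_poly (to_fract a)" "to_frac n e = const_poly (to_fract b)" by blast
  then show ?case by (intro exI[of _ "d + e"]) (simp add: to_frac_add const_poly_def single_add)
qed

lemma const_poly_mult: "const_poly (a * b) = const_poly a * const_poly b"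
  by (simp add: const_poly_def mult_single)

lemma clear_denominators:
  fixes G :: "'k::field polynomial fract polynomial"
  assumes "G \<in> polys n"
  shows "\<exists>b h. b \<noteq> 0 \<and> const_poly (to_fract b) * G = to_frac n h"
proof -
  have "\<exists>b h. b \<noteq> 0 \<and> const_poly (to_fract b) * (\<Sum>u\<in>A. single u (lookup G u)) = to_frac n h"
    if "finite A" "A \<subseteq> monomials n" for A
    using that
  proof (induction A rule: finite_induct)
    case empty
    show ?case by (intro exI[of _ 1] exI[of _ 0]) simp
  next
    case (insert u A)
    then obtain b h where b: "b \<noteq> 0" "const_poly (to_fract b) * (\<Sum>u\<in>A. single u (lookup G u)) = to_frac n h"
      by auto
    obtain p r where pr: "lookup G u = Fract p r" "r \<noteq> 0" by (cases "lookup G u")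
    obtain dr where dr: "to_frac n dr = const_poly (to_fract r)" using to_frac_const by blast
    obtain dp where dp: "to_frac n dp = const_poly (to_fract p)" using to_frac_const by blast
    obtain db where db: "to_frac n db = const_poly (to_fract b)" using to_frac_const by blast
    have u1: "to_frac n (single u 1) = single u 1"
      using to_frac_single[of u n 0 1] insert.prems by simp
    have "to_fract r * lookup G u = to_fract p" using pr by (simp add: to_fract_def eq_fract)
    then have e: "const_poly (to_fract r) * single u (lookup G u) = const_poly (to_fract p) * single u 1"
      by (simp add: const_poly_def mult_single)
    have "const_poly (to_fract (b * r)) * (\<Sum>u\<in>insert u A. single u (lookup G u))
        = const_poly (to_fract b) * (const_poly (to_fract r) * single u (lookup G u)) +
          const_poly (to_fract r) * (const_poly (to_fract b) * (\<Sum>u\<in>A. single u (lookup G u)))"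
      using insert.hyps by (simp add: const_poly_mult distrib_left mult.assoc mult.left_commute)
    also have "\<dots> = to_frac n (db * (dp * single u 1) + dr * h)"
      unfolding e b(2) by (simp add: to_frac_add to_frac_mult dr dp db u1)
    finally show ?case using b(1) pr(2) by (intro exI[of _ "b * r"] exI conjI) auto
  qed
  from this[of "keys G"] show ?thesis using assms poly_sum_singles[of G] by (auto simp: polys_def)
qed

text \<open>The extension of \<open>A\<close> to the ring over the fraction field of the parameters.
  One nonzero parameter polynomial \<open>a\<close> clears all denominators, so membership is a
  statement about \<open>A\<close>.\<close>

definition frac_ideal :: "nat \<Rightarrow> 'k::field polynomial set \<Rightarrow> 'k polynomial fract polynomial set" where
  "frac_ideal n A = {G \<in> polys n. \<exists>a g. a \<noteq> 0 \<and> g \<in> A \<and> const_poly (to_fract a) * G = to_frac n g}"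

text \<open>After denominators are cleared, the relation is pulled back along the injective
  \<open>to_frac\<close>, and there \<open>x\<close> cancels.\<close>

lemma frac_ideal_nonzerodiv:
  assumes "nonzerodiv x (ideal_span S)" "G \<in> polys n" "to_frac n x * G \<in> frac_ideal n (ideal_span S)"
  shows "G \<in> frac_ideal n (ideal_span S)"
proof -
  obtain a g where a: "a \<noteq> 0" "g \<in> ideal_span S" "const_poly (to_fract a) * (to_frac n x * G) = to_frac n g"
    using assms(3) by (auto simp: frac_ideal_def)
  obtain b h where b: "b \<noteq> 0" "const_poly (to_fract b) * G = to_frac n h"
    using clear_denominators[OF assms(2)] by blast
  obtain da where da: "to_frac n da = const_poly (to_fract a)" using to_frac_const by blast
  obtain db where db: "to_frac n db = const_poly (to_fract b)" using to_frac_const by blast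
  have "to_frac n (x * (da * h)) = const_poly (to_fract b) * (const_poly (to_fract a) * (to_frac n x * G))"
    by (simp add: to_frac_mult da b(2)[symmetric] ac_simps)
  also have "\<dots> = to_frac n (db * g)" by (simp add: a(3) to_frac_mult db)
  finally have "x * (da * h) = db * g" by (rule to_frac_inject)
  then have "x * (da * h) \<in> ideal_span S" using a(2) span_mult_left by simp
  then have "da * h \<in> ideal_span S" using assms(1) by (simp add: nonzerodiv_def)
  moreover have "const_poly (to_fract (a * b)) * G = to_frac n (da * h)"
    by (simp add: const_poly_mult to_frac_mult da b(2)[symmetric] ac_simps)
  ultimately show ?thesis using assms(2) a(1) b(1) unfolding frac_ideal_def
    by (intro CollectI conjI exI[of _ "a * b"] exI[of _ "da * h"]) auto
qed

lemma frac_ideal_insert: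
  "frac_ideal n (ideal_span (insert x S)) = add_form n (to_frac n x) (frac_ideal n (ideal_span S))"
proof (intro equalityI subsetI)
  fix G assume "G \<in> frac_ideal n (ideal_span (insert x S))"
  then obtain a g where G: "G \<in> polys n" "a \<noteq> 0" "g \<in> ideal_span (insert x S)"
      "const_poly (to_fract a) * G = to_frac n g"
    by (auto simp: frac_ideal_def)
  then obtain k where k: "g - k * x \<in> ideal_span S" by (auto simp: span_insert_iff)
  define c where "c = const_poly (inverse (to_fract a))"
  have c: "c * const_poly (to_fract a) = 1" "const_poly (to_fract a) * c = 1"
    using G(2) by (simp_all add: c_def const_poly_def mult_single)
  have "to_frac n g = to_frac n (g - k * x) + to_frac n k * to_frac n x"
    by (simp add: to_frac_add[symmetric] to_frac_mult[symmetric])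
  then have "c * (const_poly (to_fract a) * G) = c * (to_frac n (g - k * x) + to_frac n k * to_frac n x)"
    using G(4) by simp
  moreover have "c * (const_poly (to_fract a) * G) = G" using c(1) by (simp only: mult.assoc[symmetric] mult_1)
  ultimately have "G = c * to_frac n (g - k * x) + to_frac n x * (c * to_frac n k)"
    by (simp add: distrib_left mult.left_commute mult.commute)
  moreover have "c * to_frac n (g - k * x) \<in> frac_ideal n (ideal_span S)"
  proof -
    have "const_poly (to_fract a) * (c * to_frac n (g - k * x)) = to_frac n (g - k * x)"
      using c(2) by (simp only: mult.assoc[symmetric] mult_1)
    moreover have "c * to_frac n (g - k * x) \<in> polys n"
      unfolding c_def by (intro polys_closed(5) const_polys to_frac_polys)
    ultimately show ?thesis using G(2) k unfolding frac_ideal_def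
      by (intro CollectI conjI exI[of _ a] exI[of _ "g - k * x"]) auto
  qed
  moreover have "c * to_frac n k \<in> polys n"
    unfolding c_def by (intro polys_closed(5) const_polys to_frac_polys)
  ultimately show "G \<in> add_form n (to_frac n x) (frac_ideal n (ideal_span S))"
    unfolding add_form_def by blast
next
  fix G assume "G \<in> add_form n (to_frac n x) (frac_ideal n (ideal_span S))"
  then obtain G1 G2 where G: "G = G1 + to_frac n x * G2" "G1 \<in> frac_ideal n (ideal_span S)" "G2 \<in> polys n"
    by (auto simp: add_form_def)
  obtain a g where a: "a \<noteq> 0" "g \<in> ideal_span S" "const_poly (to_fract a) * G1 = to_frac n g" "G1 \<in> polys n"
    using G(2) by (auto simp: frac_ideal_def)
  obtain b h where b: "b \<noteq> 0" "const_poly (to_fract b) * G2 = to_frac n h"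
    using clear_denominators[OF G(3)] by blast
  obtain da where da: "to_frac n da = const_poly (to_fract a)" using to_frac_const by blast
  obtain db where db: "to_frac n db = const_poly (to_fract b)" using to_frac_const by blast
  have "const_poly (to_fract (a * b)) * G =
      const_poly (to_fract b) * (const_poly (to_fract a) * G1) +
      const_poly (to_fract a) * (to_frac n x * (const_poly (to_fract b) * G2))"
    by (simp add: G(1) const_poly_mult distrib_left ac_simps)
  also have "\<dots> = to_frac n (db * g + (da * h) * x)"
    unfolding a(3) b(2) by (simp add: to_frac_add to_frac_mult da db ac_simps)
  finally have e: "const_poly (to_fract (a * b)) * G = to_frac n (db * g + (da * h) * x)" .
  have "(db * g + (da * h) * x) - (da * h) * x \<in> ideal_span S"
    using span_mult_left[OF a(2), of db] by simp
  then have "db * g + (da * h) * x \<in> ideal_span (insert x S)" unfolding span_insert_iff by blast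
  moreover have "G \<in> polys n" using G a(4) by (simp add: polys_closed(4,5) to_frac_polys)
  ultimately show "G \<in> frac_ideal n (ideal_span (insert x S))"
    using e a(1) b(1) unfolding frac_ideal_def
    by (intro CollectI conjI exI[of _ "a * b"] exI[of _ "db * g + (da * h) * x"]) auto
qed

section \<open>Coefficients in the parameters and the extended ideal\<close>

lemma free_of_polys: "f \<in> polys n \<Longrightarrow> Y \<inter> {..<n} = {} \<Longrightarrow> free_of Y f"
  by (fastforce simp: polys_def monomials_def free_of_def)

lemma pslice_polys: "pslice {n..} b f \<in> polys n"
  by (auto simp: polys_def monomials_disjoint in_keys_iff lookup_pslice split: if_splits)

lemma pslice_id:
  assumes "f \<in> polys n" shows "pslice {n..} 0 f = f"
proof (rule poly_mapping_eqI)
  fix u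
  show "lookup (pslice {n..} 0 f) u = lookup f u"
  proof (cases "u \<in> keys f")
    case True
    then have "keys u \<inter> {n..} = {}" using assms monomials_disjoint by (auto simp only: polys_def)
    then show ?thesis by (simp add: lookup_pslice)
  qed (simp add: lookup_pslice in_keys_iff)
qed

definition rel_ideal :: "nat \<Rightarrow> 'k::field polynomial set \<Rightarrow> bool" where
  "rel_ideal n I \<longleftrightarrow> I \<subseteq> polys n \<and> 0 \<in> I \<and> (\<forall>f\<in>I. \<forall>g\<in>I. f + g \<in> I) \<and>
    (\<forall>f\<in>polys n. \<forall>g\<in>I. f * g \<in> I)"

text \<open>Generators in \<open>polys n\<close> are constant in the variables of index at least
  \<open>n\<close>, so all coefficients with respect to these variables stay in
  \<open>I\<close>.\<close>

lemma pslice_span_ideal: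
  assumes I: "rel_ideal n I" "X \<subseteq> I" and b: "keys b \<subseteq> {n..}" and f: "f \<in> ideal_span X"
  shows "pslice {n..} b f \<in> I"
  using f
proof (induction rule: ideal_span_induct)
  case (step c x y)
  have "x \<in> polys n" "x \<in> I" using step I by (auto simp: rel_ideal_def)
  then have "pslice {n..} b (c * x) = pslice {n..} b c * x"
    using pslice_mult[OF b free_of_polys, of x n c] by (simp add: mult.commute disjoint_iff)
  then show ?case using step(2) I(1) \<open>x \<in> I\<close> pslice_polys[of n b c]
    by (simp add: pslice_add rel_ideal_def)
qed (use I in \<open>simp add: rel_ideal_def\<close>)

lemma graded_rel_ideal: "graded_ideal n I \<Longrightarrow> rel_ideal n I"
  by (simp add: graded_ideal_def rel_ideal_def)

lemma graded_frac_ideal: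
  fixes I :: "'k::field polynomial set"
  assumes I: "graded_ideal n I"
  shows "graded_ideal n (frac_ideal n (ideal_span I))"
  unfolding graded_ideal_def
proof (intro conjI ballI allI)
  let ?A = "ideal_span I" and ?c = "\<lambda>a. const_poly (to_fract a) :: 'k polynomial fract polynomial"
  show "frac_ideal n ?A \<subseteq> polys n" by (auto simp: frac_ideal_def)
  show "0 \<in> frac_ideal n ?A"
    unfolding frac_ideal_def by (intro CollectI conjI exI[of _ 1] exI[of _ 0]) (auto simp: polys_closed ideal_span_zero)
  fix F assume "F \<in> frac_ideal n ?A"
  then obtain a f where F: "F \<in> polys n" "a \<noteq> 0" "f \<in> ?A" "?c a * F = to_frac n f"
    by (auto simp: frac_ideal_def)
  obtain da where da: "to_frac n da = ?c a" using to_frac_const by blast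
  {
    fix G assume "G \<in> frac_ideal n ?A"
    then obtain b g where G: "G \<in> polys n" "b \<noteq> 0" "g \<in> ?A" "?c b * G = to_frac n g"
      by (auto simp: frac_ideal_def)
    obtain db where db: "to_frac n db = ?c b" using to_frac_const by blast
    have "?c (a * b) * (F + G) = ?c b * (?c a * F) + ?c a * (?c b * G)"
      by (simp add: const_poly_mult distrib_left ac_simps)
    also have "\<dots> = to_frac n (db * f + da * g)" unfolding F(4) G(4) by (simp add: to_frac_add to_frac_mult da db)
    finally show "F + G \<in> frac_ideal n ?A"
      using F G unfolding frac_ideal_def
      by (intro CollectI conjI exI[of _ "a * b"] exI[of _ "db * f + da * g"])
         (auto intro: polys_closed ideal_span_add span_mult_left)
  }
  fix q
  \<comment> \<open>The parameters have degree 0: only the exponents of the variables below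
    \<open>n\<close> count, so \<open>f'\<close> corresponds to the component of degree
    \<open>q\<close> over the fraction field.\<close>
  define f' where "f' = Abs_poly_mapping (\<lambda>w. if mdeg (restr {..<n} w) = q then lookup f w else 0)"
  have "finite {w. (if mdeg (restr {..<n} w) = q then lookup f w else 0) \<noteq> 0}"
    by (rule finite_subset[OF _ finite_keys[of f]]) (auto simp: in_keys_iff split: if_splits)
  then have f': "lookup f' w = (if mdeg (restr {..<n} w) = q then lookup f w else 0)" for w
    by (simp add: f'_def)
  have rs: "restr {..<n} (u + v) = u" if "u \<in> monomials n" "keys v \<subseteq> {n..}" for u v
    using that by (auto simp: restr_add monomials_def restr_id intro!: restr_zero)
  have "f' \<in> ?A"
  proof (rule span_if_pslices[of "{n..}"])
    fix b :: monomial assume b: "keys b \<subseteq> {n..}"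
    have "pslice {n..} b f' = hcomp q (pslice {n..} b f)"
    proof (rule poly_mapping_eqI)
      fix u :: monomial
      show "lookup (pslice {n..} b f') u = lookup (hcomp q (pslice {n..} b f)) u"
      proof (cases "keys u \<inter> {n..} = {}")
        case True
        then have "u \<in> monomials n" by (simp add: monomials_disjoint)
        then show ?thesis using rs[OF _ b] True by (simp add: lookup_pslice lookup_hcomp f')
      qed (simp add: lookup_pslice lookup_hcomp)
    qed
    also have "\<dots> \<in> I" using pslice_span_ideal[OF graded_rel_ideal[OF I] order_refl b F(3)] I
      by (simp add: graded_ideal_def)
    finally show "pslice {n..} b f' \<in> ?A" by (rule ideal_span_base)
  qed
  moreover have "?c a * hcomp q F = to_frac n f'"
  proof (rule poly_mapping_eqI)
    fix u
    have "lookup (to_frac n f') u = (if mdeg u = q then lookup (to_frac n f) u else 0)"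
    proof (cases "u \<in> monomials n")
      case True
      have "keys (shift_up n v) \<subseteq> {n..}" for v
        by (auto simp: in_keys_iff lookup_shift_up split: if_splits)
      then have "coeff_in n u f' = (if mdeg u = q then coeff_in n u f else 0)"
        using rs[OF True] by (intro poly_mapping_eqI) (simp add: lookup_coeff_in f')
      then show ?thesis using True by (simp add: lookup_to_frac)
    qed (simp add: lookup_to_frac)
    then show "lookup (?c a * hcomp q F) u = lookup (to_frac n f') u"
      by (simp add: F(4)[symmetric] lookup_const_mult lookup_hcomp)
  qed
  ultimately show "hcomp q F \<in> frac_ideal n ?A"
    using F hcomp_polys unfolding frac_ideal_def by blast
next
  fix H G :: "'k polynomial fract polynomial"
  assume H: "H \<in> polys n" and "G \<in> frac_ideal n (ideal_span I)"
  then obtain b g where G: "G \<in> polys n" "b \<noteq> 0" "g \<in> ideal_span I" "const_poly (to_fract b) * G = to_frac n g"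
    by (auto simp: frac_ideal_def)
  obtain a h where a: "a \<noteq> 0" "const_poly (to_fract a) * H = to_frac n h"
    using clear_denominators[OF H] by blast
  have "const_poly (to_fract (a * b)) * (H * G) = (const_poly (to_fract a) * H) * (const_poly (to_fract b) * G)"
    by (simp add: const_poly_mult ac_simps)
  also have "\<dots> = to_frac n (h * g)" unfolding a G(4) by (simp add: to_frac_mult)
  finally show "H * G \<in> frac_ideal n (ideal_span I)"
    using a G H unfolding frac_ideal_def
    by (intro CollectI conjI exI[of _ "a * b"] exI[of _ "h * g"])
       (auto intro: polys_closed span_mult_left)
qed

lemma keys_to_frac: "keys (to_frac n g) = {u \<in> monomials n. coeff_in n u g \<noteq> 0}"
  by (auto simp: in_keys_iff lookup_to_frac split: if_splits)

text \<open>Extending the field creates no new leading monomials: a parameter monomial occurring in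
  the leading coefficient of \<open>to_frac n g\<close> singles out a coefficient of
  \<open>g\<close>, which lies in \<open>I\<close> and has the same leading monomial.\<close>

lemma leads_frac_ideal:
  fixes I :: "'k::field polynomial set"
  assumes I: "rel_ideal n I"
  shows "leads (frac_ideal n (ideal_span I)) = leads I"
proof (intro equalityI subsetI)
  fix u assume "u \<in> leads (frac_ideal n (ideal_span I))"
  then obtain G where G: "G \<in> frac_ideal n (ideal_span I)" "G \<noteq> 0" "u = lead G" by (auto simp: leads_def)
  then obtain a g where g: "a \<noteq> 0" "g \<in> ideal_span I" "const_poly (to_fract a) * G = to_frac n g"
    by (auto simp: frac_ideal_def)
  have "lookup (to_frac n g) w = to_fract a * lookup G w" for w by (simp add: g(3)[symmetric] lookup_const_mult)
  then have kG: "keys G = keys (to_frac n g)" using g(1) by (auto simp: in_keys_iff)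
  have "u \<in> keys G" using G lead_in_keys by blast
  then have u: "u \<in> monomials n" "coeff_in n u g \<noteq> 0" using kG keys_to_frac by auto
  then obtain v where v: "lookup g (u + shift_up n v) \<noteq> 0"
    by (metis lookup_coeff_in lookup_zero poly_mapping_eqI)
  define f where "f = pslice {n..} (shift_up n v) g"
  have "keys (shift_up n v) \<subseteq> {n..}" by (auto simp: in_keys_iff lookup_shift_up split: if_splits)
  then have fI: "f \<in> I" unfolding f_def using pslice_span_ideal[OF I order_refl _ g(2)] by blast
  have uf: "u \<in> keys f" using u(1) v by (auto simp: f_def in_keys_iff lookup_pslice monomials_iff)
  have "w \<le> u" if w: "w \<in> keys f" for w
  proof -
    have "w \<in> monomials n" using w fI I by (auto simp: rel_ideal_def polys_def)
    moreover have "lookup g (w + shift_up n v) \<noteq> 0"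
      using w by (auto simp: f_def in_keys_iff lookup_pslice split: if_splits)
    then have "coeff_in n w g \<noteq> 0" by (metis lookup_coeff_in lookup_zero)
    ultimately have "w \<in> keys G" using kG keys_to_frac by auto
    then show ?thesis using le_lead G(3) by blast
  qed
  then have "lead f = u" using uf by (intro leadI)
  moreover have "f \<noteq> 0" using uf by auto
  ultimately show "u \<in> leads I" using fI by (auto simp: leads_def)
next
  fix u assume "u \<in> leads I"
  then obtain f where f: "f \<in> I" "f \<noteq> 0" "u = lead f" by (auto simp: leads_def)
  have fp: "f \<in> polys n" using f I by (auto simp: rel_ideal_def)
  have ci: "coeff_in n w f = single 0 (lookup f w)" if w: "w \<in> monomials n" for w
  proof (rule poly_mapping_eqI)
    fix v
    show "lookup (coeff_in n w f) v = lookup (single 0 (lookup f w)) v"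
    proof (cases "v = 0")
      case False
      have "w + shift_up n v \<notin> monomials n"
      proof
        assume "w + shift_up n v \<in> monomials n"
        then have "lookup v i = 0" for i
          using w by (auto simp: monomials_iff lookup_add lookup_shift_up dest: spec[of _ "i + n"])
        then show False using False by (metis lookup_zero poly_mapping_eqI)
      qed
      then have "w + shift_up n v \<notin> keys f" using fp by (auto simp: polys_def)
      then show ?thesis using False by (simp add: lookup_coeff_in in_keys_iff lookup_single)
    qed (simp add: lookup_coeff_in)
  qed
  have s0: "single (0 :: monomial) c = 0 \<longleftrightarrow> c = 0" for c :: 'k
    by (metis lookup_single_eq lookup_zero single_zero)
  have "coeff_in n w f \<noteq> 0 \<longleftrightarrow> w \<in> keys f" if "w \<in> monomials n" for w
    unfolding ci[OF that] s0 by (simp add: in_keys_iff)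
  then have k: "keys (to_frac n f) = keys f"
    using fp unfolding keys_to_frac polys_def by blast
  have "const_poly (to_fract 1) * to_frac n f = to_frac n f" by (simp add: const_poly_def)
  then have "to_frac n f \<in> frac_ideal n (ideal_span I)"
    using ideal_span_base[OF f(1)] to_frac_polys unfolding frac_ideal_def
    by (intro CollectI conjI exI[of _ 1] exI[of _ f]) auto
  moreover have "to_frac n f \<noteq> 0" using to_frac_inject[of n f 0] f(2) by auto
  moreover have "lead (to_frac n f) = u" using f(3) k by (simp add: lead_def)
  ultimately show "u \<in> leads (frac_ideal n (ideal_span I))" by (force simp: leads_def)
qed

lemma to_frac_generic_form_homogeneous: "n \<le> j \<Longrightarrow> homogeneous 1 (to_frac n (generic_form n j :: 'k::field polynomial))"
proof -
  assume j: "n \<le> j"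
  have h1: "homogeneous 1 (to_frac n (single (single j i + var i) (1 :: 'k)))" if "i < n" for i
  proof -
    have "single j i = shift_up n (single (j - n) i)"
      using j by (intro poly_mapping_eqI) (auto simp: lookup_shift_up lookup_single when_def)
    then have "to_frac n (single (single j i + var i) (1 :: 'k)) = single (var i) (to_fract (single (single (j - n) i) 1))"
      using to_frac_single[of "var i" n "single (j - n) i" 1] that by (simp add: monomials_def add.commute)
    then show ?thesis by (auto simp: homogeneous_def)
  qed
  have "homogeneous 1 (\<Sum>i\<in>A. to_frac n (single (single j i + var i) (1 :: 'k)))" if "finite A" "A \<subseteq> {..<n}" for A
    using that by (induction A rule: finite_induct) (auto intro!: homogeneous_add h1[unfolded One_nat_def])
  from this[of "{..<n}"] show ?thesis by (simp add: generic_form_def to_frac_sum)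
qed

text \<open>Each generic form replaces the Hilbert function by its difference function. The
  statement uses iterated partial sums, the inverse operation, which avoids subtraction of natural
  numbers.\<close>

theorem regular_list_hilbert:
  fixes I :: "'k::field polynomial set"
  assumes I: "graded_ideal n I" and js: "\<forall>j\<in>set js. n \<le> j" and reg: "regular_list I (map (generic_form n) js)"
  shows "\<exists>V :: 'k polynomial fract polynomial set. graded_ideal n V \<and>
    card (std_monomials n V 0) = card (std_monomials n I 0) \<and>
    ((\<lambda>h q. \<Sum>p\<le>q. h p) ^^ length js) (\<lambda>q. card (std_monomials n V q)) = (\<lambda>q. card (std_monomials n I q))"
proof -
  let ?S = "\<lambda>h q. \<Sum>p\<le>q. h p :: nat"
  let ?V = "\<lambda>is. frac_ideal n (ideal_span (generic_form n ` set is \<union> I))"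
  have "graded_ideal n (?V is) \<and> card (std_monomials n (?V is) 0) = card (std_monomials n I 0) \<and>
     (?S ^^ length is) (\<lambda>q. card (std_monomials n (?V is) q)) = (\<lambda>q. card (std_monomials n I q))"
    if "\<forall>j\<in>set is. n \<le> j" "regular_list I (map (generic_form n) is)" for "is"
    using that
  proof (induction "is" rule: rev_induct)
    case Nil
    have "std_monomials n (frac_ideal n (ideal_span I)) q = std_monomials n I q" for q
      using leads_frac_ideal[OF graded_rel_ideal[OF I]] by (simp add: std_monomials_def)
    then show ?case using graded_frac_ideal[OF I] by simp
  next
    case (snoc j "is")
    let ?W = "?V is" and ?l = "to_frac n (generic_form n j)"
    have IH: "graded_ideal n ?W" "card (std_monomials n ?W 0) = card (std_monomials n I 0)"
        "(?S ^^ length is) (\<lambda>q. card (std_monomials n ?W q)) = (\<lambda>q. card (std_monomials n I q))"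
      and nz: "nonzerodiv (generic_form n j) (ideal_span (generic_form n ` set is \<union> I))"
      using snoc by (auto simp: regular_list_append)
    have Veq: "?V (is @ [j]) = add_form n ?l ?W"
      using frac_ideal_insert[of n "generic_form n j" "generic_form n ` set is \<union> I"] by simp
    have l: "?l \<in> polys n" "homogeneous 1 ?l" using to_frac_polys to_frac_generic_form_homogeneous snoc.prems by auto
    have rg: "g \<in> polys n \<Longrightarrow> ?l * g \<in> ?W \<Longrightarrow> g \<in> ?W" for g
      using frac_ideal_nonzerodiv[OF nz] by blast
    note c = card_std_add_form[OF IH(1) l rg]
    have "?S (\<lambda>q. card (std_monomials n (add_form n ?l ?W) q)) = (\<lambda>q. card (std_monomials n ?W q))"
    proof
      fix q
      show "?S (\<lambda>q. card (std_monomials n (add_form n ?l ?W) q)) q = card (std_monomials n ?W q)"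
        using c by (induction q) (auto simp: add.commute)
    qed
    then have "(?S ^^ length (is @ [j])) (\<lambda>q. card (std_monomials n (add_form n ?l ?W) q)) = (\<lambda>q. card (std_monomials n I q))"
      using IH(3) by (simp add: funpow_Suc_right del: funpow.simps)
    then show ?case using c(1) IH(2) add_form_graded[OF IH(1) l] unfolding Veq by simp
  qed
  then show ?thesis using js reg by blast
qed

section \<open>Ideals of the polynomial ring\<close>

lemma poly_ring_simps [simp]:
  "carrier (poly_ring n) = polys n" "f \<otimes>\<^bsub>poly_ring n\<^esub> g = f * g" "\<one>\<^bsub>poly_ring n\<^esub> = 1"
  "\<zero>\<^bsub>poly_ring n\<^esub> = 0" "f \<oplus>\<^bsub>poly_ring n\<^esub> g = f + g"
  by (simp_all add: poly_ring_def)

lemma ring_poly_ring: "ring (poly_ring n)"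
  using cring_poly_ring cring.axioms(1) by blast

lemma a_inv_poly_ring: "f \<in> polys n \<Longrightarrow> a_inv (poly_ring n) f = - f"
  by (rule abelian_group.minus_equality[OF ring.is_abelian_group[OF ring_poly_ring]])
     (use polys_closed(3) in auto)

lemma ideal_poly_ring_iff: "ideal I (poly_ring n) \<longleftrightarrow> rel_ideal n I"
proof
  assume "ideal I (poly_ring n)"
  then interpret J: ideal I "poly_ring n" .
  show "rel_ideal n I" unfolding rel_ideal_def
    using J.a_subset additive_subgroup.zero_closed[OF ideal.axioms(1)[OF J.ideal_axioms]]
      additive_subgroup.a_closed[OF ideal.axioms(1)[OF J.ideal_axioms]] J.I_l_closed by auto
next
  assume I: "rel_ideal n I"
  have neg: "- f \<in> I" if "f \<in> I" for f
  proof -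
    have "(- 1) * f \<in> I" using I that polys_closed(2,3) unfolding rel_ideal_def by blast
    then show ?thesis by simp
  qed
  show "ideal I (poly_ring n)"
  proof (rule idealI[OF ring_poly_ring])
    show "subgroup I (add_monoid (poly_ring n))"
    proof (rule subgroup.intro)
      fix f assume f: "f \<in> I"
      then have "f \<in> polys n" using I by (auto simp: rel_ideal_def)
      then have "inv\<^bsub>add_monoid (poly_ring n)\<^esub> f = - f" using a_inv_poly_ring by (simp add: a_inv_def)
      then show "inv\<^bsub>add_monoid (poly_ring n)\<^esub> f \<in> I" using neg[OF f] by simp
    qed (use I in \<open>auto simp: rel_ideal_def\<close>)
    show "x \<otimes>\<^bsub>poly_ring n\<^esub> f \<in> I" "f \<otimes>\<^bsub>poly_ring n\<^esub> x \<in> I"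
      if "f \<in> I" "x \<in> carrier (poly_ring n)" for f x
      using I that by (simp_all add: rel_ideal_def mult.commute[of f x])
  qed
qed

lemma rel_ideal_span: "X \<subseteq> polys n \<Longrightarrow> rel_ideal n (ideal_span X \<inter> polys n)"
  by (auto simp: rel_ideal_def polys_closed ideal_span_zero intro: ideal_span_add span_mult_left polys_closed)

text \<open>Contracting the ideal of the big ring to \<open>polys n\<close> adds nothing: setting
  the variables of index at least \<open>n\<close> to 0, that is, taking \<open>pslice\<close> at
  the monomial 0, maps the big ideal into the small one.\<close>

lemma genideal_poly_ring:
  assumes "X \<subseteq> polys n"
  shows "Idl\<^bsub>poly_ring n\<^esub> X = ideal_span X \<inter> polys n"
proof
  interpret R: ring "poly_ring n" by (rule ring_poly_ring)
  show "Idl\<^bsub>poly_ring n\<^esub> X \<subseteq> ideal_span X \<inter> polys n"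
    using assms ideal_span_base by (intro R.genideal_minimal) (auto simp: ideal_poly_ring_iff rel_ideal_span)
  have I: "rel_ideal n (Idl\<^bsub>poly_ring n\<^esub> X)" "X \<subseteq> Idl\<^bsub>poly_ring n\<^esub> X"
    using R.genideal_ideal[of X] R.genideal_self[of X] assms by (auto simp: ideal_poly_ring_iff)
  show "ideal_span X \<inter> polys n \<subseteq> Idl\<^bsub>poly_ring n\<^esub> X"
  proof
    fix f assume "f \<in> ideal_span X \<inter> polys n"
    then show "f \<in> Idl\<^bsub>poly_ring n\<^esub> X"
      using pslice_span_ideal[OF I, of 0 f] pslice_id[of f n] by auto
  qed
qed

lemma hcomp_below:
  assumes "homogeneous p f" "q < p" shows "hcomp q (f * g) = 0"
proof -
  have "p \<le> mdeg u" if u: "u \<in> keys (f * g)" for u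
  proof -
    obtain a b where "u = a + b" "a \<in> keys f" using keys_mult u by blast
    then show ?thesis using assms(1) by (simp add: homogeneous_def)
  qed
  then show ?thesis using assms(2)
    by (intro poly_mapping_eqI) (metis in_keys_iff lookup_hcomp lookup_zero not_le)
qed

lemma homogeneous_ideal_graded:
  assumes "homogeneous_ideal n I"
  shows "graded_ideal n I"
proof -
  obtain F where F: "F \<subseteq> polys n" "\<forall>f\<in>F. \<exists>q. homogeneous q f" "I = Idl\<^bsub>poly_ring n\<^esub> F"
    using assms by (auto simp: homogeneous_ideal_def)
  have I: "I = ideal_span F \<inter> polys n" using F genideal_poly_ring by simp
  have r: "rel_ideal n I" unfolding I by (rule rel_ideal_span[OF F(1)])
  have "hcomp q f \<in> ideal_span F" if "f \<in> ideal_span F" for f q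
    using that
  proof (induction rule: ideal_span_induct)
    case (step c x y)
    obtain p where p: "homogeneous p x" using F step(1) by blast
    have "hcomp q (c * x) \<in> ideal_span F"
    proof (cases "p \<le> q")
      case True
      then have "hcomp q (x * c) = x * hcomp (q - p) c"
        using hcomp_homogeneous_mult[OF p, of "q - p" c] by simp
      then show ?thesis using ideal_span_base[OF step(1)] span_mult_right by (simp add: mult.commute[of c x])
    next
      case False
      then show ?thesis using hcomp_below[OF p, of q c] by (simp add: mult.commute[of c x] ideal_span_zero)
    qed
    then show ?case using step(2) by (simp add: hcomp_add ideal_span_add)
  qed (simp add: ideal_span_zero)
  then have "hcomp q f \<in> I" if "f \<in> I" for f q using that hcomp_polys by (auto simp: I)
  then show ?thesis using r by (simp add: graded_ideal_def rel_ideal_def)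
qed

section \<open>The quotient ring\<close>

lemma quot_class_eq: "quot_class n I f = {h + f | h. h \<in> I}"
  by (auto simp: quot_class_def a_r_coset_def')

lemma rel_ideal_diff: "rel_ideal n I \<Longrightarrow> f \<in> I \<Longrightarrow> g \<in> I \<Longrightarrow> f - g \<in> I"
proof -
  assume a: "rel_ideal n I" "f \<in> I" "g \<in> I"
  then have "(- 1) * g \<in> I" using polys_closed(2,3) unfolding rel_ideal_def by blast
  then have "f + (- 1) * g \<in> I" using a unfolding rel_ideal_def by blast
  then show ?thesis by simp
qed

lemma quot_class_eq_iff:
  assumes "rel_ideal n I"
  shows "quot_class n I f = quot_class n I g \<longleftrightarrow> f - g \<in> I"
proof
  assume e: "quot_class n I f = quot_class n I g"
  have "f \<in> quot_class n I f"
    using assms unfolding quot_class_eq rel_ideal_def by (intro CollectI exI[of _ 0]) simp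
  then have "f \<in> quot_class n I g" by (simp only: e)
  then obtain h where "f = h + g" "h \<in> I" unfolding quot_class_eq by blast
  then show "f - g \<in> I" by simp
next
  assume d: "f - g \<in> I"
  show "quot_class n I f = quot_class n I g"
  proof (intro equalityI subsetI)
    fix x assume "x \<in> quot_class n I f"
    then obtain h where h: "x = h + f" "h \<in> I" by (auto simp: quot_class_eq)
    have "x = (h + (f - g)) + g" by (simp add: h)
    moreover have "h + (f - g) \<in> I" using h d assms by (simp add: rel_ideal_def)
    ultimately show "x \<in> quot_class n I g" unfolding quot_class_eq by blast
  next
    fix x assume "x \<in> quot_class n I g"
    then obtain h where h: "x = h + g" "h \<in> I" by (auto simp: quot_class_eq)
    have "x = (h - (f - g)) + f" by (simp add: h)
    moreover have "h - (f - g) \<in> I" by (rule rel_ideal_diff[OF assms h(2) d])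
    ultimately show "x \<in> quot_class n I f" unfolding quot_class_eq by blast
  qed
qed

context
  fixes n :: nat and I :: "'k::field polynomial set"
  assumes I: "rel_ideal n I"
begin

abbreviation (input) "Q \<equiv> poly_ring n Quot I"
abbreviation (input) "cl \<equiv> quot_class n I"

lemma ideal_I: "ideal I (poly_ring n)"
  using I by (simp add: ideal_poly_ring_iff)

lemma ring_hom_cl: "ring_hom_ring (poly_ring n) Q cl"
  using ideal.rcos_ring_hom_ring[OF ideal_I] by (simp add: quot_class_def[abs_def])

lemma carrier_Q: "carrier Q = cl ` polys n"
  unfolding FactRing_def A_RCOSETS_def' quot_class_def by auto

lemma cl_mult: "f \<in> polys n \<Longrightarrow> g \<in> polys n \<Longrightarrow> cl f \<otimes>\<^bsub>Q\<^esub> cl g = cl (f * g)"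
  using ring_hom_ring.homh[OF ring_hom_cl] ring_hom_mult by fastforce

lemma cl_add: "f \<in> polys n \<Longrightarrow> g \<in> polys n \<Longrightarrow> cl f \<oplus>\<^bsub>Q\<^esub> cl g = cl (f + g)"
  using ring_hom_ring.homh[OF ring_hom_cl] ring_hom_add by fastforce

lemma cl_one: "\<one>\<^bsub>Q\<^esub> = cl 1"
  using ring_hom_one[OF ring_hom_ring.homh[OF ring_hom_cl]] by simp

lemma cl_zero: "\<zero>\<^bsub>Q\<^esub> = cl 0"
proof -
  interpret H: ring_hom_ring "poly_ring n" Q cl by (rule ring_hom_cl)
  show ?thesis using H.hom_zero by simp
qed

lemma subfield_const: "subfield (range const_poly) (poly_ring n :: 'k polynomial ring)"
proof -
  interpret R: ring "poly_ring n :: 'k polynomial ring" by (rule ring_poly_ring)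
  have add: "const_poly a + const_poly b = const_poly (a + b)" for a b :: 'k
    by (simp add: const_poly_def single_add)
  have one: "(1 :: 'k polynomial) = const_poly 1" by (simp add: const_poly_def)
  have zero: "(0 :: 'k polynomial) = const_poly 0" by (simp add: const_poly_def)
  have sr: "subring (range const_poly) (poly_ring n :: 'k polynomial ring)"
  proof (rule R.subringI)
    show "range const_poly \<subseteq> carrier (poly_ring n :: 'k polynomial ring)" using const_polys by auto
    show "\<one>\<^bsub>poly_ring n\<^esub> \<in> range (const_poly :: 'k \<Rightarrow> _)" using one by simp
    fix f assume "f \<in> range (const_poly :: 'k \<Rightarrow> _)"
    then obtain a where a: "f = const_poly a" by auto
    have "- f = const_poly (- a)" by (simp add: a const_poly_def single_uminus)
    then show "\<ominus>\<^bsub>poly_ring n\<^esub> f \<in> range const_poly" using a a_inv_poly_ring[of f n] const_polys by auto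
    fix g assume "g \<in> range (const_poly :: 'k \<Rightarrow> _)"
    then obtain b where b: "g = const_poly b" by auto
    show "f \<otimes>\<^bsub>poly_ring n\<^esub> g \<in> range const_poly" by (simp add: a b const_poly_mult[symmetric])
    show "f \<oplus>\<^bsub>poly_ring n\<^esub> g \<in> range const_poly" by (simp add: a b add)
  qed
  show ?thesis
  proof (rule R.subfieldI)
    show "subcring (range const_poly) (poly_ring n :: 'k polynomial ring)"
      by (rule R.subcringI[OF sr]) (simp add: mult.commute)
    show "Units ((poly_ring n :: 'k polynomial ring)\<lparr>carrier := range const_poly\<rparr>) = range const_poly - {\<zero>\<^bsub>poly_ring n\<^esub>}"
    proof (intro equalityI subsetI)
      fix f assume "f \<in> range (const_poly :: 'k \<Rightarrow> _) - {\<zero>\<^bsub>poly_ring n\<^esub>}"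
      then obtain a where a: "f = const_poly a" "a \<noteq> 0" by (auto simp: zero)
      have "const_poly (inverse a) * const_poly a = (1 :: 'k polynomial)"
        "const_poly a * const_poly (inverse a) = (1 :: 'k polynomial)"
        using a(2) by (simp_all add: const_poly_mult[symmetric] one)
      then show "f \<in> Units ((poly_ring n :: 'k polynomial ring)\<lparr>carrier := range const_poly\<rparr>)"
        using a(1) by (auto simp: Units_def)
    qed (auto simp: Units_def)
  qed
qed

lemma subfield_Q: "1 \<notin> I \<Longrightarrow> subfield (cl ` range const_poly) Q"
  using ring_hom_ring.img_is_subfield(2)[OF ring_hom_cl subfield_const]
    quot_class_eq_iff[OF I, of 1 0] by (simp add: cl_one cl_zero)

lemma ring_Q: "ring Q"
  by (rule ideal.quotient_is_ring[OF ideal_I])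

lemma line_extension_cl:
  assumes "v \<in> polys n" "E \<subseteq> polys n"
  shows "ring.line_extension Q (cl ` range const_poly) (cl v) (cl ` E) =
    cl ` {const_poly c * v + f | c f. f \<in> E}"
proof -
  have "ring.line_extension Q (cl ` range const_poly) (cl v) (cl ` E) =
      {cl (const_poly c) \<otimes>\<^bsub>Q\<^esub> cl v \<oplus>\<^bsub>Q\<^esub> cl f | c f. f \<in> E}"
    unfolding ring.line_extension_def[OF ring_Q] set_add_def' r_coset_def by auto
  also have "\<dots> = {cl (const_poly c * v + f) | c f. f \<in> E}"
    using assms by (intro Collect_cong ex_cong1) (metis cl_add cl_mult const_polys polys_closed(5) subsetD)
  finally show ?thesis by auto
qed

text \<open>The chain of line extensions adjoins one standard monomial at a time; a class that was
  already present would give a nonzero element of \<open>I\<close> supported on standard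
  monomials.\<close>

lemma dimension_std:
  assumes gr: "graded_ideal n I" and T: "finite T" "T \<subseteq> std_monomials n I q"
  shows "ring.dimension Q (card T) (cl ` range const_poly) (cl ` {f. keys f \<subseteq> T})"
  using T
proof (induction T rule: finite_induct)
  case empty
  have "{f :: 'k polynomial. keys f \<subseteq> {}} = {0}" by auto
  then show ?case using ring.zero_dim[OF ring_Q] by (simp add: cl_zero)
next
  case (insert v T)
  have vm: "v \<in> monomials n" "T \<subseteq> monomials n" using insert.prems by (auto simp: std_monomials_def in_mons_iff)
  have vp: "single v (1 :: 'k) \<in> polys n" using vm by (simp add: polys_def)
  have Tp: "{f :: 'k polynomial. keys f \<subseteq> T} \<subseteq> polys n" using vm by (auto simp: polys_def)
  have nin: "cl (single v 1) \<notin> cl ` {f. keys f \<subseteq> T}"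
  proof
    assume "cl (single v 1) \<in> cl ` {f. keys f \<subseteq> T}"
    then obtain f where f: "keys f \<subseteq> T" "single v 1 - f \<in> I" using quot_class_eq_iff[OF I] by auto
    have "keys (single v 1 - f) \<subseteq> insert v T"
      using f(1) by (auto simp: in_keys_iff lookup_minus lookup_single when_def split: if_splits)
    then have "single v 1 - f = 0" using insert.prems std_zero[OF f(2)] by blast
    then have "v \<in> keys f" by (metis eq_iff_diff_eq_0 insertI1 keys_single zero_neq_one)
    then show False using f(1) insert.hyps by auto
  qed
  have "{const_poly c * single v 1 + f | c f. keys f \<subseteq> T} = {f :: 'k polynomial. keys f \<subseteq> insert v T}"
  proof (intro equalityI subsetI)
    fix h :: "'k polynomial" assume "h \<in> {const_poly c * single v 1 + f | c f. keys f \<subseteq> T}"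
    then obtain c f where "h = const_poly c * single v 1 + f" "keys f \<subseteq> T" by blast
    then show "h \<in> {f. keys f \<subseteq> insert v T}"
      by (auto simp: in_keys_iff lookup_add lookup_const_mult lookup_single when_def split: if_splits)
  next
    fix h :: "'k polynomial" assume h: "h \<in> {f. keys f \<subseteq> insert v T}"
    define f where "f = h - const_poly (lookup h v) * single v 1"
    have "keys f \<subseteq> T"
    proof
      fix u assume "u \<in> keys f"
      then have "lookup f u \<noteq> 0" by (simp add: in_keys_iff)
      then have "u \<noteq> v \<and> lookup h u \<noteq> 0"
        by (auto simp: f_def lookup_minus lookup_const_mult lookup_single when_def split: if_splits)
      then show "u \<in> T" using h by (auto simp: in_keys_iff)
    qed
    moreover have "h = const_poly (lookup h v) * single v 1 + f" by (simp add: f_def)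
    ultimately show "h \<in> {const_poly c * single v 1 + f | c f. keys f \<subseteq> T}" by blast
  qed
  then have "ring.line_extension Q (cl ` range const_poly) (cl (single v 1)) (cl ` {f. keys f \<subseteq> T})
      = cl ` {f. keys f \<subseteq> insert v T}"
    using line_extension_cl[OF vp Tp] by simp
  moreover have "cl (single v 1) \<in> carrier Q" using vp carrier_Q by blast
  ultimately show ?case
    using ring.Suc_dim[OF ring_Q _ nin insert.IH] insert by simp
qed

lemma hilbert_function_eq_card_std:
  assumes gr: "graded_ideal n I" and one: "1 \<notin> I"
  shows "hilbert_function n I q = card (std_monomials n I q)"
proof -
  have "cl ` {f \<in> polys n. homogeneous q f} = cl ` {f. keys f \<subseteq> std_monomials n I q}"
  proof (intro equalityI subsetI)
    fix x assume "x \<in> cl ` {f \<in> polys n. homogeneous q f}"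
    then obtain f where f: "x = cl f" "f \<in> polys n" "homogeneous q f" by auto
    then obtain g where g: "keys g \<subseteq> std_monomials n I q" "f - g \<in> degree_part I q" using std_reduce[OF gr] by blast
    then have "cl f = cl g" using quot_class_eq_iff[OF I] by (simp add: degree_part_def)
    then show "x \<in> cl ` {f. keys f \<subseteq> std_monomials n I q}" using f g by auto
  next
    fix x assume "x \<in> cl ` {f. keys f \<subseteq> std_monomials n I q}"
    then obtain f where f: "x = cl f" "keys f \<subseteq> mons {..<n} q" by (auto simp: std_monomials_def)
    then have "f \<in> polys n" "homogeneous q f" by (auto simp: polys_def homogeneous_def in_mons_iff)
    then show "x \<in> cl ` {f \<in> polys n. homogeneous q f}" using f(1) by blast
  qed
  moreover have "finite (std_monomials n I q)" by (simp add: std_monomials_def)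
  ultimately show ?thesis unfolding hilbert_function_def
    using ring.dimI[OF ring_Q subfield_Q[OF one] dimension_std[OF gr _ order_refl]] by (simp add: over_def)
qed

text \<open>This excludes \<open>I = A\<close> by means of \<open>H 0 = 1\<close>. The scalars
  collapse to a single class and form no subfield, so the dimension is evaluated from its
  definition.\<close>

lemma hilbert_function_trivial:
  assumes one: "1 \<in> I"
  shows "hilbert_function n I 0 = 0"
proof -
  have Ip: "I = polys n"
  proof
    show "polys n \<subseteq> I"
    proof
      fix f :: "'k polynomial" assume "f \<in> polys n"
      then have "f * 1 \<in> I" using I one unfolding rel_ideal_def by blast
      then show "f \<in> I" by simp
    qed
  qed (use I in \<open>auto simp: rel_ideal_def\<close>)
  have cl0: "cl f = \<zero>\<^bsub>Q\<^esub>" if "f \<in> polys n" for f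
  proof -
    have "f - 0 \<in> I" using that Ip by simp
    then have "cl f = cl 0" using quot_class_eq_iff[OF I] by blast
    then show ?thesis by (simp only: cl_zero)
  qed
  have K: "cl ` range const_poly = {\<zero>\<^bsub>Q\<^esub>}" using cl0 const_polys by auto
  have "0 \<in> {f \<in> polys n. homogeneous 0 f}" using polys_closed(1) by simp
  then have E: "cl ` {f \<in> polys n. homogeneous 0 f} = {\<zero>\<^bsub>Q\<^esub>}" using cl0 by auto
  have C: "carrier Q = {\<zero>\<^bsub>Q\<^esub>}" using cl0 polys_closed(1) unfolding carrier_Q by auto
  \<comment> \<open>In the zero ring no element lies outside the current subspace, so no line
    extension can occur.\<close>
  have "m = 0 \<and> E = {\<zero>\<^bsub>Q\<^esub>}" if "ring.dimension Q m F E" for m F E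
    using that by (induction rule: ring.dimension.induct[OF ring_Q, consumes 1]) (use C in auto)
  then have nz: "m = 0" if "ring.dimension Q m F E" for m F E using that by blast
  have "ring.dim Q {\<zero>\<^bsub>Q\<^esub>} {\<zero>\<^bsub>Q\<^esub>} = 0"
    unfolding ring.dim_def[OF ring_Q] using nz ring.zero_dim[OF ring_Q] by (intro the_equality) auto
  then show ?thesis unfolding hilbert_function_def K E .
qed

end

section \<open>Depth\<close>

lemma regular_list_nth:
  "regular_list S gs \<longleftrightarrow> (\<forall>i<length gs. nonzerodiv (gs ! i) (ideal_span (S \<union> set (take i gs))))"
proof (induction gs arbitrary: S)
  case (Cons g gs)
  have "(\<forall>i<length (g # gs). nonzerodiv ((g # gs) ! i) (ideal_span (S \<union> set (take i (g # gs))))) \<longleftrightarrow>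
      nonzerodiv g (ideal_span S) \<and> (\<forall>i<length gs. nonzerodiv (gs ! i) (ideal_span (insert g S \<union> set (take i gs))))"
    by (simp add: All_less_Suc2)
  then show ?case using Cons.IH by simp
qed simp

text \<open>Regularity in \<open>K[x_1,...,x_n]\<close> survives the adjunction of all further
  variables, because membership can be checked on coefficients with respect to these and
  \<open>f\<close> is constant in them.\<close>

lemma nonzerodiv_iff_polys:
  fixes X :: "'k::field polynomial set"
  assumes f: "f \<in> polys n" and X: "X \<subseteq> polys n"
  shows "nonzerodiv f (ideal_span X) \<longleftrightarrow> (\<forall>g\<in>polys n. f * g \<in> ideal_span X \<longrightarrow> g \<in> ideal_span X)"
proof
  assume a: "\<forall>g\<in>polys n. f * g \<in> ideal_span X \<longrightarrow> g \<in> ideal_span X"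
  have disj: "{n..} \<inter> {..<n} = {}" by auto
  have fr: "\<forall>p\<in>X. free_of {n..} p" "free_of {n..} f"
    using X f free_of_polys[OF _ disj] by auto
  show "nonzerodiv f (ideal_span X)" unfolding nonzerodiv_def
  proof (intro allI impI)
    fix g assume g: "f * g \<in> ideal_span X"
    show "g \<in> ideal_span X"
    proof (rule span_if_pslices[of "{n..}"])
      fix b :: monomial assume b: "keys b \<subseteq> {n..}"
      have "f * pslice {n..} b g \<in> ideal_span X"
        using pslice_span[OF b fr(1) g] pslice_mult[OF b fr(2), of g] by simp
      then show "pslice {n..} b g \<in> ideal_span X" using a pslice_polys by blast
    qed
  qed
qed (simp add: nonzerodiv_def)

lemma genideal_Q:
  fixes I :: "'k::field polynomial set"
  assumes I: "rel_ideal n I" and S: "S \<subseteq> polys n" and g: "g \<in> polys n"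
  shows "quot_class n I g \<in> Idl\<^bsub>poly_ring n Quot I\<^esub> (quot_class n I ` S) \<longleftrightarrow> g \<in> ideal_span (I \<union> S)"
proof -
  let ?cl = "quot_class n I" and ?Q = "poly_ring n Quot I"
  interpret R: ring "poly_ring n :: 'k polynomial ring" by (rule ring_poly_ring)
  interpret Q: ring ?Q by (rule ring_Q[OF I])
  interpret H: ring_hom_ring "poly_ring n" ?Q ?cl by (rule ring_hom_cl[OF I])
  have Ip: "I \<subseteq> polys n" using I by (simp add: rel_ideal_def)
  define J where "J = ideal_span (I \<union> S) \<inter> polys n"
  have J: "rel_ideal n J" unfolding J_def using Ip S by (intro rel_ideal_span) auto
  have sub: "?cl ` S \<subseteq> carrier ?Q" using S carrier_Q[OF I] by auto
  show ?thesis
  proof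
    assume a: "?cl g \<in> Idl\<^bsub>?Q\<^esub> (?cl ` S)"
    have "ideal ((+>\<^bsub>poly_ring n\<^esub>) I ` J) ?Q"
      using R.ring_ideal_imp_quot_ideal[of I J] I J by (simp add: ideal_poly_ring_iff)
    then have "ideal (?cl ` J) ?Q" by (simp add: quot_class_def[abs_def])
    moreover have "?cl ` S \<subseteq> ?cl ` J" using S ideal_span_base unfolding J_def by blast
    ultimately have "?cl g \<in> ?cl ` J" using Q.genideal_minimal a by blast
    then obtain j where j: "j \<in> J" "g - j \<in> I" using quot_class_eq_iff[OF I] by auto
    have "(g - j) + j \<in> ideal_span (I \<union> S)"
      using j ideal_span_base[of "g - j" "I \<union> S"] by (intro ideal_span_add) (auto simp: J_def)
    then show "g \<in> ideal_span (I \<union> S)" by simp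
  next
    assume a: "g \<in> ideal_span (I \<union> S)"
    let ?K = "{r \<in> carrier (poly_ring n). ?cl r \<in> Idl\<^bsub>?Q\<^esub> (?cl ` S)}"
    have "ideal ?K (poly_ring n)" by (rule H.ideal_vimage[OF Q.genideal_ideal[OF sub]])
    moreover have "I \<union> S \<subseteq> ?K"
    proof
      fix f assume f: "f \<in> I \<union> S"
      then have fp: "f \<in> polys n" using Ip S by auto
      show "f \<in> ?K"
      proof (cases "f \<in> S")
        case True
        then show ?thesis using fp Q.genideal_self[OF sub] by auto
      next
        case False
        then have "f - 0 \<in> I" using f by simp
        then have "?cl f = ?cl 0" using quot_class_eq_iff[OF I] by blast
        then have "?cl f = \<zero>\<^bsub>?Q\<^esub>" by (simp only: cl_zero[OF I])
        then show ?thesis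
          using fp additive_subgroup.zero_closed[OF ideal.axioms(1)[OF Q.genideal_ideal[OF sub]]] by simp
      qed
    qed
    ultimately have "Idl\<^bsub>poly_ring n\<^esub> (I \<union> S) \<subseteq> ?K" by (intro R.genideal_minimal)
    then show "?cl g \<in> Idl\<^bsub>?Q\<^esub> (?cl ` S)"
      using a g genideal_poly_ring[of "I \<union> S" n] Ip S by auto
  qed
qed

abbreviation "irrelevant n \<equiv> ideal_span (indet ` {..<n})"

lemma indet_polys: "i < n \<Longrightarrow> indet i \<in> polys n"
  by (auto simp: indet_def monomial_poly_def polys_def monomials_def)

lemma genideal_indets: "Idl\<^bsub>poly_ring n\<^esub> (indet ` {..<n}) = irrelevant n \<inter> polys n"
  using indet_polys by (intro genideal_poly_ring) auto

text \<open>Translation from the quotient ring to lists of polynomials. Properness, which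
  \<open>regular_list\<close> does not include, appears as the condition on 1.\<close>

lemma regular_sequence_iff:
  fixes I :: "'k::field polynomial set"
  assumes I: "rel_ideal n I" and gs: "set gs \<subseteq> polys n"
  shows "regular_sequence (poly_ring n Quot I) (map (quot_class n I) gs) \<longleftrightarrow>
    regular_list I gs \<and> 1 \<notin> ideal_span (I \<union> set gs)"
proof -
  let ?cl = "quot_class n I" and ?Q = "poly_ring n Quot I"
  have Ip: "I \<subseteq> polys n" using I by (simp add: rel_ideal_def)
  interpret Q: ring ?Q by (rule ring_Q[OF I])
  have car: "?cl ` set gs \<subseteq> carrier ?Q" using gs carrier_Q[OF I] by auto
  have tk: "set (take i gs) \<subseteq> polys n" for i using gs set_take_subset[of i gs] by blast
  have "(\<forall>g\<in>carrier ?Q. map ?cl gs ! i \<otimes>\<^bsub>?Q\<^esub> g \<in> Idl\<^bsub>?Q\<^esub> (set (take i (map ?cl gs))) \<longrightarrow>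
      g \<in> Idl\<^bsub>?Q\<^esub> (set (take i (map ?cl gs)))) \<longleftrightarrow>
      nonzerodiv (gs ! i) (ideal_span (I \<union> set (take i gs)))" if i: "i < length gs" for i
  proof -
    have gi: "gs ! i \<in> polys n" using gs i by auto
    have m: "?cl (gs ! i) \<otimes>\<^bsub>?Q\<^esub> ?cl g \<in> Idl\<^bsub>?Q\<^esub> (?cl ` set (take i gs)) \<longleftrightarrow>
        gs ! i * g \<in> ideal_span (I \<union> set (take i gs))" if "g \<in> polys n" for g
      using genideal_Q[OF I tk polys_closed(5)[OF gi that]] cl_mult[OF I gi that] by simp
    have st: "set (take i (map ?cl gs)) = ?cl ` set (take i gs)" by (simp add: take_map)
    show ?thesis
      unfolding st carrier_Q[OF I] nonzerodiv_iff_polys[OF gi Un_least[OF Ip tk]]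
      using i m genideal_Q[OF I tk, of _ i] by simp
  qed
  moreover have "Idl\<^bsub>?Q\<^esub> (set (map ?cl gs)) \<noteq> carrier ?Q \<longleftrightarrow> 1 \<notin> ideal_span (I \<union> set gs)"
  proof -
    have id: "ideal (Idl\<^bsub>?Q\<^esub> (?cl ` set gs)) ?Q" by (rule Q.genideal_ideal[OF car])
    have "Idl\<^bsub>?Q\<^esub> (?cl ` set gs) = carrier ?Q \<longleftrightarrow> \<one>\<^bsub>?Q\<^esub> \<in> Idl\<^bsub>?Q\<^esub> (?cl ` set gs)"
      using ideal.one_imp_carrier[OF id] by auto
    then show ?thesis using genideal_Q[OF I gs polys_closed(2)] by (simp add: cl_one[OF I])
  qed
  ultimately show ?thesis unfolding regular_sequence_def regular_list_nth using car by auto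
qed

lemma regular_list_take: "regular_list S gs \<Longrightarrow> regular_list S (take i gs)"
  using regular_list_append[of S "take i gs" "drop i gs"] by simp

lemma regular_sequence_lift:
  fixes I :: "'k::field polynomial set"
  assumes I: "rel_ideal n I"
    and fs: "set fs \<subseteq> quot_class n I ` (Idl\<^bsub>poly_ring n\<^esub> (indet ` {..<n}))"
      "regular_sequence (poly_ring n Quot I) fs" and r: "r \<le> length fs"
  shows "\<exists>gs. length gs = r \<and> set gs \<subseteq> polys n \<and> set gs \<subseteq> irrelevant n \<and> regular_list I gs"
proof -
  have "\<exists>gs. fs = map (quot_class n I) gs \<and> set gs \<subseteq> irrelevant n \<inter> polys n"
    using fs(1) unfolding genideal_indets
  proof (induction fs)
    case (Cons f fs)
    then obtain gs g where "fs = map (quot_class n I) gs" "set gs \<subseteq> irrelevant n \<inter> polys n"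
      "f = quot_class n I g" "g \<in> irrelevant n \<inter> polys n" by auto
    then show ?case by (intro exI[of _ "g # gs"]) auto
  qed simp
  then obtain gs where gs: "fs = map (quot_class n I) gs" "set gs \<subseteq> irrelevant n \<inter> polys n" by blast
  then have "regular_list I gs" using fs(2) regular_sequence_iff[OF I, of gs] by auto
  then have "regular_list I (take r gs)" by (rule regular_list_take)
  moreover have "set (take r gs) \<subseteq> set gs" by (rule set_take_subset)
  ultimately show ?thesis using gs r by (intro exI[of _ "take r gs"]) auto
qed

text \<open>Depth is a supremum in \<open>enat\<close>: if all regular sequences in the irrelevant
  ideal were shorter than \<open>r\<close>, it would be at most \<open>r - 1\<close>. The truncated
  \<open>r - 1\<close> is why \<open>r = 0\<close> is separated.\<close>

lemma depth_regular_list: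
  fixes I :: "'k::field polynomial set"
  assumes I: "rel_ideal n I" and d: "depth n I = enat b" and r: "r \<le> b"
  shows "\<exists>gs. length gs = r \<and> set gs \<subseteq> polys n \<and> set gs \<subseteq> irrelevant n \<and> regular_list I gs"
proof (cases "r = 0")
  case False
  let ?A = "{fs. set fs \<subseteq> quot_class n I ` (Idl\<^bsub>poly_ring n\<^esub> (indet ` {..<n})) \<and>
    regular_sequence (poly_ring n Quot I) fs}"
  have "\<exists>fs\<in>?A. r \<le> length fs"
  proof (rule ccontr)
    assume "\<not> ?thesis"
    then have "length fs \<le> r - 1" if "fs \<in> ?A" for fs using that by force
    then have "(SUP fs\<in>?A. enat (length fs)) \<le> enat (r - 1)" by (intro SUP_least) simp
    then show False using d r False by (simp add: depth_def ring_depth_def)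
  qed
  then show ?thesis using regular_sequence_lift[OF I] by blast
qed auto

text \<open>Only lists longer by exactly one have to be excluded, since initial segments of regular
  lists are regular.\<close>

lemma depth_eqI:
  fixes I :: "'k::field polynomial set"
  assumes I: "rel_ideal n I" and gs: "set gs \<subseteq> polys n" "set gs \<subseteq> irrelevant n" "regular_list I gs"
    and one: "1 \<notin> ideal_span (I \<union> set gs)"
    and max: "\<And>hs. length hs = Suc (length gs) \<Longrightarrow> set hs \<subseteq> polys n \<Longrightarrow> set hs \<subseteq> irrelevant n \<Longrightarrow>
      \<not> regular_list I hs"
  shows "depth n I = enat (length gs)"
  unfolding depth_def ring_depth_def
proof (rule antisym)
  let ?A = "{fs. set fs \<subseteq> quot_class n I ` (Idl\<^bsub>poly_ring n\<^esub> (indet ` {..<n})) \<and>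
    regular_sequence (poly_ring n Quot I) fs}"
  show "(SUP fs\<in>?A. enat (length fs)) \<le> enat (length gs)"
  proof (rule SUP_least)
    fix fs assume fs: "fs \<in> ?A"
    have "\<not> Suc (length gs) \<le> length fs"
    proof
      assume "Suc (length gs) \<le> length fs"
      then show False using regular_sequence_lift[OF I, of fs "Suc (length gs)"] fs max by blast
    qed
    then show "enat (length fs) \<le> enat (length gs)" by simp
  qed
  have "map (quot_class n I) gs \<in> ?A"
    using regular_sequence_iff[OF I gs(1)] gs one by (auto simp: genideal_indets)
  then show "enat (length gs) \<le> (SUP fs\<in>?A. enat (length fs))"
    using SUP_upper[of "map (quot_class n I) gs" ?A "\<lambda>fs. enat (length fs)"] by simp
qed

section \<open>Monomial ideals\<close>

definition monomial_span :: "nat \<Rightarrow> (monomial \<Rightarrow> bool) \<Rightarrow> 'k::field polynomial set" where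
  "monomial_span N P = {f \<in> polys N. \<forall>u\<in>keys f. P u}"

definition up_closed :: "(monomial \<Rightarrow> bool) \<Rightarrow> bool" where
  "up_closed P \<longleftrightarrow> (\<forall>u v. P u \<longrightarrow> P (v + u))"

lemma monomial_span_graded:
  assumes "up_closed P"
  shows "graded_ideal N (monomial_span N P)"
  unfolding graded_ideal_def
proof (intro conjI ballI allI)
  show "monomial_span N P \<subseteq> polys N" "0 \<in> monomial_span N P"
    by (auto simp: monomial_span_def polys_closed)
  fix f :: "'a polynomial" assume f: "f \<in> monomial_span N P"
  show "f + g \<in> monomial_span N P" if "g \<in> monomial_span N P" for g
    using f that Poly_Mapping.keys_add[of f g] by (auto simp: monomial_span_def polys_closed)
  show "hcomp q f \<in> monomial_span N P" for q
    using f by (auto simp: monomial_span_def keys_hcomp hcomp_polys)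
next
  fix f g :: "'a polynomial" assume fg: "f \<in> polys N" "g \<in> monomial_span N P"
  have "P u" if u: "u \<in> keys (f * g)" for u
  proof -
    obtain a b where "u = a + b" "b \<in> keys g" using keys_mult u by blast
    then show ?thesis using fg assms by (auto simp: monomial_span_def up_closed_def)
  qed
  then show "f * g \<in> monomial_span N P" using fg by (auto simp: monomial_span_def polys_closed)
qed

lemma single_in_monomial_span: "c \<noteq> 0 \<Longrightarrow> single u c \<in> monomial_span N P \<longleftrightarrow> u \<in> monomials N \<and> P u"
  by (simp add: monomial_span_def polys_def)

lemma leads_monomial_span: "leads (monomial_span N P :: 'k::field polynomial set) = {u \<in> monomials N. P u}"
proof (intro equalityI subsetI)
  fix u assume "u \<in> leads (monomial_span N P :: 'k polynomial set)"
  then obtain f :: "'k polynomial" where f: "f \<in> monomial_span N P" "f \<noteq> 0" "u = lead f" by (auto simp: leads_def)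
  then have "u \<in> keys f" using lead_in_keys by blast
  then show "u \<in> {u \<in> monomials N. P u}" using f(1) by (auto simp: monomial_span_def polys_def)
next
  fix u assume "u \<in> {u \<in> monomials N. P u}"
  then have "single u (1 :: 'k) \<in> monomial_span N P" by (simp add: single_in_monomial_span)
  moreover have "lead (single u (1 :: 'k)) = u" by (simp add: lead_def)
  moreover have "single u (1 :: 'k) \<noteq> 0" by (metis keys_single keys_zero insert_not_empty zero_neq_one)
  ultimately show "u \<in> leads (monomial_span N P :: 'k polynomial set)" unfolding leads_def by force
qed

lemma monomial_span_eq_span:
  fixes X :: "'k::field polynomial set"
  assumes P: "up_closed P" and X: "X \<subseteq> monomial_span N P"
    and gen: "\<And>u. u \<in> monomials N \<Longrightarrow> P u \<Longrightarrow> single u 1 \<in> ideal_span X"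
  shows "ideal_span X \<inter> polys N = monomial_span N P"
proof (intro equalityI subsetI)
  fix f assume "f \<in> ideal_span X \<inter> polys N"
  then show "f \<in> monomial_span N P"
    using pslice_span_ideal[OF graded_rel_ideal[OF monomial_span_graded[OF P]] X, of 0 f] pslice_id[of f N]
    by auto
next
  fix f :: "'k polynomial" assume f: "f \<in> monomial_span N P"
  have "single u (lookup f u) \<in> ideal_span X" if "u \<in> keys f" for u
  proof -
    have "u \<in> monomials N" "P u" using f that by (auto simp: monomial_span_def polys_def)
    then have "single 0 (lookup f u) * single u 1 \<in> ideal_span X" by (intro span_mult_left gen)
    then show ?thesis by (simp add: mult_single)
  qed
  then have "(\<Sum>u\<in>keys f. single u (lookup f u)) \<in> ideal_span X" by (intro ideal_span_sum)
  then show "f \<in> ideal_span X \<inter> polys N" using f poly_sum_singles[of f] by (simp add: monomial_span_def)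
qed

section \<open>Cylinders over order ideals\<close>

text \<open>For an order ideal \<open>W\<close> in \<open>c \<le> N\<close> variables,
  \<open>monomial_span N (non_member c W)\<close> is the extension to \<open>N\<close> variables of
  the monomial ideal whose standard monomials form \<open>W\<close>; the variables from index
  \<open>c\<close> on are free.\<close>

abbreviation non_member :: "nat \<Rightarrow> monomial set \<Rightarrow> monomial \<Rightarrow> bool" where
  "non_member c W \<equiv> \<lambda>u. restr {..<c} u \<notin> W"

lemma order_ideal_down: "order_ideal c W \<Longrightarrow> v + u \<in> W \<Longrightarrow> u \<in> W"
proof (induction "mdeg v" arbitrary: v)
  case 0
  then show ?case by (simp add: mdeg_eq_0_iff)
next
  case (Suc d)
  have "keys v \<noteq> {}" using Suc.hyps(2) by (auto simp: mdeg_def)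
  then obtain i w where w: "v = w + var i" using monomial_split_var by blast
  have "(w + u) + var i \<in> W" using Suc.prems(2) by (simp add: w ac_simps)
  then have "w + u \<in> W" using Suc.prems(1) unfolding order_ideal_def by blast
  moreover have "d = mdeg w" using Suc.hyps(2) w by simp
  ultimately show ?case using Suc.hyps(1) Suc.prems(1) by blast
qed

lemma up_closed_non_member: "order_ideal c W \<Longrightarrow> up_closed (non_member c W)"
  unfolding up_closed_def using order_ideal_down by (auto simp: restr_add)

lemma restr_monomials: "restr {..<c} u \<in> monomials c"
  by (simp add: monomials_def keys_restr)

lemma monomials_add: "u \<in> monomials c \<Longrightarrow> v \<in> monomials c \<Longrightarrow> u + v \<in> monomials c"
  by (auto simp: monomials_def keys_add_nat)

lemma restr_id_monomials: "u \<in> monomials c \<Longrightarrow> restr {..<c} u = u"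
  by (simp add: monomials_def restr_id)

lemma monomials_mono: "c \<le> N \<Longrightarrow> monomials c \<subseteq> monomials N"
  by (auto simp: monomials_def)

text \<open>\<open>X\<close> may be any set between the generating monomials and the ideal, so the
  lemma covers both a monomial generating set and the extension of the ideal from fewer
  variables.\<close>

lemma monomial_span_cylinder:
  fixes X :: "'k::field polynomial set"
  assumes W: "order_ideal c W" and cN: "c \<le> N"
    and X: "monomial_poly ` {u \<in> monomials c. u \<notin> W} \<subseteq> X" "X \<subseteq> monomial_span N (non_member c W)"
  shows "Idl\<^bsub>poly_ring N\<^esub> X = monomial_span N (non_member c W)"
proof -
  have "X \<subseteq> polys N" using X(2) by (auto simp: monomial_span_def)
  then have "Idl\<^bsub>poly_ring N\<^esub> X = ideal_span X \<inter> polys N" by (rule genideal_poly_ring)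
  also have "\<dots> = monomial_span N (non_member c W)"
  proof (rule monomial_span_eq_span[OF up_closed_non_member[OF W] X(2)])
    fix u assume u: "u \<in> monomials N" "non_member c W u"
    then have "single (restr {..<c} u) 1 \<in> ideal_span X"
      using X(1) restr_monomials by (intro ideal_span_base) (auto simp: monomial_poly_def)
    then have "single (restr (- {..<c}) u) 1 * single (restr {..<c} u) 1 \<in> ideal_span X"
      by (rule span_mult_left)
    then show "single u 1 \<in> ideal_span X" by (simp only: mult_single restr_split mult_1)
  qed
  finally show ?thesis .
qed

lemma monomial_poly_cylinder:
  "c \<le> N \<Longrightarrow> monomial_poly ` {u \<in> monomials c. u \<notin> W} \<subseteq> monomial_span N (non_member c W)"
  using monomials_mono[of c N] by (auto simp: monomial_poly_def single_in_monomial_span restr_id_monomials)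

lemma monomial_ideal_cylinder:
  assumes "order_ideal c W" "c \<le> N"
  shows "monomial_ideal N (monomial_span N (non_member c W) :: 'k::field polynomial set)"
  using monomial_span_cylinder[OF assms order_refl monomial_poly_cylinder[OF assms(2)]] monomials_mono[OF assms(2)]
  unfolding monomial_ideal_def by (intro exI[of _ "{u \<in> monomials c. u \<notin> W}"]) auto

lemma homogeneous_ideal_cylinder:
  assumes "order_ideal c W" "c \<le> N"
  shows "homogeneous_ideal N (monomial_span N (non_member c W) :: 'k::field polynomial set)"
  unfolding homogeneous_ideal_def
proof (intro exI conjI)
  let ?X = "monomial_poly ` {u \<in> monomials c. u \<notin> W} :: 'k polynomial set"
  show "monomial_span N (non_member c W) = Idl\<^bsub>poly_ring N\<^esub> ?X"
    by (rule monomial_span_cylinder[OF assms order_refl monomial_poly_cylinder[OF assms(2)], symmetric])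
  show "?X \<subseteq> polys N" using monomials_mono[OF assms(2)] by (auto simp: polys_def monomial_poly_def)
  show "\<forall>f\<in>?X. \<exists>q. homogeneous q f" by (auto simp: homogeneous_def monomial_poly_def)
qed

text \<open>Without socle each \<open>w\<close> in \<open>W\<close> has a multiple
  \<open>w x_i\<close> in \<open>W\<close>, and then the smaller or equal \<open>w x_(c-1)\<close>
  is in \<open>W\<close> too; so \<open>W\<close> absorbs powers of \<open>x_(c-1)\<close>. The
  parts of \<open>u\<close> and \<open>v\<close> in the first \<open>c\<close> variables may differ
  in degree, and such powers make the degrees equal without disturbing the lexicographic
  comparison.\<close>

lemma lexsegment_cylinder:
  assumes W: "order_ideal c W" "lex_closed c W" and c: "1 \<le> c" "c \<le> N"
    and nosoc: "\<And>w. w \<in> W \<Longrightarrow> \<exists>i<c. w + var i \<in> W"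
  shows "lexsegment_ideal N (monomial_span N (non_member c W) :: 'k::field polynomial set)"
  unfolding lexsegment_ideal_def
proof (intro conjI ballI impI)
  show "monomial_ideal N (monomial_span N (non_member c W) :: 'k polynomial set)"
    by (rule monomial_ideal_cylinder[OF W(1) c(2)])
  fix u v assume uv: "u \<in> monomials N" "v \<in> monomials N"
    and a: "monomial_poly u \<in> (monomial_span N (non_member c W) :: 'k polynomial set) \<and> mdeg v = mdeg u \<and> lex_less u v"
  let ?u = "restr {..<c} u" and ?v = "restr {..<c} v" and ?z = "\<lambda>e. single (c - 1) e :: monomial"
  have u: "?u \<notin> W" and lt: "u < v"
    using a uv by (auto simp: monomial_poly_def single_in_monomial_span lex_less_iff_less)
  have Wc: "W \<subseteq> monomials c" using W(1) by (simp add: order_ideal_def)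
  \<comment> \<open>A reversed comparison has its first difference before \<open>c - 1\<close>,
    where it reverses \<open>u < v\<close>, or at \<open>c - 1\<close>, where it contradicts the
    equal degrees.\<close>
  have le: "?u + ?z e \<le> ?v + ?z f" if deg: "mdeg ?u + e = mdeg ?v + f" for e f
  proof (rule ccontr)
    assume "\<not> ?thesis"
    then have "?v + ?z f < ?u + ?z e" by simp
    then obtain j where j: "lookup (?v + ?z f) j < lookup (?u + ?z e) j"
        "\<And>l. l < j \<Longrightarrow> lookup (?v + ?z f) l = lookup (?u + ?z e) l"
      by (auto simp: monomial_less_iff)
    have jc: "j < c"
      using j(1) c(1) by (cases "j < c") (auto simp: lookup_add lookup_restr lookup_single when_def split: if_splits)
    show False
    proof (cases "j = c - 1")
      case True
      let ?x = "?v + ?z f" and ?y = "?u + ?z e"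
      have "keys ?x \<subseteq> {..<c}" "keys ?y \<subseteq> {..<c}"
        using keys_single_subset[of "c - 1"] c(1) by (auto simp: keys_add_nat keys_restr split: if_splits)
      then have "mdeg ?x = (\<Sum>l<c. lookup ?x l)" "mdeg ?y = (\<Sum>l<c. lookup ?y l)"
        by (simp_all add: mdeg_eq_sum del: mdeg_add)
      moreover have "(\<Sum>l<c. lookup ?x l) < (\<Sum>l<c. lookup ?y l)"
      proof (rule sum_strict_mono_ex1)
        have "lookup ?x l \<le> lookup ?y l" if "l < c" for l
        proof (cases "l = j")
          case True then show ?thesis using j(1) by (simp add: less_imp_le)
        next
          case False
          then have "l < j" using that \<open>j = c - 1\<close> by simp
          then show ?thesis using j(2) by simp
        qed
        then show "\<forall>l\<in>{..<c}. lookup ?x l \<le> lookup ?y l" by auto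
        show "\<exists>l\<in>{..<c}. lookup ?x l < lookup ?y l" using j(1) jc by auto
      qed simp
      ultimately show False using deg by simp
    next
      case False
      have "lookup v j < lookup u j"
        using j(1) jc False by (simp add: lookup_add lookup_restr lookup_single)
      moreover have "lookup v l = lookup u l" if "l < j" for l
        using j(2)[OF that] that jc False by (simp add: lookup_add lookup_restr lookup_single when_def split: if_splits)
      ultimately have "v < u" by (auto simp: monomial_less_iff)
      then show False using lt by simp
    qed
  qed
  have zW: "w + ?z e \<in> W" if "w \<in> W" for w e
  proof (induction e)
    case (Suc e)
    obtain i where i: "i < c" "(w + ?z e) + var i \<in> W" using nosoc[OF Suc] by blast
    have "(w + ?z e) + var (c - 1) \<in> W"
    proof (cases "i = c - 1")
      case False
      then have "(w + ?z e) + var (c - 1) < (w + ?z e) + var i" using i(1) by (simp add: var_less_iff)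
      moreover have "(w + ?z e) + var (c - 1) \<in> monomials c"
      proof (rule monomials_add)
        show "w + ?z e \<in> monomials c" using Suc Wc by blast
        show "var (c - 1) \<in> monomials c" using c(1) by (simp add: monomials_def)
      qed
      ultimately show ?thesis using W(2) i(2) unfolding lex_closed_def by fastforce
    qed (use i in simp)
    moreover have "?z (Suc e) = ?z e + var (c - 1)" by (simp add: var_def single_add[symmetric])
    ultimately show ?case by (simp add: add.assoc)
  qed (use that in simp)
  have zm: "?u + ?z e \<in> monomials c" for e
    using c(1) by (auto simp: monomials_def keys_add_nat keys_restr split: if_splits)
  have lexc: "x \<in> W" if "y \<in> W" "x \<in> monomials c" "mdeg x = mdeg y" "x \<le> y" for x y
    using W(2) that unfolding lex_closed_def by (metis order_le_less)
  have "?v \<notin> W"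
  proof
    assume v: "?v \<in> W"
    \<comment> \<open>By truncated subtraction at most one of \<open>e\<close> and \<open>f\<close>
      is nonzero: the part of lower degree is padded.\<close>
    define e where "e = mdeg ?v - mdeg ?u"
    define f where "f = mdeg ?u - mdeg ?v"
    have d: "mdeg ?u + e = mdeg ?v + f" by (simp add: e_def f_def)
    have "?u + ?z e \<in> W" using lexc[OF zW[OF v, of f] zm[of e]] le[OF d] d by simp
    then have "?z e + ?u \<in> W" by (simp add: add.commute)
    then show False using order_ideal_down[OF W(1)] u by blast
  qed
  then show "monomial_poly v \<in> (monomial_span N (non_member c W) :: 'k polynomial set)"
    using uv by (simp add: monomial_poly_def single_in_monomial_span)
qed

text \<open>Slicing by the exponent of an additional free variable turns the counting function into
  its partial sums.\<close>

lemma card_cylinder: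
  "card {u \<in> mons {..<c + r} q. restr {..<c} u \<in> W} =
    ((\<lambda>h q. \<Sum>p\<le>q. h p) ^^ r) (\<lambda>q. card (W \<inter> mons {..<c} q)) q"
proof (induction r arbitrary: q)
  case 0
  have "{u \<in> mons {..<c + 0} q. restr {..<c} u \<in> W} = W \<inter> mons {..<c} q"
    by (auto simp: in_mons_iff restr_id_monomials)
  then show ?case by simp
next
  case (Suc r)
  let ?X = "{..<c + Suc r}" and ?k = "c + r"
  let ?D = "\<lambda>r q. {u \<in> mons {..<c + r} q. restr {..<c} u \<in> W}"
  have X: "?X - {?k} = {..<c + r}" "?k \<in> ?X" by auto
  have sl: "slice ?k j (?D (Suc r) q) = ?D r (q - j)" if "j \<le> q" for j
  proof -
    have "restr {..<c} (w + single ?k j) = restr {..<c} w" for w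
      by (simp add: restr_add restr_zero)
    then have "slice ?k j (?D (Suc r) q) = {w \<in> slice ?k j (mons ?X q). restr {..<c} w \<in> W}"
      by (auto simp: slice_def)
    then show ?thesis using slice_mons_eq[OF X(2) that] X(1) by simp
  qed
  have "card (?D (Suc r) q) = (\<Sum>j\<le>q. card (slice ?k j (?D (Suc r) q)))"
    by (rule card_slices[of ?X]) auto
  also have "\<dots> = (\<Sum>j\<le>q. card (?D r (q - j)))" using sl by simp
  also have "\<dots> = (\<Sum>p\<le>q. card (?D r p))" by (rule sum_flip)
  finally show ?case using Suc.IH by simp
qed

lemma std_monomial_span:
  "std_monomials N (monomial_span N (non_member c W) :: 'k::field polynomial set) q =
    {u \<in> mons {..<N} q. restr {..<c} u \<in> W}"
  by (auto simp: std_monomials_def leads_monomial_span in_mons_iff)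

lemma indet_mult_keys: "keys (indet j * f) = (+) (var j) ` keys f" for f :: "'k::field polynomial"
  unfolding indet_def monomial_poly_def var_def[symmetric] by (rule keys_single_mult) simp

text \<open>The free variables form a regular list of length \<open>r\<close>. Modulo them the
  monomial \<open>w\<close> is a nonzero socle element, so no longer regular list exists.\<close>

theorem depth_cylinder:
  fixes W :: "monomial set"
  assumes W: "order_ideal c W" and n: "n = c + r"
    and w: "w \<in> W" "\<And>i. i < c \<Longrightarrow> w + var i \<notin> W"
  shows "depth n (monomial_span n (non_member c W) :: 'k::field polynomial set) = enat r"
proof -
  let ?M = "monomial_span n (non_member c W) :: 'k polynomial set"
  have cn: "c \<le> n" using n by simp
  have M: "rel_ideal n ?M" by (rule graded_rel_ideal[OF monomial_span_graded[OF up_closed_non_member[OF W]]])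
  have Mp: "?M \<subseteq> polys n" by (auto simp: monomial_span_def)
  \<comment> \<open>\<open>P j\<close> describes the monomials of the ideal after the free variables
    with indices from \<open>c\<close> to \<open>j - 1\<close> have been added.\<close>
  define P where "P j u \<longleftrightarrow> restr {..<c} u \<notin> W \<or> (\<exists>i. c \<le> i \<and> i < j \<and> i \<in> keys u)" for j u
  have P: "up_closed (P j)" for j
    unfolding up_closed_def P_def using up_closed_non_member[OF W, unfolded up_closed_def] by (auto simp: keys_add_nat)
  have sp: "ideal_span (?M \<union> indet ` {c..<j}) \<inter> polys n = monomial_span n (P j)" if j: "j \<le> n" for j
  proof (rule monomial_span_eq_span[OF P])
    show "?M \<union> indet ` {c..<j} \<subseteq> monomial_span n (P j)"
    proof
      fix f assume "f \<in> ?M \<union> indet ` {c..<j}"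
      then consider "f \<in> ?M" | i where "c \<le> i" "i < j" "f = indet i" by auto
      then show "f \<in> monomial_span n (P j)"
      proof cases
        case 2
        then have "i < n" using j by simp
        moreover have "P j (single i 1)" using 2 by (auto simp: P_def)
        ultimately show ?thesis using 2
          by (simp add: indet_def monomial_poly_def single_in_monomial_span monomials_def)
      qed (auto simp: monomial_span_def P_def)
    qed
    fix u assume u: "u \<in> monomials n" "P j u"
    then consider "restr {..<c} u \<notin> W" | i where "c \<le> i" "i < j" "i \<in> keys u" by (auto simp: P_def)
    then show "single u 1 \<in> ideal_span (?M \<union> indet ` {c..<j})"
    proof cases
      case 1
      then have "single u 1 \<in> ?M" using u by (simp add: single_in_monomial_span)
      then show ?thesis by (intro ideal_span_base) simp
    next
      case 2
      then obtain u' where u': "u = u' + var i" using monomial_split_var by blast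
      have "single u' 1 * indet i \<in> ideal_span (?M \<union> indet ` {c..<j})"
        using 2 by (intro span_mult_left ideal_span_base) auto
      then show ?thesis by (simp add: u' indet_def monomial_poly_def mult_single var_def)
    qed
  qed
  define ys where "ys = map (indet :: nat \<Rightarrow> 'k polynomial) [c..<n]"
  have ys: "set ys = indet ` {c..<n}" "length ys = r" by (auto simp: ys_def n)
  have ysp: "set ys \<subseteq> polys n" using indet_polys unfolding ys by auto
  have ysi: "set ys \<subseteq> irrelevant n"
  proof
    fix y assume "y \<in> set ys"
    then have "y \<in> indet ` {..<n}" unfolding ys by auto
    then show "y \<in> irrelevant n" by (rule ideal_span_base)
  qed
  have reg: "regular_list ?M ys" unfolding regular_list_nth
  proof (intro allI impI)
    fix i assume i: "i < length ys"
    define j where "j = c + i"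
    have j: "j < n" "ys ! i = indet j" "set (take i ys) = indet ` {c..<j}"
      using i ys(2) n by (auto simp: ys_def j_def take_map take_upt)
    have "indet l \<in> polys n" if "l < j" for l using that j(1) by (intro indet_polys) simp
    then have jp: "?M \<union> indet ` {c..<j} \<subseteq> polys n" using Mp by auto
    show "nonzerodiv (ys ! i) (ideal_span (?M \<union> set (take i ys)))"
      unfolding j(2,3) nonzerodiv_iff_polys[OF indet_polys[OF j(1)] jp]
    proof (intro ballI impI)
      fix g :: "'k polynomial" assume g: "g \<in> polys n" and "indet j * g \<in> ideal_span (?M \<union> indet ` {c..<j})"
      then have "indet j * g \<in> monomial_span n (P j)"
        using sp[of j] polys_closed(5)[OF indet_polys[OF j(1)] g] j(1) by auto
      then have "P j (var j + u)" if "u \<in> keys g" for u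
        using that by (auto simp: monomial_span_def indet_mult_keys)
      \<comment> \<open>Multiplication by \<open>x_j\<close> changes neither the part in the first
        \<open>c\<close> variables nor the exponents at indices from \<open>c\<close> to
        \<open>j - 1\<close>.\<close>
      moreover have "P j (var j + u) \<longleftrightarrow> P j u" for u
        by (auto simp: P_def restr_add keys_add_nat restr_zero j_def)
      ultimately have "g \<in> monomial_span n (P j)" using g by (simp add: monomial_span_def)
      then show "g \<in> ideal_span (?M \<union> indet ` {c..<j})" using sp[of j] j(1) by auto
    qed
  qed
  have wc: "w \<in> monomials c" using W w(1) by (auto simp: order_ideal_def)
  have nP: "\<not> P n u" if "u \<in> W" for u
  proof -
    have "u \<in> monomials c" using W that by (auto simp: order_ideal_def)
    then show ?thesis using that by (auto simp: P_def restr_id_monomials monomials_def)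
  qed
  have nin: "single u 1 \<notin> ideal_span (?M \<union> set ys)" if "u \<in> W" for u
  proof
    assume a: "single u 1 \<in> ideal_span (?M \<union> set ys)"
    have "u \<in> monomials n" using W that monomials_mono[OF cn] by (auto simp: order_ideal_def)
    then have "single u (1 :: 'k) \<in> polys n" by (simp add: polys_def)
    then have "single u (1 :: 'k) \<in> monomial_span n (P n)" using a sp[of n] unfolding ys by blast
    then show False using nP[OF that] by (simp add: single_in_monomial_span)
  qed
  have "0 \<in> W" using order_ideal_down[OF W, of w 0] w(1) by simp
  then have one: "1 \<notin> ideal_span (?M \<union> set ys)" using nin[of 0] by simp
  have "depth n ?M = enat (length ys)"
  proof (rule depth_eqI[OF M ysp ysi reg one])
    fix hs :: "'k polynomial list"
    assume hs: "length hs = Suc (length ys)" "set hs \<subseteq> polys n" "set hs \<subseteq> irrelevant n"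
    show "\<not> regular_list ?M hs"
    proof
      assume r: "regular_list ?M hs"
      have "no_socle (indet ` {..<n}) (ideal_span (set ys \<union> ?M))"
      proof (rule no_socle_if_longer_regular_list[OF r hs(1) _ hs(3) reg ysi])
        fix p and j :: nat assume "p \<in> ?M \<union> set hs \<union> set ys" "n \<le> j"
        then have "p \<in> polys n" "{j} \<inter> {..<n} = {}" using Mp hs(2) ysp by auto
        then show "free_of {j} p" by (rule free_of_polys)
      qed
      moreover have "indet i * single w 1 \<in> ideal_span (set ys \<union> ?M)" if i: "i < n" for i
      proof (cases "i < c")
        case True
        have m: "var i + w \<in> monomials c" using True wc by (auto simp: monomials_def keys_add_nat)
        then have "var i + w \<in> monomials n" using monomials_mono[OF cn] by blast
        moreover have "restr {..<c} (var i + w) \<notin> W"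
          using w(2)[OF True] m by (simp add: restr_id_monomials add.commute)
        ultimately have "single (var i + w) 1 \<in> ?M" by (simp add: single_in_monomial_span)
        then have "indet i * single w 1 \<in> ?M" by (simp add: indet_def monomial_poly_def mult_single var_def)
        then show ?thesis by (intro ideal_span_base) simp
      next
        case False
        then show ?thesis using i by (intro span_mult_right ideal_span_base) (simp add: ys)
      qed
      ultimately have "single w 1 \<in> ideal_span (set ys \<union> ?M)" by (auto simp: no_socle_def)
      then show False using nin[OF w(1)] by (simp add: Un_commute)
    qed
  qed
  then show ?thesis by (simp add: ys)
qed

section \<open>Depths realised by cylinders\<close>

lemma cylinder_in_depth_set:
  assumes n: "n = c + r" and c: "1 \<le> c" and W: "order_ideal c W" "lex_closed c W"
    and h: "\<And>q. card (W \<inter> mons {..<c} q) = h q" "h 0 = 1"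
    and H: "((\<lambda>h q. \<Sum>p\<le>q. h p) ^^ r) h = H"
    and noncrit: "\<not> critical TYPE('k::field) n H"
  shows "r \<in> depth_set TYPE('k) n H"
proof -
  let ?M = "\<lambda>N. monomial_span N (non_member c W) :: 'k polynomial set"
  have cn: "c \<le> n" using n by simp
  have gr: "graded_ideal n (?M n)" by (rule monomial_span_graded[OF up_closed_non_member[OF W(1)]])
  have "W \<inter> mons {..<c} 0 \<noteq> {}" using h(1)[of 0] h(2) by auto
  then have 0: "0 \<in> W" by (auto simp: in_mons_iff mdeg_eq_0_iff)
  have one: "1 \<notin> ?M n"
  proof
    assume "1 \<in> ?M n"
    moreover have "restr {..<c} 0 = 0" by (simp add: restr_zero)
    ultimately show False using 0 by (auto simp: monomial_span_def)
  qed
  have "card (std_monomials n (?M n) q) = H q" for q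
    unfolding std_monomial_span n card_cylinder h(1) H by (rule refl)
  then have hf: "hilbert_function n (?M n) = H"
    using hilbert_function_eq_card_std[OF graded_rel_ideal[OF gr] gr one] by auto
  have "\<exists>w\<in>W. \<forall>i<c. w + var i \<notin> W"
  proof (rule ccontr)
    assume "\<not> ?thesis"
    then have ns: "\<And>w. w \<in> W \<Longrightarrow> \<exists>i<c. w + var i \<in> W" by blast
    have lex: "lexsegment_ideal N (?M N)" if "c \<le> N" for N
      by (rule lexsegment_cylinder[OF W c that ns])
    have "universal_lexsegment_ideal n (?M n)" unfolding universal_lexsegment_ideal_def
    proof (intro conjI allI impI)
      show "lexsegment_ideal n (?M n)" by (rule lex[OF cn])
      fix m :: nat
      \<comment> \<open>Extending to more variables gives the cylinder over the same
        \<open>W\<close>, so one lemma treats every \<open>m\<close>.\<close>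
      have "?M n \<subseteq> ?M (n + m)"
        using monomials_mono[of n "n + m"] by (auto simp: monomial_span_def polys_def)
      then have "Idl\<^bsub>poly_ring (n + m)\<^esub> (?M n) = ?M (n + m)"
        using cn monomial_poly_cylinder[OF cn] by (intro monomial_span_cylinder[OF W(1)]) auto
      then show "lexsegment_ideal (n + m) (Idl\<^bsub>poly_ring (n + m)\<^esub> (?M n))" using lex[of "n + m"] cn by simp
    qed
    then have "critical TYPE('k) n H" using lex[OF cn] hf unfolding critical_def by blast
    then show False using noncrit by simp
  qed
  then obtain w where "w \<in> W" "\<And>i. i < c \<Longrightarrow> w + var i \<notin> W" by blast
  then have "depth n (?M n) = enat r" by (rule depth_cylinder[OF W(1) n])
  then show ?thesis using hf homogeneous_ideal_cylinder[OF W(1) cn] n unfolding depth_set_def by auto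
qed

text \<open>If \<open>H\<close> arises from \<open>h\<close> by \<open>r\<close> summations, the
  value at 1 gives \<open>h 1 + r = H 1\<close>, so that \<open>h\<close> fits into
  \<open>n - r\<close> variables.\<close>

lemma partial_sums_0_1:
  fixes h :: "nat \<Rightarrow> nat"
  assumes "h 0 = 1"
  shows "((\<lambda>h q. \<Sum>p\<le>q. h p) ^^ r) h 0 = 1 \<and> ((\<lambda>h q. \<Sum>p\<le>q. h p) ^^ r) h 1 = h 1 + r"
  by (induction r) (use assms in auto)

text \<open>Multiplication by a variable is compatible with the order of monomials, so it carries
  leading monomials to leading monomials.\<close>

lemma order_ideal_std:
  assumes V: "graded_ideal n V"
  shows "order_ideal n {u \<in> monomials n. u \<notin> leads V}"
  unfolding order_ideal_def
proof (intro conjI allI impI)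
  fix u i assume a: "u + var i \<in> {u \<in> monomials n. u \<notin> leads V}"
  then have m: "u \<in> monomials n" "i < n" by (auto simp: monomials_def keys_add_nat)
  moreover have "u \<notin> leads V"
  proof
    assume "u \<in> leads V"
    then obtain f where f: "f \<in> V" "f \<noteq> 0" "lead f = u" by (auto simp: leads_def)
    have "indet i * f \<in> V" using V f(1) indet_polys[OF m(2)] by (auto simp: graded_ideal_def)
    moreover have "lead (indet i * f) = u + var i"
    proof (rule leadI)
      show "u + var i \<in> keys (indet i * f)"
        using lead_in_keys[OF f(2)] f(3) by (auto simp: indet_mult_keys add.commute)
      fix v assume "v \<in> keys (indet i * f)"
      then obtain x where "x \<in> keys f" "v = x + var i" by (auto simp: indet_mult_keys add.commute)
      then show "v \<le> u + var i" using le_lead[of x f] f(3) by (simp add: add_right_mono)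
    qed
    moreover have "indet i * f \<noteq> 0" using f(2) lead_in_keys[OF f(2)] indet_mult_keys[of i f] by force
    ultimately show False using a by (force simp: leads_def)
  qed
  ultimately show "u \<in> {u \<in> monomials n. u \<notin> leads V}" by simp
qed simp

theorem theorem2p1:
  fixes n :: nat and H :: "nat \<Rightarrow> nat"
  assumes "n \<ge> 1"
    and "H 0 = 1"
    and "H 1 \<le> n"
    and "\<forall>q\<ge>1. H (q + 1) \<le> macaulay_upper (H q) q"
    and "\<not> critical TYPE('k::field) n H"
  shows "\<exists>b. b \<in> depth_set TYPE('k) n H \<and>
             (\<forall>r\<in>depth_set TYPE('k) n H. r \<le> b) \<and>
             depth_set TYPE('k) n H = {0..b}"
proof -
  let ?D = "depth_set TYPE('k) n H" and ?S = "\<lambda>h q. \<Sum>p\<le>q. h p :: nat"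
  have fin: "finite ?D" by (rule finite_subset[of _ "{..n}"]) (auto simp: depth_set_def)
  have "0 \<in> ?D"
  proof -
    obtain W where "order_ideal n W" "lex_closed n W" "\<And>q. card (W \<inter> mons {..<n} q) = H q"
      using lex_order_ideal_exists[of n H] assms by auto
    then show ?thesis using assms by (intro cylinder_in_depth_set[where c = n and W = W and h = H]) auto
  qed
  define b where "b = Max ?D"
  have b: "b \<in> ?D" "\<And>r. r \<in> ?D \<Longrightarrow> r \<le> b" 
    using Max_in[OF fin] Max_ge[OF fin] \<open>0 \<in> ?D\<close> by (auto simp: b_def)
  have "r \<in> ?D" if r: "r < b" for r
  proof -
    obtain I :: "'k polynomial set" where I: "homogeneous_ideal n I" "hilbert_function n I = H"
        "depth n I = enat b" and bn: "b \<le> n"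
      using b(1) by (auto simp: depth_set_def)
    have gr: "graded_ideal n I" by (rule homogeneous_ideal_graded[OF I(1)])
    note rel = graded_rel_ideal[OF gr]
    have one: "1 \<notin> I" using hilbert_function_trivial[OF rel] I(2) assms(2) by auto
    have HI: "card (std_monomials n I q) = H q" for q
      using hilbert_function_eq_card_std[OF rel gr one] I(2) by auto
    obtain fs where fs: "length fs = r" "set fs \<subseteq> polys n" "set fs \<subseteq> irrelevant n" "regular_list I fs"
      using depth_regular_list[OF rel I(3), of r] r by auto
    have "regular_list I (map (generic_form n) [n..<n + r])"
    proof (rule regular_list_generic_forms[OF fs(4)])
      fix j p assume "j \<in> set [n..<n + r]" "p \<in> I \<union> set fs"
      then have "p \<in> polys n" "{j} \<inter> {..<n} = {}" using fs(2) rel by (auto simp: rel_ideal_def)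
      then show "free_of {j} p" by (rule free_of_polys)
    qed (use fs in auto)
    then obtain V :: "'k polynomial fract polynomial set" where V: "graded_ideal n V"
        "card (std_monomials n V 0) = card (std_monomials n I 0)"
        "(?S ^^ r) (\<lambda>q. card (std_monomials n V q)) = (\<lambda>q. card (std_monomials n I q))"
      using regular_list_hilbert[OF gr, of "[n..<n + r]"] by auto
    define h where "h = (\<lambda>q. card (std_monomials n V q))"
    have h: "h 0 = 1" "(?S ^^ r) h = H" using V(2,3) HI assms(2) by (simp_all add: h_def)
    have h1: "h 1 + r \<le> n" using partial_sums_0_1[of h r] h assms(3) by simp
    let ?W = "{u \<in> monomials n. u \<notin> leads V}"
    have WV: "?W \<inter> mons {..<n} q = std_monomials n V q" for q by (auto simp: std_monomials_def in_mons_iff)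
    \<comment> \<open>The bound is applied in all \<open>n\<close> variables over the fraction
      field. It involves only numbers, so the lexsegment ideal can then be built over
      \<open>K\<close> in \<open>n - r\<close> variables.\<close>
    have mac: "h (Suc q) \<le> macaulay_upper (h q) q" if "q \<ge> 1" for q
      using order_ideal_macaulay[OF assms(1) order_ideal_std[OF V(1)] that] unfolding WV h_def .
    have c: "1 \<le> n - r" "n = (n - r) + r" using r bn by auto
    have "h 1 \<le> n - r" using h1 by simp
    then obtain W where "order_ideal (n - r) W" "lex_closed (n - r) W" "\<And>q. card (W \<inter> mons {..<n - r} q) = h q"
      using lex_order_ideal_exists[OF c(1) h(1) _ mac] by auto
    then show ?thesis using c h assms(5) by (intro cylinder_in_depth_set[where c = "n - r" and W = W and h = h]) auto
  qed
  then have "?D = {0..b}" using b by (auto simp: order_le_less)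
  then show ?thesis using b by blast
qed

end
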